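(* Let $n\ge1$, $a\in\mathbb{R}^n$ with $a_i>0$ for all $i$, $s>0$, $k\in\{1,\dots,n\}$, and let $U(x):=(1-a_k^{1/2}x_k)\,u_s(x)$ for $x\in\mathbb{R}^n$. Then, for any $x\in E_a$, $$\frac{(-\Delta)^sU(x)}{k_{n,s}\,\Gamma(1+s)}=J_0-\big(J_0+2sJ_1^{(k)}\big)a_k^{1/2}x_k .$$
   Context: Let $A=\mathrm{diag}(a_1,\dots,a_n)$, $|x|_a:=\sqrt{Ax\cdot x}$, $E_a:=\{x\in\mathbb{R}^n:|x|_a<1\}$, $u_s(x):=(1-|x|_a^2)_+^s$. $\mu(d\theta)=\dfrac{d\theta}{|\theta|^{n+2s}|A\theta|}$, where $d\theta$ is the surface measure of $\partial E_a$ (counting measure if $n=1$); $J_0:=\int_{\partial E_a}\mu(d\theta)$ and $J_i^{(k)}:=a_k^i\int_{\partial E_a}\theta_k^{2i}\,\mu(d\theta)$. $k_{n,s}:=\dfrac{2^{2s-1}\Gamma(n/2+s)}{\pi^{n/2}}$. $\mathbb{N}=\{1,2,\dots\}$. Pointwise fractional Laplacian: for $s>0$, $$(-\Delta)^s u(x)=\frac{c_{n,m,s}}{2}\int_{\mathbb{R}^n}\frac{\delta_m u(x,y)}{|y|^{n+2s}}\,dy,\qquad \delta_m u(x,y):=\sum_{k=-m}^m(-1)^k\binom{2m}{m-k}u(x+ky),$$ where $m\in\mathbb{N}$ is any integer with $m>s$ (the value does not depend on this choice), and $c_{n,m,s}$ is the positive constant $$c_{n,m,s}=\begin{cases}\dfrac{4^{s}\Gamma(\frac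 n2+s)}{\pi^{n/2}\Gamma(-s)}\Big(\sum_{k=1}^{m}(-1)^{k}\binom{2m}{m-k}k^{2s}\Big)^{-1}, & s\in(0,m)\setminus\mathbb{N},\\[2mm] \dfrac{4^{s}\Gamma(\frac n2+s)\,s!}{2\pi^{n/2}}\Big(\sum_{k=2}^m(-1)^{k-s+1}\binom{2m}{m-k}k^{2s}\ln k\Big)^{-1}, & s\in\{1,\dots,m-1\}.\end{cases}$$ *)

theory Defs
  imports "HOL-Analysis.Analysis"
begin

section \<open>Surface measure\<close>

definition set_coord :: "real^'n \<Rightarrow> 'n \<Rightarrow> real \<Rightarrow> real^'n" where
  "set_coord y i t = (\<chi> j. if j = i then t else y $ j)"

text \<open>
  Lebesgue measure on the coordinate hyperplane \<open>{y. y $ i = 0}\<close>, regarded as a measure on the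
  ambient space. In ambient dimension one the index set \<open>- {i}\<close> is empty, and this is the unit
  point mass at the origin.
\<close>

definition hyperplane_lborel :: "'n \<Rightarrow> (real^'n) measure" where
  "hyperplane_lborel i =
     distr (\<Pi>\<^sub>M j\<in>- {i}. lborel) borel (\<lambda>y. \<chi> j. if j = i then 0 else y j)"

text \<open>
  \<open>C1_graph_patch S i U V g G\<close>: inside the open set \<open>U\<close>, the set \<open>S\<close> is the graph
  \<open>x $ i = g y\<close> of a \<open>C\<^sup>1\<close> function over the relatively open part
  \<open>{y \<in> V. y $ i = 0}\<close> of the coordinate hyperplane. For convenience \<open>g\<close> is given on an open
  subset \<open>V\<close> of the whole space, with gradient \<open>G\<close>; only its values on the hyperplane matter.
\<close>

definition C1_graph_patch ::
  "(real^'n) set \<Rightarrow> 'n \<Rightarrow> (real^'n) set \<Rightarrow> (real^'n) set \<Rightarrow> (real^'n \<Rightarrow> real) \<Rightarrow>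
    (real^'n \<Rightarrow> real^'n) \<Rightarrow> bool"
where
  "C1_graph_patch S i U V g G \<longleftrightarrow>
     open U \<and> open V \<and>
     (\<forall>y\<in>V. (g has_derivative (\<lambda>h. G y \<bullet> h)) (at y)) \<and> continuous_on V G \<and>
     S \<inter> U = {set_coord y i (g y) | y. y \<in> V \<and> y $ i = 0}"

text \<open>
  The surface measure of a \<open>C\<^sup>1\<close> hypersurface \<open>S\<close>, as a Borel measure of the ambient space
  concentrated on \<open>S\<close>: on each piece of \<open>S\<close> that is a graph over a coordinate hyperplane, the
  surface element is \<open>sqrt (1 + \<bar>\<nabla>g\<bar>\<^sup>2) dy\<close>, the gradient being taken in the directions of the
  hyperplane. Such pieces cover a \<open>C\<^sup>1\<close> hypersurface, so the measure is determined uniquely.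
  If the ambient dimension is one and \<open>S\<close> is discrete, this is the counting measure on \<open>S\<close>.
\<close>

definition is_surface_measure :: "(real^'n) set \<Rightarrow> (real^'n) measure \<Rightarrow> bool" where
  "is_surface_measure S \<sigma> \<longleftrightarrow>
     sets \<sigma> = sets borel \<and> - S \<in> null_sets \<sigma> \<and>
     (\<forall>i U V g G. C1_graph_patch S i U V g G \<longrightarrow>
       (\<forall>B\<in>sets borel. B \<subseteq> S \<inter> U \<longrightarrow>
         emeasure \<sigma> B =
           (\<integral>\<^sup>+ y\<in>V. indicator B (set_coord y i (g y)) *
             ennreal (sqrt (1 + (\<Sum>j\<in>- {i}. (G y $ j)\<^sup>2))) \<partial>hyperplane_lborel i)))"

definition surface_measure :: "(real^'n) set \<Rightarrow> (real^'n) measure" where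
  "surface_measure S = (THE \<sigma>. is_surface_measure S \<sigma>)"

section \<open>The pointwise fractional Laplacian\<close>

definition finite_diff :: "nat \<Rightarrow> (real^'n \<Rightarrow> real) \<Rightarrow> real^'n \<Rightarrow> real^'n \<Rightarrow> real" where
  "finite_diff m u x y =
     (\<Sum>k\<in>{- int m..int m}.
        (- 1) powi k * real ((2 * m) choose nat (int m - k)) * u (x + real_of_int k *\<^sub>R y))"

text \<open>In the branch of integer \<open>s\<close>, the exponent and the factorial use \<open>\<lfloor>s\<rfloor> = s\<close>.\<close>

definition frac_const :: "nat \<Rightarrow> nat \<Rightarrow> real \<Rightarrow> real" where
  "frac_const n m s =
     (if s \<notin> \<nat> then
        4 powr s * Gamma (real n / 2 + s) / (pi powr (real n / 2) * Gamma (- s)) *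
        inverse (\<Sum>k=1..m. (- 1) ^ k * real ((2 * m) choose (m - k)) * real k powr (2 * s))
      else
        4 powr s * Gamma (real n / 2 + s) * fact (nat \<lfloor>s\<rfloor>) / (2 * pi powr (real n / 2)) *
        inverse (\<Sum>k=2..m. (- 1) powi (int k - \<lfloor>s\<rfloor> + 1) * real ((2 * m) choose (m - k)) *
                   real k powr (2 * s) * ln (real k)))"

text \<open>
  The order \<open>m\<close> of the finite difference is a parameter; it is meant to be used with \<open>m > s\<close>.
\<close>

definition frac_laplacian :: "nat \<Rightarrow> real \<Rightarrow> (real^'n \<Rightarrow> real) \<Rightarrow> real^'n \<Rightarrow> real" where
  "frac_laplacian m s u x =
     frac_const CARD('n) m s / 2 *
     (\<integral>y. finite_diff m u x y / norm y powr (real CARD('n) + 2 * s) \<partial>lborel)"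

section \<open>Ellipsoids\<close>

definition diag :: "real^'n \<Rightarrow> real^'n^'n" where
  "diag a = (\<chi> i j. if i = j then a $ i else 0)"

definition norm_ell :: "real^'n \<Rightarrow> real^'n \<Rightarrow> real" where
  "norm_ell a x = sqrt ((diag a *v x) \<bullet> x)"

definition ellipsoid :: "real^'n \<Rightarrow> (real^'n) set" where
  "ellipsoid a = {x. norm_ell a x < 1}"

definition u_ell :: "real^'n \<Rightarrow> real \<Rightarrow> real^'n \<Rightarrow> real" where
  "u_ell a s x = (max 0 (1 - (norm_ell a x)\<^sup>2)) powr s"

definition mu_ell :: "real^'n \<Rightarrow> real \<Rightarrow> (real^'n) measure" where
  "mu_ell a s =
     density (surface_measure (frontier (ellipsoid a)))
       (\<lambda>\<theta>. ennreal (1 / (norm \<theta> powr (real CARD('n) + 2 * s) * norm (diag a *v \<theta>))))"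

definition J0 :: "real^'n \<Rightarrow> real \<Rightarrow> real" where
  "J0 a s = (LINT \<theta>:frontier (ellipsoid a)|mu_ell a s. 1)"

definition J :: "real^'n \<Rightarrow> real \<Rightarrow> nat \<Rightarrow> 'n \<Rightarrow> real" where
  "J a s i k = (a $ k) ^ i * (LINT \<theta>:frontier (ellipsoid a)|mu_ell a s. (\<theta> $ k) ^ (2 * i))"

definition k_const :: "nat \<Rightarrow> real \<Rightarrow> real" where
  "k_const n s = 2 powr (2 * s - 1) * Gamma (real n / 2 + s) / pi powr (real n / 2)"

end

theory Submission
  imports Defs "HOL-Complex_Analysis.Complex_Analysis"
begin

text \<open>
  On a line \<open>t \<mapsto> x + t \<theta>\<close> with \<open>\<theta>\<close> on the boundary of the ellipsoid, the quadratic
  \<open>1 - |x + t \<theta>|\<^sub>a\<^sup>2\<close> equals \<open>R\<^sup>2 - (t + b)\<^sup>2\<close>, where \<open>b = A x \<cdot> \<theta>\<close> and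
  \<open>R\<^sup>2 = 1 - |x|\<^sub>a\<^sup>2 + b\<^sup>2\<close>. In the variable \<open>\<tau> = (t + b) / R\<close> the function \<open>u\<^sub>s\<close> is a multiple of
  \<open>(1 - \<tau>\<^sup>2)\<^sub>+\<^sup>s\<close>, and \<open>U\<close> is a combination of this function and of \<open>\<tau> (1 - \<tau>\<^sup>2)\<^sub>+\<^sup>s\<close>. Polar
  coordinates adapted to the ellipsoid therefore reduce the theorem to the line, where both functions
  are treated at once by an exponent \<open>e \<in> {0, 1}\<close>: for \<open>|\<tau>| < 1\<close>, the integral of
  \<open>\<delta>\<^sub>m(\<tau>, t) t\<^sup>-\<^sup>1\<^sup>-\<^sup>2\<^sup>s\<close> over \<open>t > 0\<close> is \<open>((1 + 2 s) \<tau>)\<^sup>e K\<close>, with \<open>K\<close> independent of \<open>\<tau>\<close>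
  (\<open>cap_diff_log_integral\<close>). In a direction \<open>\<theta>\<close> this gives
  \<open>K (1 - \<surd>a\<^sub>k (x\<^sub>k + 2 s b \<theta>\<^sub>k))\<close>. Integrating over \<open>\<theta>\<close>, the mixed moments \<open>\<theta>\<^sub>j \<theta>\<^sub>k\<close> drop
  out by reflection, and what remains is the right-hand side.

  The value of \<open>K\<close> for \<open>s\<close> not an integer comes from a contour integral. The function
  \<open>z\<^sup>e (1 - z)\<^sup>s (1 + z)\<^sup>s\<close> is holomorphic off the two real half-lines where \<open>|z| \<ge> 1\<close>, so its
  difference is holomorphic in the step \<open>t\<close> on the upper half-plane, and there is no singularity at
  \<open>t = 0\<close> to regularise, because the difference vanishes there to order \<open>2 m > 2 s\<close>. On the
  half-lines the boundary values have the constant phase \<open>exp (- \<i> \<pi> s)\<close>, so multiplication by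
  \<open>exp (\<i> \<pi> s)\<close> and passage to imaginary parts removes them and leaves \<open>sin (\<pi> s)\<close> times
  the difference of the truncated power (\<open>ext_diff_boundary\<close>). The only other contribution is that
  of the large arc, which is an explicit limit (\<open>ext_diff_at_infinity\<close>). With \<open>t = e\<^sup>\<xi>\<close> the half-plane
  becomes a strip (\<open>strip_contour_limit\<close>).

  For \<open>s\<close> an integer the same function is a polynomial of degree less than \<open>2 m\<close>, which the
  difference annihilates; the difference of the truncated power is then minus that of the
  complementary part, supported in \<open>|z| \<ge> 1\<close>, and the integral is of Frullani type
  (\<open>frullani_combination\<close>). In both cases \<open>K\<close> is a multiple of the sum whose inverse appears in
  \<open>frac_const\<close>. That this sum is not zero follows from the fact that an exponential sum with
  \<open>m\<close> terms has fewer than \<open>m\<close> real zeros (\<open>exp_sum_zeros\<close>).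

  The surface measure enters through the cone measure of the ellipsoid, for which polar coordinates
  are a formal consequence of homogeneity (\<open>polar_coordinates\<close>). In graph coordinates over a
  coordinate hyperplane the cone measure is computed by substituting in one variable at a time
  (\<open>nn_integral_cone_measure_cap\<close>). Hence the density \<open>|A \<theta>|\<close> turns it into a surface measure, and
  surface measures of the ellipsoid are unique because finitely many open hemispheres cover it
  (\<open>surface_measure_ellipsoid\<close>).
\<close>

section \<open>Symmetric finite differences\<close>

definition dcoef :: "nat \<Rightarrow> int \<Rightarrow> real" where
  "dcoef m k = (- 1) powi k * real ((2 * m) choose nat (int m - k))"

text \<open>
  Pascal's rule turns the sum for \<open>n + 1\<close> into the sum for \<open>n\<close> of the first difference of the
  power, which by the binomial theorem has lower degree.
\<close>

lemma alternating_binomial_power_sum: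
  fixes a :: real
  assumes "j < n"
  shows "(\<Sum>i\<le>n. (- 1) ^ i * real (n choose i) * (a - real i) ^ j) = 0"
  using assms
proof (induction n arbitrary: j)
  case 0
  then show ?case by simp
next
  case (Suc n)
  define h where "h i = (a - real i) ^ j" for i
  have "(\<Sum>i\<le>Suc n. (- 1) ^ i * real (Suc n choose i) * h i)
      = (\<Sum>i\<le>n. (- 1) ^ i * real (n choose i) * h i)
        - (\<Sum>i\<le>n. (- 1) ^ i * real (n choose i) * h (Suc i))"
  proof -
    have "(\<Sum>i\<le>Suc n. (- 1) ^ i * real (Suc n choose i) * h i)
        = h 0 + (\<Sum>i\<le>n. (- 1) ^ Suc i * real (Suc n choose Suc i) * h (Suc i))"
      by (subst sum.atMost_Suc_shift) simp
    also have "\<dots> = (h 0 + (\<Sum>i\<le>n. (- 1) ^ Suc i * real (n choose Suc i) * h (Suc i)))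
        - (\<Sum>i\<le>n. (- 1) ^ i * real (n choose i) * h (Suc i))"
      by (simp add: sum_subtractf[symmetric] sum.distrib[symmetric] algebra_simps sum_negf)
    also have "h 0 + (\<Sum>i\<le>n. (- 1) ^ Suc i * real (n choose Suc i) * h (Suc i))
        = (\<Sum>i\<le>Suc n. (- 1) ^ i * real (n choose i) * h i)"
      by (subst sum.atMost_Suc_shift) simp
    finally show ?thesis by simp
  qed
  also have "\<dots> = (\<Sum>i\<le>n. (- 1) ^ i * real (n choose i) * (h i - h (Suc i)))"
    by (simp add: sum_subtractf[symmetric] algebra_simps)
  also have "\<dots> = (\<Sum>i\<le>n. (- 1) ^ i * real (n choose i) *
                     (- (\<Sum>l<j. real (j choose l) * (a - real i) ^ l * (- 1) ^ (j - l))))"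
  proof (rule sum.cong[OF refl])
    fix i
    have "h (Suc i) = ((a - real i) + (- 1)) ^ j" by (simp add: h_def algebra_simps)
    also have "\<dots> = (\<Sum>l\<le>j. real (j choose l) * (a - real i) ^ l * (- 1) ^ (j - l))"
      by (subst binomial_ring) simp
    also have "\<dots> = (\<Sum>l<j. real (j choose l) * (a - real i) ^ l * (- 1) ^ (j - l)) + h i"
      by (simp add: lessThan_Suc_atMost[symmetric] h_def)
    finally show "(- 1) ^ i * real (n choose i) * (h i - h (Suc i)) = (- 1) ^ i * real (n choose i) *
                     (- (\<Sum>l<j. real (j choose l) * (a - real i) ^ l * (- 1) ^ (j - l)))"
      by simp
  qed
  also have "\<dots> = - (\<Sum>l<j. real (j choose l) * (- 1) ^ (j - l) *
                      (\<Sum>i\<le>n. (- 1) ^ i * real (n choose i) * (a - real i) ^ l))"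
    by (simp add: sum_distrib_left sum_negf mult_ac) (rule sum.swap)
  also have "\<dots> = 0"
    using Suc by (auto intro!: sum.neutral)
  finally show ?case by (simp add: h_def)
qed

lemma dcoef_moments:
  assumes "j < 2 * m"
  shows "(\<Sum>k = - int m..int m. dcoef m k * of_int k ^ j) = 0"
proof -
  have "(\<Sum>k = - int m..int m. dcoef m k * of_int k ^ j)
      = (\<Sum>i\<le>2 * m. dcoef m (int m - int i) * of_int (int m - int i) ^ j)"
    by (rule sum.reindex_bij_witness[of _ "\<lambda>i. int m - int i" "\<lambda>k. nat (int m - k)"]) auto
  also have "\<dots> = (\<Sum>i\<le>2 * m. (- 1) ^ m * ((- 1) ^ i * real ((2 * m) choose i) * (real m - real i) ^ j))"
    by (intro sum.cong refl) (simp add: dcoef_def power_int_diff minus_one_power_iff)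
  also have "\<dots> = 0"
    using alternating_binomial_power_sum[OF assms, of "real m"] by (simp add: sum_distrib_left[symmetric])
  finally show ?thesis .
qed

lemma dcoef_minus [simp]: "k \<in> {- int m..int m} \<Longrightarrow> dcoef m (- k) = dcoef m k"
proof -
  assume k: "k \<in> {- int m..int m}"
  have "nat (int m + k) \<le> 2 * m" and "2 * m - nat (int m + k) = nat (int m - k)"
    using k by auto
  then show ?thesis
    using binomial_symmetric[of "nat (int m + k)" "2 * m"] by (simp add: dcoef_def power_int_minus_one_minus)
qed

lemma dcoef_of_nat: "k \<le> m \<Longrightarrow> dcoef m (int k) = (- 1) ^ k * real ((2 * m) choose (m - k))"
  by (simp add: dcoef_def nat_diff_distrib')

lemma sum_symmetric_int_interval:
  fixes h :: "int \<Rightarrow> 'a::comm_monoid_add"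
  shows "(\<Sum>k = - int m..int m. h k) = h 0 + (\<Sum>k = 1..m. h (int k) + h (- int k))"
proof -
  have eq: "{- int m..int m} = insert 0 ({1..int m} \<union> uminus ` {1..int m})"
    by auto
  have "(\<Sum>k = - int m..int m. h k) = h 0 + (sum h {1..int m} + sum h (uminus ` {1..int m}))"
    unfolding eq by (subst sum.insert, simp, force, subst sum.union_disjoint) auto
  moreover have "sum h {1..int m} = (\<Sum>k = 1..m. h (int k))"
    by (rule sum.reindex_bij_witness[of _ int nat]) auto
  moreover have "sum h (uminus ` {1..int m}) = (\<Sum>k = 1..m. h (- int k))"
    by (rule sum.reindex_bij_witness[of _ "\<lambda>k. - int k" "\<lambda>k. nat (- k)"]) auto
  ultimately show ?thesis by (simp add: sum.distrib)
qed

lemma sum_dcoef_symmetric: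
  fixes h :: "int \<Rightarrow> 'a::real_vector"
  shows "(\<Sum>k = - int m..int m. dcoef m k *\<^sub>R h k)
    = dcoef m 0 *\<^sub>R h 0 + (\<Sum>k = 1..m. dcoef m (int k) *\<^sub>R (h (int k) + h (- int k)))"
  by (subst sum_symmetric_int_interval) (auto intro!: sum.cong simp: scaleR_add_right)

lemma dcoef_even_moments:
  assumes "0 < j" "j < m"
  shows "(\<Sum>k = 1..m. dcoef m (int k) * real k ^ (2 * j)) = 0"
proof -
  have "(\<Sum>k = - int m..int m. dcoef m k * of_int k ^ (2 * j)) = 0"
    by (rule dcoef_moments) (use assms in auto)
  then have "(\<Sum>k = 1..m. dcoef m (int k) * (2 * real k ^ (2 * j))) = 0"
    using assms sum_dcoef_symmetric[of m "\<lambda>k. of_int k ^ (2 * j) :: real"] by (simp add: zero_power)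
  then show ?thesis by (simp add: sum_distrib_left[symmetric] mult.left_commute)
qed

lemma sum_dcoef_poly:
  fixes p :: "real poly"
  assumes "degree p < 2 * m"
  shows "(\<Sum>k = - int m..int m. dcoef m k * poly p (x + of_int k * t)) = 0"
proof -
  define q where "q = p \<circ>\<^sub>p [:x, t:]"
  have "degree q < 2 * m"
    using degree_pcompose_le[of p "[:x, t:]"] assms unfolding q_def
    by (smt (verit) degree_pCons_eq_if mult_le_mono2 mult.right_neutral degree_0 le_less_trans le_numeral_extra(4) nat_mult_1_right One_nat_def zero_le_one mult_0_right le0)
  have "(\<Sum>k = - int m..int m. dcoef m k * poly q (of_int k))
     = (\<Sum>j\<le>degree q. coeff q j * (\<Sum>k = - int m..int m. dcoef m k * of_int k ^ j))"
    by (simp add: poly_altdef sum_distrib_left mult_ac) (rule sum.swap)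
  also have "\<dots> = 0" using \<open>degree q < 2 * m\<close> by (auto intro!: sum.neutral simp: dcoef_moments)
  finally show ?thesis by (simp add: q_def poly_pcompose algebra_simps)
qed

lemma sum_dcoef_abs: "(\<Sum>k = - int m..int m. \<bar>dcoef m k\<bar>) = 4 ^ m"
proof -
  have "(\<Sum>k = - int m..int m. \<bar>dcoef m k\<bar>) = (\<Sum>i\<le>2 * m. real ((2 * m) choose i))"
    by (rule sum.reindex_bij_witness[of _ "\<lambda>i. int m - int i" "\<lambda>k. nat (int m - k)"])
      (auto simp: dcoef_def abs_mult power_int_abs)
  also have "\<dots> = real (\<Sum>i\<le>2 * m. (2 * m) choose i)" by simp
  also have "\<dots> = 4 ^ m" by (subst choose_row_sum) (simp add: power_mult)
  finally show ?thesis .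
qed

text \<open>
  The vanishing moments remove all terms of order less than \<open>2 m\<close> in the power series of \<open>f\<close> at \<open>x\<close>,
  and Cauchy's inequality bounds the others by a geometric series. The bound depends on \<open>f\<close> only
  through \<open>M\<close> and \<open>r\<close>, so that it is uniform in \<open>x\<close>; this uniformity is what makes the integral over
  all directions converge.
\<close>

lemma sum_dcoef_holomorphic_bound:
  fixes f :: "complex \<Rightarrow> complex"
  assumes hol: "f holomorphic_on ball x r" and bd: "\<And>z. z \<in> ball x r \<Longrightarrow> norm (f z) \<le> M"
    and r: "0 < r" and t: "2 * (real m * norm t) \<le> r / 2"
  shows "norm (\<Sum>k = - int m..int m. dcoef m k *\<^sub>R f (x + of_int k * t))
         \<le> 4 ^ m * (2 * M) * (real m * norm t / (r / 2)) ^ (2 * m)"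
proof -
  define R where "R = r / 2"
  have R: "0 < R" "R < r" using r by (auto simp: R_def)
  define a where "a n = (deriv ^^ n) f x / fact n" for n
  have M0: "0 \<le> M" using bd[of x] r norm_ge_zero[of "f x"] by (simp del: norm_ge_zero)
  have a: "norm (a n) \<le> M / R ^ n" for n
  proof -
    have "norm ((deriv ^^ n) f x) \<le> fact n * M / R ^ n"
    proof (rule Cauchy_inequality[OF _ _ \<open>0 < R\<close>])
      show "f holomorphic_on ball x R" by (rule holomorphic_on_subset[OF hol]) (use R in auto)
      show "continuous_on (cball x R) f"
        by (rule holomorphic_on_imp_continuous_on, rule holomorphic_on_subset[OF hol]) (use R in auto)
      show "norm (f y) \<le> M" if "norm (x - y) = R" for y
        by (rule bd) (use that R in \<open>simp add: dist_norm\<close>)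
    qed
    then show ?thesis by (simp add: a_def norm_divide field_simps)
  qed
  define T where "T = real m * norm t"
  have T: "0 \<le> T" "2 * T \<le> R" using t by (auto simp: T_def R_def)
  have kt: "norm (of_int k * t) \<le> T" if "k \<in> {- int m..int m}" for k
  proof -
    have "\<bar>real_of_int k\<bar> \<le> real m" using that by auto
    then show ?thesis unfolding T_def by (simp add: norm_mult mult_right_mono)
  qed
  have sums: "(\<lambda>n. a n * (of_int k * t) ^ n) sums f (x + of_int k * t)" if "k \<in> {- int m..int m}" for k
  proof -
    have "x + of_int k * t \<in> ball x r" using kt[OF that] T R by (auto simp: dist_norm)
    from holomorphic_power_series[OF hol this] show ?thesis by (simp add: a_def)
  qed
  define b where "b n = (\<Sum>k = - int m..int m. dcoef m k *\<^sub>R (a n * (of_int k * t) ^ n))" for n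
  have bsums: "b sums (\<Sum>k = - int m..int m. dcoef m k *\<^sub>R f (x + of_int k * t))"
    unfolding b_def by (intro sums_sum sums_scaleR_right sums)
  have b0: "b n = 0" if "n < 2 * m" for n
  proof -
    have "b n = a n * t ^ n * of_real (\<Sum>k = - int m..int m. dcoef m k * of_int k ^ n)"
      by (simp add: b_def sum_distrib_left scaleR_conv_of_real power_mult_distrib mult_ac)
    then show ?thesis using dcoef_moments[OF that] by simp
  qed
  have bbd: "norm (b n) \<le> 4 ^ m * M * (T / R) ^ n" for n
  proof -
    have "norm (b n) \<le> (\<Sum>k = - int m..int m. \<bar>dcoef m k\<bar> * (M * (T / R) ^ n))"
      unfolding b_def
    proof (rule order_trans[OF norm_sum sum_mono])
      fix k assume k: "k \<in> {- int m..int m}"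
      have "norm (a n * (of_int k * t) ^ n) \<le> (M / R ^ n) * T ^ n"
        unfolding norm_mult norm_power using kt[OF k] a[of n] M0 R
        by (intro mult_mono power_mono) (auto simp: norm_mult)
      then have "\<bar>dcoef m k\<bar> * norm (a n * (of_int k * t) ^ n) \<le> \<bar>dcoef m k\<bar> * ((M / R ^ n) * T ^ n)"
        by (rule mult_left_mono) simp
      then show "norm (dcoef m k *\<^sub>R (a n * (of_int k * t) ^ n)) \<le> \<bar>dcoef m k\<bar> * (M * (T / R) ^ n)"
        unfolding norm_scaleR by (simp only: power_divide times_divide_eq_right times_divide_eq_left)
    qed
    also have "\<dots> = 4 ^ m * M * (T / R) ^ n"
      by (simp add: sum_distrib_right[symmetric] sum_dcoef_abs)
    finally show ?thesis .
  qed
  have q: "0 \<le> T / R" "T / R \<le> 1 / 2" using T R by (auto simp: field_simps)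
  have fs: "(\<lambda>n. b (n + 2 * m)) sums (\<Sum>k = - int m..int m. dcoef m k *\<^sub>R f (x + of_int k * t))"
    using sums_split_initial_segment[OF bsums, of "2 * m"] b0 by simp
  have gs: "(\<lambda>n. 4 ^ m * M * (T / R) ^ (2 * m) * (1 / 2) ^ n) sums (4 ^ m * M * (T / R) ^ (2 * m) * (1 / (1 - 1 / 2)))"
    by (intro sums_mult geometric_sums) auto
  have bb: "norm (b (n + 2 * m)) \<le> 4 ^ m * M * (T / R) ^ (2 * m) * (1 / 2) ^ n" for n
  proof -
    have "norm (b (n + 2 * m)) \<le> 4 ^ m * M * (T / R) ^ (2 * m) * (T / R) ^ n"
      using bbd[of "n + 2 * m"] by (simp add: power_add mult_ac)
    also have "\<dots> \<le> 4 ^ m * M * (T / R) ^ (2 * m) * (1 / 2) ^ n"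
      using q M0 by (intro mult_left_mono power_mono) auto
    finally show ?thesis .
  qed
  have "norm (\<Sum>k = - int m..int m. dcoef m k *\<^sub>R f (x + of_int k * t))
     \<le> 4 ^ m * M * (T / R) ^ (2 * m) * (1 / (1 - 1 / 2))"
    using norm_suminf_le[OF bb sums_summable[OF gs]]
    unfolding sums_unique[OF fs, symmetric] sums_unique[OF gs, symmetric] .
  then show ?thesis by (simp add: T_def R_def mult_ac)
qed

section \<open>A contour integral over a strip\<close>

text \<open>
  The integrand \<open>h(z) = exp (- 2 s z) G (exp z)\<close> is continuous on the closed strip \<open>|Im z| \<le> \<pi>/2\<close>
  and holomorphic inside, so it has a primitive \<open>H\<close> there. Comparing the increments of \<open>H\<close> along the
  four sides of the rectangle with \<open>|Re z| \<le> R\<close>: the horizontal sides combine, by the symmetry of \<open>G\<close>,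
  to \<open>2 \<i>\<close> times the integral in the claim; the left side tends to \<open>0\<close> since \<open>G\<close> is of order
  \<open>N > 2 s\<close> at the origin; on the right side \<open>h\<close> tends to \<open>L\<close> and the side has length \<open>\<pi>\<close>.
\<close>

lemma strip_contour_limit:
  fixes G :: "complex \<Rightarrow> complex" and s C \<delta> L :: real
  assumes cont: "continuous_on {p. 0 \<le> Re p} G" and hol: "G holomorphic_on {p. 0 < Re p}"
    and real_sym: "\<And>\<tau>. 0 < \<tau> \<Longrightarrow> G (\<i> * of_real \<tau>) = cnj (G (- \<i> * of_real \<tau>))"
    and small: "\<And>p. 0 \<le> Re p \<Longrightarrow> norm p \<le> \<delta> \<Longrightarrow> norm (G p) \<le> C * norm p ^ N"
    and N: "2 * s < real N" and \<delta>: "0 < \<delta>"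
    and large: "((\<lambda>p. G p * exp (- 2 * complex_of_real s * Ln p)) \<longlongrightarrow> of_real L)
                  (inf at_infinity (principal {p. 0 \<le> Re p}))"
  shows "((\<lambda>R. integral {- R..R}
            (\<lambda>\<xi>. exp (- 2 * s * \<xi>) * Im (cis (pi * s) * G (- \<i> * of_real (exp \<xi>)))))
          \<longlongrightarrow> - pi * L / 2) at_top"
proof -
  define S where "S = {z::complex. \<bar>Im z\<bar> \<le> pi / 2}"
  define h where "h z = exp (- 2 * of_real s * z) * G (exp z)" for z
  have convS: "convex S"
  proof -
    have "S = {z. Im z \<le> pi / 2} \<inter> {z. Im z \<ge> - (pi / 2)}" by (auto simp: S_def)
    then show ?thesis
      using convex_Int[OF convex_halfspace_Im_le convex_halfspace_Im_ge] by metis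
  qed
  have expS: "0 \<le> Re (exp z)" if "z \<in> S" for z
  proof -
    have "- (pi / 2) \<le> Im z" "Im z \<le> pi / 2" using that by (auto simp: S_def abs_le_iff)
    then show ?thesis using cos_ge_zero[of "Im z"] by (simp add: Re_exp)
  qed
  have conth: "continuous_on S h"
    unfolding h_def
    by (intro continuous_intros continuous_on_compose2[OF cont]) (use expS in auto)
  \<comment> \<open>A point of the interior has room to move up and down inside the closed strip.\<close>
  have intS: "interior S \<subseteq> {z. \<bar>Im z\<bar> < pi / 2}"
  proof
    fix z assume z: "z \<in> interior S"
    then obtain e where e: "e > 0" "ball z e \<subseteq> S" by (auto simp: mem_interior)
    have "z + of_real (e / 2) * \<i> \<in> S" "z - of_real (e / 2) * \<i> \<in> S"
      using e by (auto simp: dist_norm norm_mult intro!: subsetD[OF e(2)])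
    then have "\<bar>Im z + e / 2\<bar> \<le> pi / 2" "\<bar>Im z - e / 2\<bar> \<le> pi / 2"
      by (auto simp: S_def)
    then have "\<bar>Im z\<bar> < pi / 2" using e(1) by linarith
    then show "z \<in> {z. \<bar>Im z\<bar> < pi / 2}" by simp
  qed
  have holh: "h field_differentiable at z" if "z \<in> interior S - {}" for z
  proof -
    have "\<bar>Im z\<bar> < pi / 2" using that intS by auto
    then have "- (pi / 2) < Im z" "Im z < pi / 2" by (auto simp: abs_less_iff)
    then have "0 < Re (exp z)" using cos_gt_zero_pi[of "Im z"] by (simp add: Re_exp)
    then have *: "G field_differentiable at (exp z)"
      using hol holomorphic_on_imp_differentiable_at[OF hol, of "exp z"] open_halfspace_Re_gt by auto
    have "(G \<circ> exp) field_differentiable at z"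
      by (rule field_differentiable_compose[OF field_differentiable_within_exp *])
    then have comp: "(\<lambda>z. G (exp z)) field_differentiable at z" by (simp add: o_def)
    have "((\<lambda>z. exp (- 2 * of_real s * z)) has_field_derivative exp (- 2 * of_real s * z) * (- 2 * of_real s)) (at z)"
      by (auto intro!: derivative_eq_intros)
    then have "(\<lambda>z. exp (- 2 * of_real s * z)) field_differentiable at z"
      unfolding field_differentiable_def by blast
    from field_differentiable_mult[OF this comp] show ?thesis unfolding h_def .
  qed
  obtain H where H: "\<And>z. z \<in> S \<Longrightarrow> (H has_field_derivative h z) (at z within S)"
    using holomorphic_convex_primitive[OF convS finite.emptyI conth holh] by blast
  define e :: real where "e = pi / 2"
  have line: "((\<lambda>\<xi>. h (Complex \<xi> b)) has_integral (H (Complex R b) - H (Complex (- R) b))) {- R..R}"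
    if "\<bar>b\<bar> \<le> pi / 2" "0 \<le> R" for b R
  proof (rule fundamental_theorem_of_calculus)
    fix \<xi> assume "\<xi> \<in> {- R..R}"
    have "((\<lambda>\<xi>. Complex \<xi> b) has_vector_derivative 1) (at \<xi> within {- R..R})"
      unfolding Complex_eq by (auto intro!: derivative_eq_intros)
    moreover have "(H has_field_derivative h (Complex \<xi> b)) (at (Complex \<xi> b) within (\<lambda>\<xi>. Complex \<xi> b) ` {- R..R})"
      by (rule DERIV_subset[OF H]) (use that in \<open>auto simp: S_def\<close>)
    ultimately show "((\<lambda>\<xi>. H (Complex \<xi> b)) has_vector_derivative h (Complex \<xi> b)) (at \<xi> within {- R..R})"
      using field_vector_diff_chain_within[of "\<lambda>\<xi>. Complex \<xi> b" 1 \<xi> "{- R..R}" H] by (simp add: o_def)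
  qed (use that in auto)
  have w: "h (Complex \<xi> (- e)) - h (Complex \<xi> e)
      = 2 * \<i> * of_real (exp (- 2 * s * \<xi>) * Im (cis (pi * s) * G (- \<i> * of_real (exp \<xi>))))" for \<xi>
  proof -
    have 1: "exp (Complex \<xi> e) = \<i> * of_real (exp \<xi>)" "exp (Complex \<xi> (- e)) = - \<i> * of_real (exp \<xi>)"
      by (auto simp: e_def exp_eq_polar cis_pi_half complex_eq_iff)
    have 2: "exp (- 2 * of_real s * Complex \<xi> (- e)) = of_real (exp (- 2 * s * \<xi>)) * cis (pi * s)"
      by (simp add: exp_eq_polar e_def mult_ac)
    have 3: "exp (- 2 * of_real s * Complex \<xi> e) = of_real (exp (- 2 * s * \<xi>)) * cnj (cis (pi * s))"
      by (simp add: exp_eq_polar e_def mult_ac cis_cnj)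
    have "h (Complex \<xi> (- e)) - h (Complex \<xi> e) = of_real (exp (- 2 * s * \<xi>)) *
        (cis (pi * s) * G (- \<i> * of_real (exp \<xi>)) - cnj (cis (pi * s) * G (- \<i> * of_real (exp \<xi>))))"
      unfolding h_def 1 2 3 using real_sym[of "exp \<xi>"] by (simp add: algebra_simps)
    then show ?thesis by (simp only: complex_diff_cnj) (simp add: algebra_simps)
  qed
  define I where "I R = integral {- R..R}
            (\<lambda>\<xi>. exp (- 2 * s * \<xi>) * Im (cis (pi * s) * G (- \<i> * of_real (exp \<xi>))))" for R
  have e_le: "\<bar>e\<bar> \<le> pi / 2" "\<bar>- e\<bar> \<le> pi / 2" by (auto simp: e_def)
  define EL where "EL R = H (Complex (- R) e) - H (Complex (- R) (- e))" for R
  define ER where "ER R = H (Complex R e) - H (Complex R (- e))" for R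
  have IR: "of_real (I R) = (EL R - ER R) / (2 * \<i>)" if "0 \<le> R" for R
  proof -
    have "((\<lambda>\<xi>. (h (Complex \<xi> (- e)) - h (Complex \<xi> e)) / (2 * \<i>)) has_integral (EL R - ER R) / (2 * \<i>)) {- R..R}"
      using has_integral_divide[OF has_integral_diff[OF line[OF e_le(2) that] line[OF e_le(1) that]], of "2 * \<i>"]
      by (simp add: EL_def ER_def algebra_simps)
    then have *: "((\<lambda>\<xi>. complex_of_real (exp (- 2 * s * \<xi>) * Im (cis (pi * s) * G (- \<i> * of_real (exp \<xi>))))) has_integral (EL R - ER R) / (2 * \<i>)) {- R..R}"
      unfolding w by simp
    have "((\<lambda>\<xi>. (exp (- 2 * s * \<xi>) * Im (cis (pi * s) * G (- \<i> * of_real (exp \<xi>))))) has_integral Re ((EL R - ER R) / (2 * \<i>))) {- R..R}"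
      using has_integral_Re[OF *] by simp
    then have "I R = Re ((EL R - ER R) / (2 * \<i>))" unfolding I_def by (rule integral_unique)
    moreover have "((\<lambda>\<xi>. 0::real) has_integral Im ((EL R - ER R) / (2 * \<i>))) {- R..R}"
      using has_integral_Im[OF *] by (simp only: Im_complex_of_real)
    then have "Im ((EL R - ER R) / (2 * \<i>)) = 0"
      by (rule has_integral_unique[OF _ has_integral_0])
    ultimately show ?thesis by (simp add: complex_eq_iff)
  qed
  \<comment> \<open>The increment of the primitive along a vertical side is close to \<open>\<i> \<pi> c\<close> where \<open>h\<close> is close to \<open>c\<close>.\<close>
  have edge: "norm (H (Complex R e) - H (Complex R (- e)) - \<i> * of_real pi * c) \<le> B * pi"
    if "\<And>b. \<bar>b\<bar> \<le> e \<Longrightarrow> norm (h (Complex R b) - c) \<le> B" for R c B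
  proof -
    define E where "E = {z. Re z = R \<and> \<bar>Im z\<bar> \<le> e}"
    have "norm ((H (Complex R e) - c * Complex R e) - (H (Complex R (- e)) - c * Complex R (- e))) \<le> B * norm (Complex R e - Complex R (- e))"
    proof (rule field_differentiable_bound[of E _ "\<lambda>z. h z - c"])
      have "E = {z. Re z \<le> R} \<inter> {z. Re z \<ge> R} \<inter> S" by (auto simp: E_def S_def e_def)
      then show "convex E"
        by (auto intro!: convex_Int convS convex_halfspace_Re_le convex_halfspace_Re_ge)
      show "((\<lambda>z. H z - c * z) has_field_derivative h z - c) (at z within E)" if "z \<in> E" for z
        using that by (auto intro!: derivative_eq_intros DERIV_subset[OF H] simp: E_def S_def e_def)
      show "norm (h z - c) \<le> B" if "z \<in> E" for z
        using that \<open>\<And>b. \<bar>b\<bar> \<le> e \<Longrightarrow> norm (h (Complex R b) - c) \<le> B\<close>[of "Im z"]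
        by (cases z) (auto simp: E_def)
    qed (auto simp: E_def e_def)
    moreover have "Complex R e - Complex R (- e) = \<i> * of_real pi" by (auto simp: complex_eq_iff e_def)
    moreover have "(H (Complex R e) - c * Complex R e) - (H (Complex R (- e)) - c * Complex R (- e))
       = H (Complex R e) - H (Complex R (- e)) - (Complex R e - Complex R (- e)) * c"
      by (simp add: algebra_simps)
    ultimately show ?thesis by (simp add: norm_mult)
  qed
  have "(EL \<longlongrightarrow> 0) at_top"
  proof (rule Lim_null_comparison)
    have "norm (EL R) \<le> C * exp (- (real N - 2 * s) * R) * pi" if "R \<ge> - ln \<delta>" for R
    proof -
      have "norm (h (Complex (- R) b) - 0) \<le> C * exp (- (real N - 2 * s) * R)" if "\<bar>b\<bar> \<le> e" for b
      proof -
        have le: "exp (- R) \<le> \<delta>" using \<open>R \<ge> - ln \<delta>\<close> \<delta> by (metis exp_le_cancel_iff exp_ln minus_le_iff)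
        have "norm (h (Complex (- R) b)) = exp (2 * s * R) * norm (G (exp (Complex (- R) b)))"
          by (simp add: h_def norm_mult)
        also have "\<dots> \<le> exp (2 * s * R) * (C * norm (exp (Complex (- R) b)) ^ N)"
          by (intro mult_left_mono small expS) (use that le in \<open>auto simp: S_def e_def\<close>)
        also have "\<dots> = C * exp (- (real N - 2 * s) * R)"
          by (simp add: exp_of_nat_mult[symmetric] exp_add[symmetric] algebra_simps)
        finally show ?thesis by simp
      qed
      from edge[of "- R" 0, OF this] show ?thesis by (simp add: EL_def)
    qed
    then show "eventually (\<lambda>R. norm (EL R) \<le> C * exp (- (real N - 2 * s) * R) * pi) at_top"
      using eventually_ge_at_top by (rule eventually_mono[rotated])
    have "filterlim (\<lambda>R. - (real N - 2 * s) * R) at_bot at_top"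
      using N by (intro filterlim_tendsto_neg_mult_at_bot[OF tendsto_const] filterlim_ident) auto
    then have e0: "((\<lambda>R. exp (- (real N - 2 * s) * R)) \<longlongrightarrow> 0) at_top"
      by (rule filterlim_compose[OF exp_at_bot])
    then show "((\<lambda>R. C * exp (- (real N - 2 * s) * R) * pi) \<longlongrightarrow> 0) at_top"
      using tendsto_mult[OF tendsto_mult[OF tendsto_const[of C] e0] tendsto_const[of pi]] by simp
  qed
  moreover have "(ER \<longlongrightarrow> \<i> * of_real pi * of_real L) at_top"
  proof (rule tendstoI)
    fix \<epsilon> :: real assume \<epsilon>: "\<epsilon> > 0"
    have "eventually (\<lambda>p. dist (G p * exp (- 2 * complex_of_real s * Ln p)) (of_real L) < \<epsilon> / (2 * pi))
                  (inf at_infinity (principal {p. 0 \<le> Re p}))"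
      using tendstoD[OF large, of "\<epsilon> / (2 * pi)"] \<epsilon> by auto
    then obtain B where B: "\<And>p. norm p \<ge> B \<Longrightarrow> 0 \<le> Re p \<Longrightarrow> dist (G p * exp (- 2 * complex_of_real s * Ln p)) (of_real L) < \<epsilon> / (2 * pi)"
      by (auto simp: eventually_inf_principal eventually_at_infinity)
    have "dist (ER R) (\<i> * of_real pi * of_real L) < \<epsilon>" if R: "R \<ge> ln (max B 1)" for R
    proof -
      have "norm (h (Complex R b) - of_real L) \<le> \<epsilon> / (2 * pi)" if "\<bar>b\<bar> \<le> e" for b
      proof -
        have "max B 1 \<le> exp R" using R by (metis exp_le_cancel_iff exp_ln max.strict_coboundedI2 zero_less_one)
        then have "B \<le> exp R" by simp
        have "- pi < b" "b \<le> pi" using that pi_gt_zero unfolding e_def by linarith+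
        then have "Ln (exp (Complex R b)) = Complex R b" by (intro Ln_exp) auto
        then show ?thesis using B[of "exp (Complex R b)"] \<open>B \<le> exp R\<close> expS[of "Complex R b"] that
          by (simp add: h_def dist_norm S_def e_def mult_ac)
      qed
      from edge[of R "of_real L", OF this] show ?thesis using \<epsilon> by (simp add: ER_def dist_norm)
    qed
    then show "eventually (\<lambda>R. dist (ER R) (\<i> * of_real pi * of_real L) < \<epsilon>) at_top"
      using eventually_ge_at_top by (rule eventually_mono[rotated])
  qed
  ultimately have "((\<lambda>R. (EL R - ER R) / (2 * \<i>)) \<longlongrightarrow> (0 - \<i> * of_real pi * of_real L) / (2 * \<i>)) at_top"
    by (intro tendsto_intros) auto
  then have "((\<lambda>R. of_real (I R)) \<longlongrightarrow> (0 - \<i> * of_real pi * of_real L) / (2 * \<i>)) at_top"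
    by (rule Lim_transform_eventually)
      (rule eventually_mono[OF eventually_ge_at_top[of 0]], simp only: IR)
  then have "((\<lambda>R. Re (of_real (I R))) \<longlongrightarrow> Re ((0 - \<i> * of_real pi * of_real L) / (2 * \<i>))) at_top"
    by (rule tendsto_Re)
  then show ?thesis by (simp add: I_def)
qed

section \<open>Truncated powers and their holomorphic extension\<close>

text \<open>
  The exponent \<open>e\<close> is \<open>0\<close> or \<open>1\<close> in the end: these are the restrictions of \<open>u\<^sub>s\<close> and of a linear
  multiple of it to a line through the ellipsoid, up to scaling.
\<close>

definition cap_pow :: "real \<Rightarrow> nat \<Rightarrow> real \<Rightarrow> real" where
  "cap_pow s e y = y ^ e * (max 0 (1 - y\<^sup>2)) powr s"

definition cap_diff :: "nat \<Rightarrow> real \<Rightarrow> nat \<Rightarrow> real \<Rightarrow> real \<Rightarrow> real" where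
  "cap_diff m s e x t = (\<Sum>k = - int m..int m. dcoef m k * cap_pow s e (x + of_int k * t))"

lemma cap_pow_minus: "cap_pow s e (- y) = (- 1) ^ e * cap_pow s e y"
  by (simp add: cap_pow_def power_minus[of y])

lemma cap_diff_eq:
  "cap_diff m s e x t = dcoef m 0 * cap_pow s e x +
     (\<Sum>k = 1..m. dcoef m (int k) * (cap_pow s e (real k * t + x) + (- 1) ^ e * cap_pow s e (real k * t - x)))"
proof -
  have "cap_pow s e (x - k * t) = (- 1) ^ e * cap_pow s e (k * t - x)" for k
    using cap_pow_minus[of s e "k * t - x"] by simp
  then show ?thesis
    using sum_dcoef_symmetric[of m "\<lambda>k. cap_pow s e (x + of_int k * t)"]
    by (simp add: cap_diff_def add.commute)
qed

lemma holomorphic_cap: "(\<lambda>z. z ^ e * (1 - z\<^sup>2) powr of_real s) holomorphic_on ball 0 1"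
proof -
  have "0 < Re (1 - z\<^sup>2)" if "z \<in> ball 0 1" for z :: complex
  proof -
    have "Re (z\<^sup>2) \<le> norm z ^ 2" using complex_Re_le_cmod[of "z\<^sup>2"] by (simp add: norm_power)
    also have "\<dots> < 1" using that by (simp add: abs_square_less_1)
    finally show ?thesis by simp
  qed
  then show ?thesis
    by (intro holomorphic_intros) (auto simp: complex_nonpos_Reals_iff not_le)
qed

lemma norm_cap_le:
  fixes z :: complex
  assumes "norm z < 1" "0 < s"
  shows "norm (z ^ e * (1 - z\<^sup>2) powr of_real s) \<le> 2 powr s"
proof -
  have "norm (1 - z\<^sup>2) \<le> 1 + norm z ^ 2" using norm_triangle_ineq4[of 1 "z\<^sup>2"] by (simp add: norm_power)
  also have "\<dots> \<le> 2" using assms by (simp add: abs_square_le_1)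
  finally have "norm ((1 - z\<^sup>2) powr of_real s) \<le> 2 powr s"
    using assms by (simp add: norm_powr_real_powr' powr_mono2)
  moreover have "norm (z ^ e) \<le> 1" using assms by (simp add: norm_power power_le_one)
  ultimately show ?thesis using mult_mono[of "norm (z ^ e)" 1 "norm ((1 - z\<^sup>2) powr of_real s)" "2 powr s"]
    by (simp add: norm_mult)
qed

lemma cap_pow_complex:
  assumes "\<bar>y\<bar> < 1"
  shows "(of_real y :: complex) ^ e * (1 - (of_real y)\<^sup>2) powr of_real s = of_real (cap_pow s e y)"
proof -
  have y: "0 < 1 - y\<^sup>2" using assms by (simp add: abs_square_less_1)
  have "(1 - (complex_of_real y)\<^sup>2) powr of_real s = of_real ((1 - y\<^sup>2) powr s)"
    using powr_of_real[of "1 - y\<^sup>2" s] y by simp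
  then show ?thesis using y by (simp add: cap_pow_def)
qed

text \<open>
  The ball of radius \<open>1 - \<rho>\<close> around \<open>x\<close> lies in the unit disc, on which the function is bounded by
  \<open>2\<^sup>s\<close>.
\<close>

lemma cap_complex_diff_bound:
  fixes t :: complex and x \<rho> s :: real
  assumes x: "\<bar>x\<bar> \<le> \<rho>" "\<rho> < 1" and s: "0 < s" and t: "2 * (real m * norm t) \<le> (1 - \<rho>) / 2"
  shows "norm (\<Sum>k = - int m..int m. dcoef m k *\<^sub>R
            ((of_real x + of_int k * t) ^ e * (1 - (of_real x + of_int k * t)\<^sup>2) powr of_real s))
         \<le> 4 ^ m * (2 * 2 powr s) * (real m * norm t / ((1 - \<rho>) / 2)) ^ (2 * m)"
proof (rule sum_dcoef_holomorphic_bound[where f = "\<lambda>z. z ^ e * (1 - z\<^sup>2) powr of_real s"])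
  have sub: "ball (complex_of_real x) (1 - \<rho>) \<subseteq> ball 0 1"
    using x by (subst ball_subset_ball_iff) auto
  show "(\<lambda>z. z ^ e * (1 - z\<^sup>2) powr of_real s) holomorphic_on ball (of_real x) (1 - \<rho>)"
    by (rule holomorphic_on_subset[OF holomorphic_cap sub])
  show "norm (z ^ e * (1 - z\<^sup>2) powr of_real s) \<le> 2 powr s" if "z \<in> ball (of_real x) (1 - \<rho>)" for z :: complex
    using subsetD[OF sub that] s by (intro norm_cap_le) auto
qed (use x t in auto)

lemma norm_of_int_mult_le:
  fixes t :: "'a::real_normed_field"
  assumes "k \<in> {- int m..int m}" shows "norm (of_int k * t) \<le> real m * norm t"
proof -
  have "\<bar>real_of_int k\<bar> \<le> real m" using assms by auto
  then show ?thesis by (simp add: norm_mult mult_right_mono)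
qed

lemma cap_diff_small:
  assumes x: "\<bar>x\<bar> \<le> \<rho>" "\<rho> < 1" and s: "0 < s" and t: "2 * (real m * \<bar>t\<bar>) \<le> (1 - \<rho>) / 2"
  shows "\<bar>cap_diff m s e x t\<bar> \<le> 4 ^ m * (2 * 2 powr s) * (real m * \<bar>t\<bar> / ((1 - \<rho>) / 2)) ^ (2 * m)"
proof -
  have "complex_of_real (cap_diff m s e x t) = (\<Sum>k = - int m..int m. dcoef m k *\<^sub>R
            ((of_real x + of_int k * of_real t) ^ e * (1 - (of_real x + of_int k * of_real t)\<^sup>2) powr of_real s))"
    unfolding cap_diff_def of_real_sum
  proof (rule sum.cong[OF refl])
    fix k assume "k \<in> {- int m..int m}"
    then have "\<bar>of_int k * t\<bar> \<le> real m * \<bar>t\<bar>" using norm_of_int_mult_le[of k m t] by simp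
    moreover have "0 \<le> real m * \<bar>t\<bar>" by simp
    ultimately have "\<bar>x\<bar> + \<bar>of_int k * t\<bar> < 1" using x t by argo
    then have "\<bar>x + of_int k * t\<bar> < 1" by (meson abs_triangle_ineq le_less_trans)
    from cap_pow_complex[OF this, of e s]
    show "complex_of_real (dcoef m k * cap_pow s e (x + of_int k * t)) = dcoef m k *\<^sub>R
            ((of_real x + of_int k * of_real t) ^ e * (1 - (of_real x + of_int k * of_real t)\<^sup>2) powr of_real s)"
      by (simp add: scaleR_conv_of_real)
  qed
  then have "\<bar>cap_diff m s e x t\<bar> = norm (\<Sum>k = - int m..int m. dcoef m k *\<^sub>R
            ((of_real x + of_int k * of_real t) ^ e * (1 - (of_real x + of_int k * of_real t)\<^sup>2) powr complex_of_real s))"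
    by (metis norm_of_real)
  also have "\<dots> \<le> 4 ^ m * (2 * 2 powr s) * (real m * norm (complex_of_real t) / ((1 - \<rho>) / 2)) ^ (2 * m)"
    by (rule cap_complex_diff_bound) (use assms in auto)
  finally show ?thesis by simp
qed

text \<open>
  The two arguments add up to a number strictly between \<open>- \<pi>\<close> and \<open>\<pi>\<close>.
\<close>

lemma powr_mult_right_halfplane:
  assumes "0 \<le> Re a" "0 < Re b"
  shows "(a * b) powr s = a powr s * b powr (s::complex)"
proof (cases "a = 0")
  case False
  have "b \<noteq> 0" using assms by auto
  have "\<bar>Im (Ln a)\<bar> \<le> pi / 2" "\<bar>Im (Ln b)\<bar> < pi / 2"
    using assms False \<open>b \<noteq> 0\<close> Re_Ln_pos_le Re_Ln_pos_lt by auto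
  then have "- pi < Im (Ln a + Ln b)" "Im (Ln a + Ln b) \<le> pi"
    unfolding plus_complex.simps by linarith+
  then have "Ln (a * b) = Ln a + Ln b" using Ln_times[OF False \<open>b \<noteq> 0\<close>] by simp
  then show ?thesis using False \<open>b \<noteq> 0\<close> by (simp add: powr_def exp_add distrib_left)
qed simp

text \<open>
  With \<open>z = \<i> q\<close> this is \<open>(1 - z)\<^sup>s (1 + z)\<^sup>s\<close> on the closed upper half-plane. Rotating each factor into
  the closed right half-plane, where the principal power is continuous, makes the function continuous
  up to the boundary, including the two branch points; the two rotations cancel.
\<close>

definition half_plane_pow :: "real \<Rightarrow> complex \<Rightarrow> complex" where
  "half_plane_pow s q = (q + \<i>) powr of_real s * (q - \<i>) powr of_real s"

lemma ipower_ii_multr: "\<i> powr of_real s = cis (pi * s / 2)" "(- \<i>) powr of_real s = cis (- (pi * s / 2))"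
  by (simp_all add: powr_def cis_conv_exp mult_ac)

lemma half_plane_pow_inside:
  assumes "0 \<le> Re q" "norm q < 1"
  shows "half_plane_pow s q = (1 + q\<^sup>2) powr of_real s"
proof (cases "Re q = 0")
  case False
  have "(q + \<i>) * (q - \<i>) = 1 + q\<^sup>2" by (simp add: algebra_simps power2_eq_square)
  then show ?thesis
    using powr_mult_right_halfplane[of "q + \<i>" "q - \<i>" "of_real s"] assms False by (simp add: half_plane_pow_def)
next
  case True
  define b where "b = Im q"
  have q: "q = \<i> * of_real b" using True by (simp add: b_def complex_eq_iff)
  have b: "\<bar>b\<bar> < 1" using assms by (simp add: q norm_mult)
  have 1: "q + \<i> = of_real (1 + b) * \<i>" "q - \<i> = of_real (1 - b) * (- \<i>)" by (simp_all add: q algebra_simps)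
  have "half_plane_pow s q = (of_real (1 + b) powr of_real s * of_real (1 - b) powr of_real s) * (cis (pi * s / 2) * cis (- (pi * s / 2)))"
    unfolding half_plane_pow_def 1 using b
    by (subst (1 2) powr_times_real_left) (auto simp: ipower_ii_multr)
  also have "\<dots> = (of_real (1 + b) * of_real (1 - b)) powr of_real s"
    using b by (subst powr_times_real_left) (auto simp: cis_mult)
  also have "of_real (1 + b) * of_real (1 - b) = 1 + q\<^sup>2" by (simp add: q algebra_simps power2_eq_square)
  finally show ?thesis .
qed

lemma half_plane_pow_cnj: "0 \<le> Re q \<Longrightarrow> cnj (half_plane_pow s q) = half_plane_pow s (cnj q)"
  by (simp add: half_plane_pow_def cnj_powr mult.commute)

text \<open>
  Beyond the branch point both factors lie on the negative imaginary axis, each contributing a phase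
  \<open>exp (- \<i> \<pi> s / 2)\<close>, so the product with \<open>cis (\<pi> s)\<close> is real.
\<close>

lemma half_plane_pow_boundary:
  assumes "- 1 < y" "0 < s"
  shows "Im (cis (pi * s) * half_plane_pow s (- \<i> * of_real y)) = sin (pi * s) * (max 0 (1 - y\<^sup>2)) powr s"
proof (cases "y < 1")
  case True
  then have y: "\<bar>y\<bar> < 1" using assms by auto
  then have "half_plane_pow s (- \<i> * of_real y) = (1 + (- \<i> * of_real y)\<^sup>2) powr of_real s"
    by (intro half_plane_pow_inside) (auto simp: norm_mult)
  also have "\<dots> = of_real (cap_pow s 0 y)"
    using cap_pow_complex[OF y, of 0 s] by (simp add: power_mult_distrib)
  finally show ?thesis by (simp add: cap_pow_def)
next
  case False
  then have "max 0 (1 - y\<^sup>2) = 0" by (simp add: one_le_power)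
  have 1: "- \<i> * of_real y + \<i> = of_real (y - 1) * (- \<i>)" "- \<i> * of_real y - \<i> = of_real (1 + y) * (- \<i>)"
    by (simp_all add: algebra_simps)
  have "half_plane_pow s (- \<i> * of_real y) = of_real ((y - 1) powr s * (1 + y) powr s) * (cis (- (pi * s / 2)) * cis (- (pi * s / 2)))"
    unfolding half_plane_pow_def 1 using False
    by (subst (1 2) powr_times_real_left) (auto simp: ipower_ii_multr powr_of_real simp del: of_real_diff of_real_add)
  also have "\<dots> = of_real ((y - 1) powr s * (1 + y) powr s) * cis (- (pi * s))"
    by (simp add: cis_mult)
  finally have "cis (pi * s) * half_plane_pow s (- \<i> * of_real y) = of_real ((y - 1) powr s * (1 + y) powr s)"
    by (simp add: cis_mult)
  then show ?thesis using \<open>max 0 (1 - y\<^sup>2) = 0\<close> assms by (simp del: of_real_mult)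
qed

lemma continuous_half_plane_pow:
  "0 < s \<Longrightarrow> continuous_on {q. 0 \<le> Re q} (half_plane_pow s)"
  unfolding half_plane_pow_def by (intro continuous_intros) auto

lemma holomorphic_half_plane_pow: "half_plane_pow s holomorphic_on {q. 0 < Re q}"
  unfolding half_plane_pow_def by (intro holomorphic_intros) (auto simp: complex_nonpos_Reals_iff)

text \<open>
  The difference of \<open>z\<^sup>e (1 - z\<^sup>2)\<^sup>s\<close> at \<open>x\<close> with the complex step \<open>t = \<i> p\<close>, where the terms with
  negative multiples of \<open>t\<close> are folded back to the upper half-plane by the parity of the function.
  For \<open>Re p \<ge> 0\<close> every argument of \<open>half_plane_pow\<close> stays in the closed right half-plane.
\<close>

definition ext_diff :: "nat \<Rightarrow> real \<Rightarrow> nat \<Rightarrow> real \<Rightarrow> complex \<Rightarrow> complex" where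
  "ext_diff m s e x p = of_real (dcoef m 0 * cap_pow s e x) +
     (\<Sum>k = 1..m. of_real (dcoef m (int k)) * \<i> ^ e *
        ((of_nat k * p - \<i> * of_real x) ^ e * half_plane_pow s (of_nat k * p - \<i> * of_real x) +
         (- 1) ^ e * ((of_nat k * p + \<i> * of_real x) ^ e * half_plane_pow s (of_nat k * p + \<i> * of_real x))))"

lemma continuous_ext_diff:
  assumes "0 < s" shows "continuous_on {p. 0 \<le> Re p} (ext_diff m s e x)"
  unfolding ext_diff_def
  by (intro continuous_intros continuous_on_compose2[OF continuous_half_plane_pow[OF assms]]) auto

lemma holomorphic_ext_diff: "ext_diff m s e x holomorphic_on {p. 0 < Re p}"
proof -
  have 1: "(\<lambda>p. half_plane_pow s (of_nat k * p - \<i> * of_real x)) holomorphic_on {p. 0 < Re p}"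
    "(\<lambda>p. half_plane_pow s (of_nat k * p + \<i> * of_real x)) holomorphic_on {p. 0 < Re p}" if "k \<in> {1..m}" for k
    by (rule holomorphic_on_compose_gen[OF _ holomorphic_half_plane_pow, unfolded o_def],
        (intro holomorphic_intros), use that in auto)+
  show ?thesis unfolding ext_diff_def
    by (intro holomorphic_intros 1)
qed

lemma power_ii_mult: "(\<i> * w) ^ e = \<i> ^ e * w ^ e" "(- \<i> * w) ^ e = \<i> ^ e * ((- 1) ^ e * w ^ e)"
proof -
  show "(\<i> * w) ^ e = \<i> ^ e * w ^ e" by (simp add: power_mult_distrib)
  have "- \<i> * w = \<i> * ((- 1) * w)" by simp
  then show "(- \<i> * w) ^ e = \<i> ^ e * ((- 1) ^ e * w ^ e)" by (simp only: power_mult_distrib)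
qed

text \<open>
  For a real step \<open>\<tau> > 0\<close> (that is, \<open>p = - \<i> \<tau>\<close>) all points \<open>k \<tau> \<plusminus> x\<close> lie to the right of \<open>-1\<close>,
  where \<open>half_plane_pow_boundary\<close> applies.
\<close>

lemma ext_diff_boundary:
  assumes x: "\<bar>x\<bar> < 1" and s: "0 < s" and \<tau>: "0 < \<tau>"
  shows "Im (cis (pi * s) * ext_diff m s e x (- \<i> * of_real \<tau>)) = sin (pi * s) * cap_diff m s e x \<tau>"
proof -
  define W where "W y = cis (pi * s) * (\<i> ^ e * ((- \<i> * of_real y) ^ e * half_plane_pow s (- \<i> * of_real y)))" for y
  have A: "Im (W y) = sin (pi * s) * cap_pow s e y"
    if "- 1 < y" for y
  proof -
    have "W y = (y ^ e) *\<^sub>R (cis (pi * s) * half_plane_pow s (- \<i> * of_real y))"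
    proof -
      have "\<i> ^ e * (- \<i> * of_real y) ^ e = (of_real (y ^ e) :: complex)"
        by (simp add: power_mult_distrib[symmetric])
      then show ?thesis unfolding scaleR_conv_of_real W_def by (metis mult.assoc mult.commute)
    qed
    then show ?thesis using half_plane_pow_boundary[OF that s]
      by (simp only: scaleR_complex.simps cap_pow_def mult.left_commute)
  qed
  have Imr: "Im (complex_of_real r * z) = r * Im z" for r z by simp
  define P where "P k = of_nat k * (- \<i> * complex_of_real \<tau>) - \<i> * complex_of_real x" for k
  define Q where "Q k = of_nat k * (- \<i> * complex_of_real \<tau>) + \<i> * complex_of_real x" for k
  have P: "P k = - \<i> * complex_of_real (real k * \<tau> + x)" and Q: "Q k = - \<i> * complex_of_real (real k * \<tau> - x)" for k
    by (simp_all add: P_def Q_def algebra_simps)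
  have pos: "- 1 < real k * \<tau> + x" "- 1 < real k * \<tau> - x" for k
  proof -
    have "0 \<le> real k * \<tau>" using \<tau> by simp
    then show "- 1 < real k * \<tau> + x" "- 1 < real k * \<tau> - x" using x by (auto simp: abs_less_iff)
  qed
  have T: "C * (d * I * (Z * p + \<epsilon> * (Z' * p'))) = d * (C * (I * (Z * p)) + \<epsilon> * (C * (I * (Z' * p'))))"
    for C d I Z p \<epsilon> Z' p' :: complex by (simp only: distrib_left mult_ac)
  define h where "h k = complex_of_real (dcoef m (int k)) * \<i> ^ e *
    (P k ^ e * half_plane_pow s (P k) + (- 1) ^ e * (Q k ^ e * half_plane_pow s (Q k)))" for k
  have h: "Im (cis (pi * s) * h k) = sin (pi * s) *
      (dcoef m (int k) * (cap_pow s e (real k * \<tau> + x) + (- 1) ^ e * cap_pow s e (real k * \<tau> - x)))" for k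
  proof -
    have "cis (pi * s) * h k = complex_of_real (dcoef m (int k)) *
        (W (real k * \<tau> + x) + complex_of_real ((- 1) ^ e) * W (real k * \<tau> - x))"
      unfolding h_def P Q W_def T by (simp only: of_real_power of_real_minus of_real_1)
    then have "Im (cis (pi * s) * h k) = dcoef m (int k) * (Im (W (real k * \<tau> + x)) + (- 1) ^ e * Im (W (real k * \<tau> - x)))"
      by (simp only: Imr plus_complex.simps)
    then show ?thesis using A[OF pos(1)[of k]] A[OF pos(2)[of k]] by (simp add: algebra_simps)
  qed
  have "ext_diff m s e x (- \<i> * of_real \<tau>) = complex_of_real (dcoef m 0 * cap_pow s e x) + (\<Sum>k = 1..m. h k)"
    unfolding ext_diff_def h_def P_def Q_def ..
  then have "Im (cis (pi * s) * ext_diff m s e x (- \<i> * of_real \<tau>))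
    = Im (complex_of_real (dcoef m 0 * cap_pow s e x) * cis (pi * s)) + (\<Sum>k = 1..m. Im (cis (pi * s) * h k))"
    by (simp only: distrib_left sum_distrib_left plus_complex.simps Im_sum mult.commute)
  then show ?thesis
    unfolding h Imr cap_diff_eq distrib_left[of "sin (pi * s)" "dcoef m 0 * cap_pow s e x"] sum_distrib_left[symmetric]
    by (simp add: mult.commute)
qed

lemma ext_diff_symmetric:
  "ext_diff m s e x (\<i> * of_real \<tau>) = cnj (ext_diff m s e x (- \<i> * of_real \<tau>))"
proof -
  have eq: "cnj (of_nat k * (- \<i> * of_real \<tau>) - \<i> * of_real x) = of_nat k * (\<i> * of_real \<tau>) + \<i> * of_real x"
     "cnj (of_nat k * (- \<i> * of_real \<tau>) + \<i> * of_real x) = of_nat k * (\<i> * of_real \<tau>) - \<i> * of_real x" for k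
    by simp_all
  have h: "cnj (half_plane_pow s (of_nat k * (- \<i> * of_real \<tau>) - \<i> * of_real x)) = half_plane_pow s (of_nat k * (\<i> * of_real \<tau>) + \<i> * of_real x)"
     "cnj (half_plane_pow s (of_nat k * (- \<i> * of_real \<tau>) + \<i> * of_real x)) = half_plane_pow s (of_nat k * (\<i> * of_real \<tau>) - \<i> * of_real x)" for k
    by (subst half_plane_pow_cnj, simp, simp only: eq)+
  have i: "cnj (\<i> ^ e) = (- 1) ^ e * \<i> ^ e" by (simp add: power_minus[of \<i>])
  have one: "(- 1) ^ e * ((- 1) ^ e * z) = (z :: complex)" for z by (cases "even e") auto
  have "cnj (ext_diff m s e x (- \<i> * of_real \<tau>)) = of_real (dcoef m 0 * cap_pow s e x) +
     (\<Sum>k = 1..m. of_real (dcoef m (int k)) * ((- 1) ^ e * \<i> ^ e) *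
        ((of_nat k * (\<i> * of_real \<tau>) + \<i> * of_real x) ^ e * half_plane_pow s (of_nat k * (\<i> * of_real \<tau>) + \<i> * of_real x) +
         (- 1) ^ e * ((of_nat k * (\<i> * of_real \<tau>) - \<i> * of_real x) ^ e * half_plane_pow s (of_nat k * (\<i> * of_real \<tau>) - \<i> * of_real x))))"
    unfolding ext_diff_def complex_cnj_add cnj_sum complex_cnj_mult complex_cnj_complex_of_real i h
      complex_cnj_power complex_cnj_one complex_cnj_minus
    by (simp add: eq power_minus[of \<i>] mult_ac)
  also have "\<dots> = ext_diff m s e x (\<i> * of_real \<tau>)"
  proof -
    have T: "c * ((- 1) ^ e * i) * (X + (- 1) ^ e * Y) = c * i * (Y + (- 1) ^ e * X)" for c i X Y :: complex
      by (cases "even e") (simp_all add: algebra_simps)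
    show ?thesis unfolding ext_diff_def T ..
  qed
  finally show ?thesis by simp
qed

text \<open>
  Near \<open>p = 0\<close> no branch point is met, and the function is the plain finite difference of
  \<open>z\<^sup>e (1 - z\<^sup>2)\<^sup>s\<close>.
\<close>

lemma ext_diff_small:
  assumes x: "\<bar>x\<bar> < 1" and s: "0 < s" and p: "0 \<le> Re p" and small: "2 * (real m * norm p) \<le> (1 - \<bar>x\<bar>) / 2"
  shows "norm (ext_diff m s e x p) \<le> 4 ^ m * (2 * 2 powr s) * (real m * norm p / ((1 - \<bar>x\<bar>) / 2)) ^ (2 * m)"
proof -
  define f where "f z = z ^ e * (1 - z\<^sup>2) powr of_real s" for z :: complex
  have fi: "f (\<i> * q) = \<i> ^ e * (q ^ e * half_plane_pow s q)"
    "f (- \<i> * q) = \<i> ^ e * ((- 1) ^ e * (q ^ e * half_plane_pow s q))" if "0 \<le> Re q" "norm q < 1" for q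
    unfolding f_def half_plane_pow_inside[OF that] power_ii_mult by (simp_all add: power_mult_distrib)
  have q: "norm (of_nat k * p - \<i> * of_real x) < 1" "norm (of_nat k * p + \<i> * of_real x) < 1" if "k \<in> {1..m}" for k
  proof -
    have "norm (of_nat k * p) \<le> real m * norm p" using that by (simp add: norm_mult mult_right_mono)
    moreover have "norm (\<i> * complex_of_real x) = \<bar>x\<bar>" by (simp add: norm_mult)
    moreover have "0 \<le> real m * norm p" by simp
    ultimately have "norm (of_nat k * p) + norm (\<i> * complex_of_real x) < 1" using small x by argo
    then show "norm (of_nat k * p - \<i> * of_real x) < 1" "norm (of_nat k * p + \<i> * of_real x) < 1"
      by (meson norm_triangle_ineq4 norm_triangle_ineq le_less_trans)+
  qed
  have eq: "of_real x + of_int (int k) * (\<i> * p) = \<i> * (of_nat k * p - \<i> * of_real x)"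
     "of_real x + of_int (- int k) * (\<i> * p) = - \<i> * (of_nat k * p + \<i> * of_real x)" for k
    by (simp_all add: algebra_simps)
  have sum_eq: "ext_diff m s e x p = (\<Sum>k = - int m..int m. dcoef m k *\<^sub>R f (of_real x + of_int k * (\<i> * p)))"
    unfolding sum_dcoef_symmetric ext_diff_def
  proof (intro arg_cong2[of _ _ _ _ "(+)"] sum.cong refl)
    show "complex_of_real (dcoef m 0 * cap_pow s e x) = dcoef m 0 *\<^sub>R f (of_real x + of_int 0 * (\<i> * p))"
      using cap_pow_complex[OF x, of e s] by (simp add: f_def scaleR_conv_of_real)
    fix k assume k: "k \<in> {1..m}"
    show "of_real (dcoef m (int k)) * \<i> ^ e *
        ((of_nat k * p - \<i> * of_real x) ^ e * half_plane_pow s (of_nat k * p - \<i> * of_real x) +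
         (- 1) ^ e * ((of_nat k * p + \<i> * of_real x) ^ e * half_plane_pow s (of_nat k * p + \<i> * of_real x)))
      = dcoef m (int k) *\<^sub>R (f (of_real x + of_int (int k) * (\<i> * p)) + f (of_real x + of_int (- int k) * (\<i> * p)))"
      unfolding eq using p q[OF k] by (subst fi, simp, simp, subst fi) (simp_all add: scaleR_conv_of_real algebra_simps)
  qed
  have "norm (\<Sum>k = - int m..int m. dcoef m k *\<^sub>R f (of_real x + of_int k * (\<i> * p)))
      \<le> 4 ^ m * (2 * 2 powr s) * (real m * norm (\<i> * p) / ((1 - \<bar>x\<bar>) / 2)) ^ (2 * m)"
    unfolding f_def by (rule cap_complex_diff_bound) (use assms in \<open>auto simp: norm_mult\<close>)
  then show ?thesis unfolding sum_eq by (simp add: norm_mult)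
qed

section \<open>The one-dimensional integral for non-integer order\<close>

definition coef_sum :: "nat \<Rightarrow> real \<Rightarrow> real" where
  "coef_sum m s = (\<Sum>k = 1..m. dcoef m (int k) * real k powr (2 * s))"

text \<open>
  \<open>half_plane_pow s (k p - \<i> x)\<close> divided by \<open>p\<^sup>2\<^sup>s\<close>, as a function of \<open>w = 1 / p\<close>. It is holomorphic
  near \<open>w = 0\<close>, so the behaviour at infinity is read off from its first order expansion.
\<close>

definition end_factor :: "real \<Rightarrow> real \<Rightarrow> real \<Rightarrow> complex \<Rightarrow> complex" where
  "end_factor s k x w = (of_real k + of_real (1 - x) * (\<i> * w)) powr of_real s * (of_real k + of_real (- (1 + x)) * (\<i> * w)) powr of_real s"

lemma end_factor_0: "0 < k \<Longrightarrow> end_factor s k x 0 = of_real (k powr (2 * s))"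
proof -
  assume "0 < k"
  have "end_factor s k x 0 = complex_of_real (k powr s) * complex_of_real (k powr s)"
    unfolding end_factor_def using \<open>0 < k\<close> by (simp add: powr_of_real)
  also have "\<dots> = of_real (k powr (2 * s))"
    by (simp only: of_real_mult[symmetric] powr_add[symmetric] mult_2[symmetric])
  finally show ?thesis .
qed

lemma end_factor_deriv:
  assumes "0 < k"
  shows "(end_factor s k x has_field_derivative (- 2 * \<i> * of_real (x * s * k powr (2 * s - 1)))) (at 0)"
proof -
  have nn: "complex_of_real k \<notin> \<real>\<^sub>\<le>\<^sub>0" using assms by simp
  have p: "complex_of_real k powr (of_real s - 1) = of_real (k powr (s - 1))"
    using powr_of_real[of k "s - 1"] assms by simp
  have q: "complex_of_real k powr of_real s = of_real (k powr s)"
    using powr_of_real[of k s] assms by simp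
  have r: "k powr (s - 1) * k powr s = k powr (2 * s - 1)" by (simp add: powr_add[symmetric])
  have d1: "((\<lambda>w. (of_real k + of_real (1 - x) * (\<i> * w)) powr of_real s) has_field_derivative
      of_real s * of_real k powr (of_real s - 1) * (\<i> * of_real (1 - x))) (at 0)"
    by (rule DERIV_chain'[of "\<lambda>w. of_real k + of_real (1 - x) * (\<i> * w)" _ 0 UNIV "\<lambda>z. z powr of_real s", OF _ has_field_derivative_powr, THEN DERIV_cong])
      (use nn in \<open>auto intro!: derivative_eq_intros\<close>)
  have d2: "((\<lambda>w. (of_real k + of_real (- (1 + x)) * (\<i> * w)) powr of_real s) has_field_derivative
      of_real s * of_real k powr (of_real s - 1) * (\<i> * of_real (- (1 + x)))) (at 0)"
    by (rule DERIV_chain'[of "\<lambda>w. of_real k + of_real (- (1 + x)) * (\<i> * w)" _ 0 UNIV "\<lambda>z. z powr of_real s", OF _ has_field_derivative_powr, THEN DERIV_cong])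
      (use nn in \<open>auto intro!: derivative_eq_intros\<close>)
  have "complex_of_real s * of_real (k powr (s - 1)) * (\<i> * of_real (1 - x)) * of_real (k powr s) +
        complex_of_real s * of_real (k powr (s - 1)) * (\<i> * of_real (- (1 + x))) * of_real (k powr s)
     = of_real s * (of_real (k powr (s - 1)) * of_real (k powr s)) * (\<i> * (of_real (1 - x) + of_real (- (1 + x))))"
    by algebra
  also have "\<dots> = - 2 * \<i> * of_real (x * s * k powr (2 * s - 1))"
    unfolding of_real_mult[symmetric] r by (simp add: mult_ac)
  finally show ?thesis
    unfolding end_factor_def[abs_def]
    by (intro DERIV_cong[OF DERIV_mult[OF d1 d2]]) (simp add: p q mult_ac)
qed

text \<open>
  For large \<open>|p|\<close> the second factors have positive real part, so the powers of the products split.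
\<close>

lemma half_plane_pow_scaled:
  assumes p: "0 \<le> Re p" "p \<noteq> 0" and k: "0 < k"
    and b: "\<bar>1 - x\<bar> < norm p * k" "\<bar>1 + x\<bar> < norm p * k"
  shows "half_plane_pow s (of_real k * p - \<i> * of_real x) * exp (- 2 * of_real s * Ln p) = end_factor s k x (inverse p)"
proof -
  have pos: "0 < Re (of_real k + of_real c * (\<i> * inverse p))" if "\<bar>c\<bar> < norm p * k" for c
  proof -
    have "norm (of_real c * (\<i> * inverse p)) < k"
      using that p by (simp add: norm_mult norm_inverse norm_divide divide_simps mult.commute)
    then have "- Re (of_real c * (\<i> * inverse p)) < k"
      using abs_Re_le_cmod[of "of_real c * (\<i> * inverse p)"] by linarith
    then show ?thesis unfolding plus_complex.simps Re_complex_of_real by linarith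
  qed
  have pos': "0 < Re (of_real k + of_real (- (1 + x)) * (\<i> * inverse p))"
    by (rule pos) (use b(2) in simp)
  have e1: "of_real k * p - \<i> * of_real x + \<i> = p * (of_real k + of_real (1 - x) * (\<i> * inverse p))"
    using p by (simp add: field_simps)
  have e2: "of_real k * p - \<i> * of_real x - \<i> = p * (of_real k + of_real (- (1 + x)) * (\<i> * inverse p))"
    using p by (simp add: field_simps)
  have f: "half_plane_pow s (of_real k * p - \<i> * of_real x) =
      (p powr of_real s * p powr of_real s) * end_factor s k x (inverse p)"
    unfolding half_plane_pow_def e1 e2 end_factor_def
      powr_mult_right_halfplane[OF p(1) pos[OF b(1)]] powr_mult_right_halfplane[OF p(1) pos']
    by (simp only: mult_ac)
  have "p powr of_real s * p powr of_real s * exp (- 2 * of_real s * Ln p) = 1"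
    using p by (simp add: powr_def exp_add[symmetric])
  then show ?thesis unfolding f by (metis mult.assoc mult.commute mult_1)
qed

lemma tendsto_inverse_at_infinity:
  fixes f :: "complex \<Rightarrow> complex"
  assumes "(f \<longlongrightarrow> l) (at 0)"
  shows "((\<lambda>p. f (inverse p)) \<longlongrightarrow> l) (inf at_infinity A)"
proof -
  have "filterlim (\<lambda>p::complex. inverse p) (at 0) at_infinity"
    by (simp add: filterlim_inverse_at_iff filterlim_ident)
  then have "((\<lambda>p. f (inverse p)) \<longlongrightarrow> l) at_infinity" by (rule filterlim_compose[OF assms])
  then show ?thesis by (rule tendsto_mono[rotated]) simp
qed

text \<open>
  The terms are functions of \<open>w = 1 / p\<close>. For \<open>e = 0\<close> the limit is a value at \<open>w = 0\<close>. For \<open>e = 1\<close> the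
  leading terms cancel in the difference of the two terms with the same \<open>k\<close>, and the limit is a
  derivative at \<open>w = 0\<close>: the factor \<open>z\<close> contributes \<open>x\<close>, and the power \<open>2 s x\<close>.
\<close>

lemma ext_diff_at_infinity:
  assumes s: "0 < s" and e: "e \<le> 1"
  shows "((\<lambda>p. ext_diff m s e x p * exp (- 2 * complex_of_real s * Ln p)) \<longlongrightarrow> of_real (2 * ((1 + 2 * s) * x) ^ e * coef_sum m s))
          (inf at_infinity (principal {p. 0 \<le> Re p}))" (is "(_ \<longlongrightarrow> _) ?F")
proof -
  define T where "T k p = (of_nat k * p - \<i> * of_real x) ^ e * half_plane_pow s (of_nat k * p - \<i> * of_real x) +
         (- 1) ^ e * ((of_nat k * p + \<i> * of_real x) ^ e * half_plane_pow s (of_nat k * p + \<i> * of_real x))" for k p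
  have E0: "((\<lambda>p. exp (- 2 * complex_of_real s * Ln p)) \<longlongrightarrow> 0) ?F"
  proof (rule tendsto_mono[of _ at_infinity], simp, rule Lim_null_comparison)
    show "\<forall>\<^sub>F p in at_infinity. norm (exp (- 2 * complex_of_real s * Ln p)) \<le> norm p powr (- 2 * s)"
      using eventually_not_equal_at_infinity[of 0] by eventually_elim (simp add: powr_def)
    have "((\<lambda>r. r powr (- 2 * s)) \<longlongrightarrow> 0) at_top"
      using s by (intro tendsto_neg_powr filterlim_ident) auto
    then show "((\<lambda>p::complex. norm p powr (- 2 * s)) \<longlongrightarrow> 0) at_infinity"
      by (rule filterlim_compose[OF _ filterlim_norm_at_top])
  qed
  have TK: "((\<lambda>p. \<i> ^ e * T k p * exp (- 2 * complex_of_real s * Ln p)) \<longlongrightarrow> of_real (2 * ((1 + 2 * s) * x) ^ e * real k powr (2 * s))) ?F"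
    if k: "k \<in> {1..m}" for k
  proof -
    have k0: "0 < real k" using k by auto
    define h\<^sub>k where "h\<^sub>k y w = (of_real (real k) - \<i> * of_real y * w) ^ e * end_factor s (real k) y w" for y w
    \<comment> \<open>For \<open>e = 1\<close> one factor \<open>p = 1 / w\<close> is left over from the powers.\<close>
    define R where "R w = \<i> ^ e * (if e = 0 then h\<^sub>k x w + h\<^sub>k (- x) w else (h\<^sub>k x w - h\<^sub>k (- x) w) / w)" for w
    have scaled: "\<i> ^ e * T k p * exp (- 2 * complex_of_real s * Ln p) = R (inverse p)"
      if p: "0 \<le> Re p" "norm p > (\<bar>1 - x\<bar> + \<bar>1 + x\<bar>) / real k" for p
    proof -
      have "(\<bar>1 - x\<bar> + \<bar>1 + x\<bar>) / real k \<ge> 0" by simp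
      then have "0 < norm p" using p(2) by linarith
      then have p0: "p \<noteq> 0" by simp
      have "\<bar>1 - x\<bar> + \<bar>1 + x\<bar> < norm p * real k" using p(2) k0 by (simp add: field_simps)
      then have b: "\<bar>1 - x\<bar> < norm p * real k" "\<bar>1 + x\<bar> < norm p * real k" by linarith+
      have h1: "half_plane_pow s (of_nat k * p - \<i> * of_real x) * exp (- 2 * complex_of_real s * Ln p) = end_factor s (real k) x (inverse p)"
        using half_plane_pow_scaled[OF p(1) p0 k0 b] by simp
      have h2: "half_plane_pow s (of_nat k * p + \<i> * of_real x) * exp (- 2 * complex_of_real s * Ln p) = end_factor s (real k) (- x) (inverse p)"
        using half_plane_pow_scaled[OF p(1) p0 k0, of "- x" s] b by simp
      have "T k p * exp (- 2 * complex_of_real s * Ln p) = (of_nat k * p - \<i> * of_real x) ^ e * end_factor s (real k) x (inverse p) +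
         (- 1) ^ e * ((of_nat k * p + \<i> * of_real x) ^ e * end_factor s (real k) (- x) (inverse p))"
        unfolding T_def h1[symmetric] h2[symmetric] by (simp only: distrib_right mult.assoc)
      moreover have "of_nat k * p - \<i> * of_real x = (of_real (real k) - \<i> * of_real x * inverse p) * p"
        "of_nat k * p + \<i> * of_real x = (of_real (real k) - \<i> * of_real (- x) * inverse p) * p"
        using p0 by (simp_all add: field_simps)
      moreover have "(X\<^sub>1 * p) ^ e * E\<^sub>1 + (- 1) ^ e * ((X\<^sub>2 * p) ^ e * E\<^sub>2) =
        (if e = 0 then X\<^sub>1 ^ e * E\<^sub>1 + X\<^sub>2 ^ e * E\<^sub>2 else (X\<^sub>1 ^ e * E\<^sub>1 - X\<^sub>2 ^ e * E\<^sub>2) / inverse p)"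
        for X\<^sub>1 X\<^sub>2 E\<^sub>1 E\<^sub>2 :: complex
      proof -
        have "e = 0 \<or> e = 1" using e by auto
        then show ?thesis by (elim disjE) (simp_all add: divide_inverse algebra_simps)
      qed
      ultimately have "T k p * exp (- 2 * complex_of_real s * Ln p) = (if e = 0 then h\<^sub>k x (inverse p) + h\<^sub>k (- x) (inverse p) else (h\<^sub>k x (inverse p) - h\<^sub>k (- x) (inverse p)) / inverse p)"
        unfolding h\<^sub>k_def by (simp only:)
      then show ?thesis unfolding R_def by (simp only: mult.assoc)
    qed
    have R: "(R \<longlongrightarrow> of_real (2 * ((1 + 2 * s) * x) ^ e * real k powr (2 * s))) (at 0)"
    proof (cases "e = 0")
      case True
      have "((\<lambda>w. end_factor s (real k) y w) \<longlongrightarrow> end_factor s (real k) y 0) (at 0)" for y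
        using DERIV_isCont[OF end_factor_deriv[OF k0, of s y]] by (simp add: isCont_def)
      then have "((\<lambda>w. end_factor s (real k) x w + end_factor s (real k) (- x) w) \<longlongrightarrow> end_factor s (real k) x 0 + end_factor s (real k) (- x) 0) (at 0)"
        by (intro tendsto_add)
      then show ?thesis using True by (simp add: R_def[abs_def] h\<^sub>k_def end_factor_0[OF k0])
    next
      case False
      then have e1: "e = 1" using e by simp
      define D where "D y = - (\<i> * of_real y) * of_real (real k powr (2 * s)) + of_real (real k) * (- 2 * \<i> * of_real (y * s * real k powr (2 * s - 1)))" for y
      have d: "(h\<^sub>k y has_field_derivative D y) (at 0)" for y
        unfolding h\<^sub>k_def[abs_def] e1 power_one_right
        by (rule DERIV_cong[OF DERIV_mult[OF _ end_factor_deriv[OF k0]], of _ "- (\<i> * of_real y)"])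
          (auto intro!: derivative_eq_intros simp: D_def end_factor_0[OF k0])
      have kk: "real k * real k powr (2 * s - 1) = real k powr (2 * s)"
        using k0 powr_mult_base[of "real k" "2 * s - 1"] by simp
      have eqy: "of_real (real k) * (- 2 * \<i> * complex_of_real (y * s * real k powr (2 * s - 1))) = - 2 * \<i> * of_real (y * s * real k powr (2 * s))" for y
        unfolding kk[symmetric] by (simp add: mult_ac)
      have D: "D x - D (- x) = - 2 * \<i> * of_real ((1 + 2 * s) * x * real k powr (2 * s))"
        unfolding D_def eqy by (simp add: algebra_simps)
      have z: "h\<^sub>k x 0 - h\<^sub>k (- x) 0 = 0" by (simp add: h\<^sub>k_def end_factor_0[OF k0])
      have "((\<lambda>w. h\<^sub>k x w - h\<^sub>k (- x) w) has_field_derivative (D x - D (- x))) (at 0)"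
        by (rule DERIV_diff[OF d d])
      then have "((\<lambda>w. (h\<^sub>k x w - h\<^sub>k (- x) w) / w) \<longlongrightarrow> D x - D (- x)) (at 0)"
        using z by (simp add: DERIV_def)
      from tendsto_mult_left[OF this, of \<i>]
      have "((\<lambda>w. \<i> * ((h\<^sub>k x w - h\<^sub>k (- x) w) / w)) \<longlongrightarrow> \<i> * (D x - D (- x))) (at 0)" .
      moreover have "\<i> * (D x - D (- x)) = of_real (2 * ((1 + 2 * s) * x) ^ e * real k powr (2 * s))"
        unfolding D e1 by (simp add: mult.assoc)
      ultimately show ?thesis using e1 by (simp only: R_def[abs_def]) simp
    qed
    show ?thesis
    proof (rule Lim_transform_eventually[OF tendsto_inverse_at_infinity[OF R]])
      have "\<forall>\<^sub>F p::complex in at_infinity. norm p > (\<bar>1 - x\<bar> + \<bar>1 + x\<bar>) / real k"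
        using filterlim_norm_at_top[THEN filterlim_at_top_dense[THEN iffD1]] by blast
      then show "\<forall>\<^sub>F p in ?F. R (inverse p) = \<i> ^ e * T k p * exp (- 2 * complex_of_real s * Ln p)"
        unfolding eventually_inf_principal by eventually_elim (use scaled in auto)
    qed
  qed
  have "((\<lambda>p. of_real (dcoef m 0 * cap_pow s e x) * exp (- 2 * complex_of_real s * Ln p) + (\<Sum>k = 1..m. of_real (dcoef m (int k)) * (\<i> ^ e * T k p * exp (- 2 * complex_of_real s * Ln p))))
     \<longlongrightarrow> of_real (dcoef m 0 * cap_pow s e x) * 0 + (\<Sum>k = 1..m. of_real (dcoef m (int k)) * of_real (2 * ((1 + 2 * s) * x) ^ e * real k powr (2 * s)))) ?F"
    by (intro tendsto_add tendsto_mult tendsto_const tendsto_sum E0 TK)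
  moreover have "ext_diff m s e x p * exp (- 2 * complex_of_real s * Ln p) =
     of_real (dcoef m 0 * cap_pow s e x) * exp (- 2 * complex_of_real s * Ln p) + (\<Sum>k = 1..m. of_real (dcoef m (int k)) * (\<i> ^ e * T k p * exp (- 2 * complex_of_real s * Ln p)))" for p
    unfolding ext_diff_def T_def[symmetric] distrib_right sum_distrib_right by (simp only: mult.assoc)
  moreover have "of_real (dcoef m 0 * cap_pow s e x) * 0 + (\<Sum>k = 1..m. of_real (dcoef m (int k)) * of_real (2 * ((1 + 2 * s) * x) ^ e * real k powr (2 * s)))
     = complex_of_real (2 * ((1 + 2 * s) * x) ^ e * coef_sum m s)"
    unfolding coef_sum_def sum_distrib_left of_real_sum by (simp add: mult_ac)
  ultimately show ?thesis by simp
qed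

lemma cap_diff_log_limit:
  assumes x: "\<bar>x\<bar> < 1" and s: "0 < s" "s < real m" and e: "e \<le> 1"
  shows "((\<lambda>R. integral {- R..R} (\<lambda>\<xi>. exp (- 2 * s * \<xi>) * (sin (pi * s) * cap_diff m s e x (exp \<xi>))))
          \<longlongrightarrow> - pi * ((1 + 2 * s) * x) ^ e * coef_sum m s) at_top"
proof -
  define r where "r = (1 - \<bar>x\<bar>) / 2"
  have m: "0 < real m" using s by linarith
  have r: "0 < r" using x by (simp add: r_def)
  have "((\<lambda>R. integral {- R..R}
            (\<lambda>\<xi>. exp (- 2 * s * \<xi>) * Im (cis (pi * s) * ext_diff m s e x (- \<i> * of_real (exp \<xi>)))))
          \<longlongrightarrow> - pi * (2 * ((1 + 2 * s) * x) ^ e * coef_sum m s) / 2) at_top"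
  proof (rule strip_contour_limit[OF continuous_ext_diff holomorphic_ext_diff ext_diff_symmetric _ _ _ ext_diff_at_infinity])
    show "norm (ext_diff m s e x p) \<le> (4 ^ m * (2 * 2 powr s) * (real m / r) ^ (2 * m)) * norm p ^ (2 * m)"
      if "0 \<le> Re p" "norm p \<le> r / (2 * real m)" for p
    proof -
      have "2 * (real m * norm p) \<le> r" using that m by (simp add: field_simps)
      from ext_diff_small[OF x s(1) that(1) this[unfolded r_def], of e] show ?thesis
        unfolding r_def[symmetric] by (simp only: power_mult_distrib power_divide times_divide_eq_left times_divide_eq_right mult.assoc)
    qed
  qed (use s e r m in auto)
  then show ?thesis
    using ext_diff_boundary[OF x s(1), of "exp _" m e] by (simp add: mult.assoc)
qed

section \<open>Nonvanishing of the normalising constants\<close>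

lemma dcoef_nonzero: "k \<le> m \<Longrightarrow> dcoef m (int k) \<noteq> 0"
  by (simp add: dcoef_of_nat)

text \<open>
  The points of \<open>W\<close> lie strictly between consecutive points of \<open>Z\<close>. Their disjointness from \<open>Z\<close> allows
  a multiple zero of \<open>f\<close> in \<open>Z\<close> to be counted as one more zero of \<open>f'\<close>.
\<close>

lemma rolle_zeros:
  fixes f f' :: "real \<Rightarrow> real"
  assumes fin: "finite Z" and ne: "Z \<noteq> {}" and zero: "\<And>z. z \<in> Z \<Longrightarrow> f z = 0"
    and deriv: "\<And>y. (f has_real_derivative f' y) (at y)"
  shows "\<exists>W. finite W \<and> Suc (card W) = card Z \<and> W \<inter> Z = {} \<and> (\<forall>w\<in>W. f' w = 0 \<and> w < Max Z)"
  using fin ne zero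
proof (induction Z rule: finite_linorder_max_induct)
  case empty
  then show ?case by simp
next
  case (insert b A)
  show ?case
  proof (cases "A = {}")
    case True
    then show ?thesis by (intro exI[of _ "{}"]) auto
  next
    case False
    have "\<And>z. z \<in> A \<Longrightarrow> f z = 0" using insert.prems by blast
    from insert.IH[OF False this] obtain W where W: "finite W" "Suc (card W) = card A" "W \<inter> A = {}"
      "\<And>w. w \<in> W \<Longrightarrow> f' w = 0 \<and> w < Max A"
      by blast
    have M: "Max A \<in> A" "Max A < b" using False insert by auto
    then obtain w where w: "Max A < w" "w < b" "f' w = 0"
      using Rolle_deriv[of "Max A" b f "\<lambda>y h. f' y * h"] insert.prems deriv
      by (auto simp: has_field_derivative_def fun_eq_iff
          intro!: continuous_at_imp_continuous_on DERIV_isCont[OF deriv])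
    have "Max (insert b A) = b" using M insert by (intro Max_eqI) auto
    moreover have "w \<notin> A" using w(1) \<open>finite A\<close> by (auto dest: Max_ge)
    moreover have "w \<notin> W" "b \<notin> W" using W(4) w M by force+
    moreover have "b \<notin> A" using insert by auto
    ultimately show ?thesis using W w M insert
      by (intro exI[of _ "insert w W"]) (auto dest!: W(4))
  qed
qed

text \<open>
  Multiplying by an exponential makes one of the terms constant; differentiation removes it, and by
  Rolle's theorem costs at most one zero.
\<close>

lemma exp_sum_zeros:
  fixes c l :: "'i \<Rightarrow> real"
  assumes "finite I" "I \<noteq> {}" "inj_on l I" "\<And>i. i \<in> I \<Longrightarrow> c i \<noteq> 0" "finite Z"
    "\<And>z. z \<in> Z \<Longrightarrow> (\<Sum>i\<in>I. c i * exp (l i * z)) = 0"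
  shows "card Z < card I"
  using assms
proof (induction I arbitrary: c l Z rule: finite_induct)
  case empty
  then show ?case by simp
next
  case (insert a I)
  show ?case
  proof (cases "Z = {} \<or> I = {}")
    case True
    then show ?thesis
    proof
      assume "I = {}"
      with insert.prems have "Z = {}" by force
      then show ?thesis using insert by simp
    qed (use insert in simp)
  next
    case False
    define f where "f y = c a + (\<Sum>i\<in>I. c i * exp ((l i - l a) * y))" for y
    define f' where "f' y = (\<Sum>i\<in>I. (c i * (l i - l a)) * exp ((l i - l a) * y))" for y
    have d: "(f has_real_derivative f' y) (at y)" for y
      unfolding f_def f'_def by (auto intro!: derivative_eq_intros sum.cong)
    have z: "f z = 0" if "z \<in> Z" for z
    proof -
      have "f z = exp (- l a * z) * (\<Sum>i\<in>insert a I. c i * exp (l i * z))"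
        using insert.hyps by (simp add: f_def sum_distrib_left distrib_left exp_minus exp_diff divide_inverse algebra_simps)
      then show ?thesis using insert.prems(5)[OF that] by simp
    qed
    obtain W where W: "finite W" "Suc (card W) = card Z" "\<And>w. w \<in> W \<Longrightarrow> f' w = 0"
      using rolle_zeros[OF insert.prems(4) _ z d] False by auto
    have "card W < card I"
    proof (rule insert.IH[of "\<lambda>i. l i - l a" "\<lambda>i. c i * (l i - l a)"])
      show "inj_on (\<lambda>i. l i - l a) I" using insert.prems(2) by (auto simp: inj_on_def)
      show "c i * (l i - l a) \<noteq> 0" if "i \<in> I" for i
        using insert.prems(2,3) that insert.hyps by (auto simp: inj_on_def)
    qed (use W False in \<open>auto simp: f'_def\<close>)
    then show ?thesis using W insert by simp
  qed
qed

lemma coef_sum_exp: "coef_sum m s = (\<Sum>k = 1..m. dcoef m (int k) * exp ((2 * ln (real k)) * s))"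
  unfolding coef_sum_def by (intro sum.cong) (auto simp: powr_def mult_ac)

lemma coef_sum_integer:
  assumes "0 < j" "j < m" shows "coef_sum m (real j) = 0"
proof -
  have "real k powr (2 * real j) = real k ^ (2 * j)" if "k \<in> {1..m}" for k
    using powr_realpow[of "real k" "2 * j"] that by simp
  then show ?thesis using dcoef_even_moments[OF assms] by (simp add: coef_sum_def)
qed

text \<open>
  As a function of \<open>s\<close> this is an exponential sum with \<open>m\<close> terms. It already has the \<open>m - 1\<close> zeros
  \<open>1, \<dots>, m - 1\<close>, which come from the vanishing moments.
\<close>

lemma coef_sum_nonzero:
  assumes "0 < s" "s \<notin> \<nat>" "0 < m" shows "coef_sum m s \<noteq> 0"
proof
  assume "coef_sum m s = 0"
  have "card (insert s (real ` {1..<m})) < card {1..m}"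
  proof (rule exp_sum_zeros[of _ "\<lambda>k. 2 * ln (real k)" "\<lambda>k. dcoef m (int k)"])
    show "(\<Sum>k = 1..m. dcoef m (int k) * exp (2 * ln (real k) * z)) = 0" if "z \<in> insert s (real ` {1..<m})" for z
      using that \<open>coef_sum m s = 0\<close> coef_sum_integer[of _ m] unfolding coef_sum_exp by auto
  qed (use \<open>0 < m\<close> in \<open>auto simp: inj_on_def dcoef_nonzero\<close>)
  moreover have "s \<notin> real ` {1..<m}" using assms by auto
  ultimately show False using \<open>0 < m\<close> by (simp add: card_image)
qed

text \<open>
  Half the derivative of \<open>coef_sum m\<close> at \<open>s\<close>.
\<close>

definition coef_log_sum :: "nat \<Rightarrow> real \<Rightarrow> real" where
  "coef_log_sum m s = (\<Sum>k = 1..m. dcoef m (int k) * real k powr (2 * s) * ln (real k))"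

text \<open>
  All zeros of \<open>coef_sum m\<close> are simple. The derivative has only \<open>m - 1\<close> terms, as the term with \<open>k = 1\<close>
  is constant, and by Rolle's theorem it has \<open>m - 2\<close> zeros between \<open>1, \<dots>, m - 1\<close>; a double zero at \<open>j\<close>
  would be one zero too many.
\<close>

lemma coef_log_sum_nonzero:
  assumes j: "0 < j" "j < m" shows "coef_log_sum m (real j) \<noteq> 0"
proof
  assume z: "coef_log_sum m (real j) = 0"
  define f' where "f' y = (\<Sum>k = 2..m. (dcoef m (int k) * (2 * ln (real k))) * exp ((2 * ln (real k)) * y))" for y
  have split: "{1..m} = insert 1 {2..m}" using j by auto
  have d: "(coef_sum m has_real_derivative f' y) (at y)" for y
    unfolding coef_sum_exp[abs_def] f'_def split by (auto intro!: derivative_eq_intros sum.cong)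
  have f'j: "f' (real j) = 2 * coef_log_sum m (real j)"
    unfolding f'_def coef_log_sum_def split by (simp add: sum_distrib_left powr_def mult_ac)
  have "\<exists>W. finite W \<and> Suc (card W) = card (real ` {1..<m}) \<and> W \<inter> real ` {1..<m} = {} \<and> (\<forall>w\<in>W. f' w = 0 \<and> w < Max (real ` {1..<m}))"
    by (rule rolle_zeros[OF _ _ _ d]) (use j coef_sum_integer[of _ m] in auto)
  then obtain W where W: "finite W" "Suc (card W) = card (real ` {1..<m})" "W \<inter> real ` {1..<m} = {}" "\<And>w. w \<in> W \<Longrightarrow> f' w = 0"
    by blast
  have "card (insert (real j) W) < card {2..m}"
  proof (rule exp_sum_zeros[of _ "\<lambda>k. 2 * ln (real k)" "\<lambda>k. dcoef m (int k) * (2 * ln (real k))"])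
    show "(\<Sum>k = 2..m. dcoef m (int k) * (2 * ln (real k)) * exp (2 * ln (real k) * y)) = 0" if "y \<in> insert (real j) W" for y
      using that W(4) f'j z unfolding f'_def by auto
  qed (use j W in \<open>auto simp: inj_on_def dcoef_nonzero\<close>)
  moreover have "real j \<notin> W" using W(3) j by auto
  ultimately show False using W j by (simp add: card_image)
qed

text \<open>
  The constant \<open>K\<close> of the one-dimensional formula. For \<open>0 < s < m\<close> the value at an integer is the limit of
  the values at nearby non-integers.
\<close>

definition line_const :: "nat \<Rightarrow> real \<Rightarrow> real" where
  "line_const m s = (if s \<in> \<nat> then - 2 * cos (pi * s) * coef_log_sum m s
     else - pi * coef_sum m s / sin (pi * s))"

lemma Gamma_reflection_real:
  assumes "0 < s" "s \<notin> \<nat>"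
  shows "Gamma (- s) * Gamma (1 + s) = - pi / sin (pi * s)"
proof -
  have sin: "sin (complex_of_real pi * complex_of_real s) = complex_of_real (sin (pi * s))"
    by (metis of_real_mult sin_of_real)
  have "complex_of_real (Gamma s * Gamma (- s)) = of_real (- pi / (s * sin (pi * s)))"
    using Gamma_reflection_complex'[of "of_real s"] unfolding sin
    by (simp add: Gamma_complex_of_real[symmetric])
  then have "Gamma s * Gamma (- s) = - pi / (s * sin (pi * s))" by (simp only: of_real_eq_iff)
  moreover have "Gamma (1 + s) = s * Gamma s"
    using Gamma_plus1[of s] assms by (simp add: add.commute nonpos_Ints_def)
  ultimately show ?thesis using assms by (simp add: field_simps)
qed

text \<open>
  The normalisation \<open>frac_const\<close> contains the inverse of \<open>coef_sum\<close>, or of \<open>coef_log_sum\<close> up to sign, which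
  cancels against \<open>line_const\<close>. The remaining Gamma factors match by the reflection formula.
\<close>

lemma frac_const_line_const:
  assumes s: "0 < s" "s < real m"
  shows "frac_const n m s / 2 * line_const m s = k_const n s * Gamma (1 + s)"
proof (cases "s \<in> \<nat>")
  case False
  have S: "coef_sum m s \<noteq> 0" using coef_sum_nonzero[OF s(1) False] s by force
  have sum: "(\<Sum>k = 1..m. (- 1) ^ k * real ((2 * m) choose (m - k)) * real k powr (2 * s)) = coef_sum m s"
    unfolding coef_sum_def by (intro sum.cong) (auto simp: dcoef_of_nat)
  have r: "- pi / sin (pi * s) = Gamma (- s) * Gamma (1 + s)"
    using Gamma_reflection_real[OF s(1) False] by simp
  have L: "line_const m s = (Gamma (- s) * Gamma (1 + s)) * coef_sum m s"
    using False by (simp add: line_const_def r[symmetric])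
  have "- s \<notin> \<int>\<^sub>\<le>\<^sub>0"
  proof
    assume "- s \<in> \<int>\<^sub>\<le>\<^sub>0"
    then obtain n where "- s = - of_nat n" by (rule nonpos_Ints_cases')
    then show False using False by simp
  qed
  then have G: "Gamma (- s) \<noteq> 0" by (simp add: Gamma_eq_zero_iff)
  have p: "2 powr (2 * s - 1) = 4 powr s / (2::real)"
    by (simp add: powr_diff powr_powr[symmetric])
  show ?thesis unfolding frac_const_def k_const_def L sum p using False S G by (simp add: field_simps)
next
  case True
  then obtain j where j: "s = real j" by (auto elim: Nats_cases)
  have j0: "0 < j" "j < m" using s j by auto
  have c: "cos (pi * s) = (- 1) ^ j" unfolding j by (simp add: mult.commute)
  have "(\<Sum>k = 2..m. (- 1) powi (int k - \<lfloor>s\<rfloor> + 1) * real ((2 * m) choose (m - k)) * real k powr (2 * s) * ln (real k))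
     = (\<Sum>k = 2..m. - ((- 1) ^ j) * (dcoef m (int k) * real k powr (2 * s) * ln (real k)))"
    by (intro sum.cong refl) (simp add: dcoef_of_nat j power_int_add power_int_diff minus_one_power_iff)
  also have "\<dots> = - ((- 1) ^ j) * coef_log_sum m s"
  proof -
    have "{1..m} = insert 1 {2..m}" using j0 by auto
    then show ?thesis unfolding coef_log_sum_def sum_distrib_left by simp
  qed
  finally have sum: "(\<Sum>k = 2..m. (- 1) powi (int k - \<lfloor>s\<rfloor> + 1) * real ((2 * m) choose (m - k)) * real k powr (2 * s) * ln (real k))
     = - ((- 1) ^ j) * coef_log_sum m s" .
  have G: "Gamma (1 + s) = fact (nat \<lfloor>s\<rfloor>)" using Gamma_fact[of j, where 'a = real] j by simp
  have p: "2 powr (2 * s - 1) = 4 powr s / (2::real)"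
    by (simp add: powr_diff powr_powr[symmetric])
  have nz: "coef_log_sum m s \<noteq> 0" using coef_log_sum_nonzero[OF j0] j by simp
  show ?thesis unfolding frac_const_def line_const_def k_const_def sum p G c using True nz by simp
qed

section \<open>The one-dimensional integral for integer order\<close>

text \<open>
  Since the coefficients sum to zero, only the parts of the shifted integrals near the upper end
  survive: with \<open>Q' = q\<close> they are \<open>Q (R + a\<^sub>i) - Q R\<close>, which tends to \<open>L a\<^sub>i\<close>.
\<close>

lemma frullani_combination:
  fixes q :: "real \<Rightarrow> real" and c a :: "'i \<Rightarrow> real"
  assumes cont: "continuous_on UNIV q" and zero: "\<And>\<xi>. \<xi> \<le> - B \<Longrightarrow> q \<xi> = 0"
    and lim: "(q \<longlongrightarrow> L) at_top" and fin: "finite I" and a: "\<And>i. i \<in> I \<Longrightarrow> 0 \<le> a i"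
    and c: "(\<Sum>i\<in>I. c i) = 0"
  shows "((\<lambda>R. integral {- R..R} (\<lambda>\<xi>. \<Sum>i\<in>I. c i * q (\<xi> + a i))) \<longlongrightarrow> L * (\<Sum>i\<in>I. c i * a i)) at_top"
proof -
  have "\<exists>Q. \<forall>x::real. (-\<infinity>::ereal) < ereal x \<longrightarrow> ereal x < (\<infinity>::ereal) \<longrightarrow> (Q has_vector_derivative q x) (at x)"
    by (rule einterval_antiderivative) (use cont in \<open>auto simp: continuous_on_eq_continuous_at\<close>)
  then obtain Q where Q: "\<And>x. (Q has_real_derivative q x) (at x)"
    by (auto simp: has_real_derivative_iff_has_vector_derivative)
  have const: "Q y = Q (- B)" if "y \<le> - B" for y
  proof (cases "y = - B")
    case False
    then have "y < - B" using that by simp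
    obtain z where "y < z" "z < - B" "Q (- B) - Q y = (- B - y) * q z"
      using MVT2[OF \<open>y < - B\<close> Q] by blast
    then show ?thesis using zero[of z] by simp
  qed simp
  have int: "integral {- R..R} (\<lambda>\<xi>. \<Sum>i\<in>I. c i * q (\<xi> + a i)) = (\<Sum>i\<in>I. c i * (Q (R + a i) - Q R))"
    if R: "R \<ge> 0" "\<And>i. i \<in> I \<Longrightarrow> R \<ge> B + a i" for R
  proof -
    have "((\<lambda>\<xi>. \<Sum>i\<in>I. c i * q (\<xi> + a i)) has_integral (\<Sum>i\<in>I. c i * (Q (R + a i) - Q (- R + a i)))) {- R..R}"
    proof (intro has_integral_sum fin has_integral_mult_right)
      fix i
      show "((\<lambda>\<xi>. q (\<xi> + a i)) has_integral (Q (R + a i) - Q (- R + a i))) {- R..R}"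
      proof (rule fundamental_theorem_of_calculus)
        fix x
        have "((\<lambda>\<xi>. Q (\<xi> + a i)) has_real_derivative q (x + a i)) (at x)"
          using DERIV_shift[of Q "q (x + a i)" x "a i"] Q by simp
        then show "((\<lambda>\<xi>. Q (\<xi> + a i)) has_vector_derivative q (x + a i)) (at x within {- R..R})"
          by (simp add: has_real_derivative_iff_has_vector_derivative has_vector_derivative_at_within)
      qed (use R in auto)
    qed
    then have "integral {- R..R} (\<lambda>\<xi>. \<Sum>i\<in>I. c i * q (\<xi> + a i)) = (\<Sum>i\<in>I. c i * (Q (R + a i) - Q (- R + a i)))"
      by (rule integral_unique)
    also have "\<dots> = (\<Sum>i\<in>I. c i * (Q (R + a i) - Q (- B)))"
      by (intro sum.cong refl arg_cong2[of _ _ _ _ "(*)"] arg_cong2[of _ _ _ _ "(-)"] const) (use R in force)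
    also have "\<dots> = (\<Sum>i\<in>I. c i * (Q (R + a i) - Q R)) + (\<Sum>i\<in>I. c i) * (Q R - Q (- B))"
      unfolding sum_distrib_right sum.distrib[symmetric] by (intro sum.cong refl) (simp add: algebra_simps)
    finally show ?thesis using c by simp
  qed
  have diff: "((\<lambda>R. Q (R + d) - Q R) \<longlongrightarrow> L * d) at_top" if d: "0 \<le> d" for d
  proof (cases "d = 0")
    case False
    then have d: "0 < d" using d by simp
    show ?thesis
    proof (rule tendstoI)
      fix \<epsilon> :: real assume "0 < \<epsilon>"
      then have "\<forall>\<^sub>F y in at_top. dist (q y) L < \<epsilon> / d" using tendstoD[OF lim] d by simp
      then obtain N where N: "\<And>y. y \<ge> N \<Longrightarrow> dist (q y) L < \<epsilon> / d" by (auto simp: eventually_at_top_linorder)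
      have "dist (Q (R + d) - Q R) (L * d) < \<epsilon>" if "R \<ge> N" for R
      proof -
        obtain z where z: "R < z" "Q (R + d) - Q R = d * q z"
          using MVT2[of R "R + d" Q q] Q d by auto
        have "dist (Q (R + d) - Q R) (L * d) = d * dist (q z) L"
        proof -
          have "d * q z - L * d = d * (q z - L)" by algebra
          then show ?thesis using d by (simp add: z dist_real_def abs_mult)
        qed
        also have "\<dots> < \<epsilon>" using N[of z] z that d by (simp add: field_simps)
        finally show ?thesis .
      qed
      then show "\<forall>\<^sub>F R in at_top. dist (Q (R + d) - Q R) (L * d) < \<epsilon>"
        unfolding eventually_at_top_linorder by blast
    qed
  qed simp
  have "((\<lambda>R. \<Sum>i\<in>I. c i * (Q (R + a i) - Q R)) \<longlongrightarrow> (\<Sum>i\<in>I. c i * (L * a i))) at_top"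
    by (intro tendsto_sum tendsto_mult tendsto_const diff a)
  moreover have "\<forall>\<^sub>F R in at_top. (\<Sum>i\<in>I. c i * (Q (R + a i) - Q R)) = integral {- R..R} (\<lambda>\<xi>. \<Sum>i\<in>I. c i * q (\<xi> + a i))"
  proof -
    have "\<forall>\<^sub>F R in at_top. \<forall>i\<in>I. R \<ge> B + a i"
      using fin by (simp add: eventually_ball_finite eventually_ge_at_top)
    then show ?thesis using eventually_ge_at_top[of 0] by eventually_elim (simp add: int)
  qed
  ultimately have "((\<lambda>R. integral {- R..R} (\<lambda>\<xi>. \<Sum>i\<in>I. c i * q (\<xi> + a i))) \<longlongrightarrow> (\<Sum>i\<in>I. c i * (L * a i))) at_top"
    by (rule Lim_transform_eventually)
  then show ?thesis by (simp add: sum_distrib_left mult_ac)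
qed

text \<open>
  The part of the polynomial \<open>y\<^sup>e (1 - y\<^sup>2)\<^sup>j\<close> that lives on \<open>|y| \<ge> 1\<close>.
\<close>

definition outer_pow :: "nat \<Rightarrow> nat \<Rightarrow> real \<Rightarrow> real" where
  "outer_pow j e y = (- 1) ^ j * y ^ e * (max 0 (y\<^sup>2 - 1)) ^ j"

lemma outer_pow_minus: "outer_pow j e (- y) = (- 1) ^ e * outer_pow j e y"
  by (simp add: outer_pow_def power_minus[of y])

lemma cap_pow_integer:
  assumes "0 < j"
  shows "cap_pow (real j) e y = y ^ e * (1 - y\<^sup>2) ^ j - outer_pow j e y"
proof (cases "y\<^sup>2 < 1")
  case True
  then show ?thesis using assms by (simp add: cap_pow_def outer_pow_def powr_realpow)
next
  case False
  have "(1 - y\<^sup>2) ^ j = ((- 1) * (y\<^sup>2 - 1)) ^ j" by simp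
  then have p: "(1 - y\<^sup>2) ^ j = (- 1) ^ j * (y\<^sup>2 - 1) ^ j" by (simp only: power_mult_distrib)
  have "max 0 (y\<^sup>2 - 1) = y\<^sup>2 - 1" "max 0 (1 - y\<^sup>2) = 0" using False by auto
  then show ?thesis using assms unfolding cap_pow_def outer_pow_def p by simp
qed

text \<open>
  The polynomial has degree \<open>e + 2 j < 2 m\<close>, so that its difference vanishes, and the truncated power
  may be replaced by minus its complementary part. The point \<open>x\<close> itself does not contribute, as
  \<open>|x| < 1\<close>.
\<close>

lemma cap_diff_integer:
  assumes j: "0 < j" "j < m" and e: "e \<le> 1" and x: "\<bar>x\<bar> < 1"
  shows "cap_diff m (real j) e x t =
    - (\<Sum>k = 1..m. dcoef m (int k) * (outer_pow j e (real k * t + x) + (- 1) ^ e * outer_pow j e (real k * t - x)))"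
proof -
  define p :: "real poly" where "p = monom 1 e * [:1, 0, -1:] ^ j"
  have p: "poly p y = y ^ e * (1 - y\<^sup>2) ^ j" for y
    by (simp add: p_def poly_monom power2_eq_square algebra_simps)
  have "degree p \<le> e + 2 * j"
    unfolding p_def by (rule order_trans[OF degree_mult_le add_mono[OF degree_monom_le order_trans[OF degree_power_le]]]) simp
  then have "degree p < 2 * m" using j e by linarith
  from sum_dcoef_poly[OF this, of x t]
  have "cap_diff m (real j) e x t = - (\<Sum>k = - int m..int m. dcoef m k * outer_pow j e (x + of_int k * t))"
    unfolding cap_diff_def cap_pow_integer[OF j(1)] by (simp add: p right_diff_distrib sum_subtractf)
  moreover have "(\<Sum>k = - int m..int m. dcoef m k * outer_pow j e (x + of_int k * t)) =
      dcoef m 0 * outer_pow j e x + (\<Sum>k = 1..m. dcoef m (int k) * (outer_pow j e (x + real k * t) + outer_pow j e (x - real k * t)))"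
    using sum_dcoef_symmetric[of m "\<lambda>k. outer_pow j e (x + of_int k * t)"] by simp
  moreover have "outer_pow j e (x - c) = (- 1) ^ e * outer_pow j e (c - x)" for c
    using outer_pow_minus[of j e "c - x"] by simp
  moreover have "outer_pow j e x = 0"
    using x j by (simp add: outer_pow_def abs_square_le_1 less_imp_le)
  ultimately show ?thesis by (simp only: add.commute[of x] mult_zero_right add_0)
qed

text \<open>
  Writing \<open>k t = exp (\<xi> + ln k)\<close> turns the terms of the difference into shifts of one function \<open>q\<close>,
  which vanishes for very negative \<open>\<xi>\<close> and converges at infinity. The weights of the shifts sum to zero
  because \<open>coef_sum m j = 0\<close>.
\<close>

lemma cap_diff_log_limit_integer:
  assumes j: "0 < j" "j < m" and e: "e \<le> 1" and x: "\<bar>x\<bar> < 1"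
  shows "((\<lambda>R. integral {- R..R} (\<lambda>\<xi>. exp (- 2 * real j * \<xi>) * cap_diff m (real j) e x (exp \<xi>)))
          \<longlongrightarrow> ((1 + 2 * real j) * x) ^ e * (- 2 * (- 1) ^ j * coef_log_sum m (real j))) at_top"
proof -
  define d where "d t = outer_pow j e (t + x) + (- 1) ^ e * outer_pow j e (t - x)" for t
  define q where "q \<xi> = exp (- 2 * real j * \<xi>) * d (exp \<xi>)" for \<xi>
  have cq: "continuous_on UNIV q"
    unfolding q_def d_def outer_pow_def by (intro continuous_intros)
  have x1: "0 < 1 - \<bar>x\<bar>" using x by simp
  have q0: "q \<xi> = 0" if "\<xi> \<le> - (- ln (1 - \<bar>x\<bar>))" for \<xi>
  proof -
    have "exp \<xi> \<le> 1 - \<bar>x\<bar>" using that x1 by (metis exp_le_cancel_iff exp_ln minus_minus)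
    then have "\<bar>exp \<xi> + x\<bar> \<le> 1" "\<bar>exp \<xi> - x\<bar> \<le> 1" using exp_gt_zero[of \<xi>] by linarith+
    then have "(exp \<xi> + x)\<^sup>2 \<le> 1" "(exp \<xi> - x)\<^sup>2 \<le> 1" by (simp_all add: abs_square_le_1)
    then show ?thesis using j by (simp add: q_def d_def outer_pow_def zero_power)
  qed
  have ql: "(q \<longlongrightarrow> (- 1) ^ j * (2 * ((1 + 2 * real j) * x) ^ e)) at_top"
  proof -
    define A where "A y u = (1 + y * u) ^ e * ((1 + y * u)\<^sup>2 - u\<^sup>2) ^ j" for y u :: real
    define R where "R u = (if e = 0 then A x u + A (- x) u else (A x u - A (- x) u) / u)" for u
    have e01: "e = 0 \<or> e = 1" using e by auto
    have "(R \<longlongrightarrow> 2 * ((1 + 2 * real j) * x) ^ e) (at 0)"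
    proof (cases "e = 0")
      case True
      have "((\<lambda>u. A x u + A (- x) u) \<longlongrightarrow> A x 0 + A (- x) 0) (at 0)"
        unfolding A_def by (intro tendsto_intros)
      then show ?thesis using True by (simp add: R_def[abs_def] A_def)
    next
      case False
      then have e1: "e = 1" using e by simp
      have "(A y has_real_derivative (1 + 2 * real j) * y) (at 0)" for y
        unfolding A_def[abs_def] e1 by (auto intro!: derivative_eq_intros simp: algebra_simps)
      from DERIV_diff[OF this[of x] this[of "- x"]]
      have "((\<lambda>u. (A x u - A (- x) u) / u) \<longlongrightarrow> (1 + 2 * real j) * x - (1 + 2 * real j) * (- x)) (at 0)"
        by (simp add: DERIV_def A_def)
      moreover have "(1 + 2 * real j) * x - (1 + 2 * real j) * (- x) = 2 * ((1 + 2 * real j) * x) ^ e"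
        by (simp add: e1)
      moreover have "R = (\<lambda>u. (A x u - A (- x) u) / u)" using e1 by (simp add: R_def[abs_def])
      ultimately show ?thesis by (simp only:)
    qed
    moreover have "filterlim (\<lambda>\<xi>::real. exp (- \<xi>)) (at 0) at_top"
      unfolding filterlim_at by (auto intro!: filterlim_compose[OF exp_at_bot] filterlim_uminus_at_bot_at_top)
    ultimately have "((\<lambda>\<xi>. R (exp (- \<xi>))) \<longlongrightarrow> 2 * ((1 + 2 * real j) * x) ^ e) at_top"
      by (rule filterlim_compose)
    then have "((\<lambda>\<xi>. (- 1) ^ j * R (exp (- \<xi>))) \<longlongrightarrow> (- 1) ^ j * (2 * ((1 + 2 * real j) * x) ^ e)) at_top"
      by (rule tendsto_mult_left)
    moreover have "\<forall>\<^sub>F \<xi> in at_top. (- 1) ^ j * R (exp (- \<xi>)) = q \<xi>"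
      using eventually_ge_at_top[of "ln 2"]
    proof eventually_elim
      fix \<xi> :: real assume \<xi>: "ln 2 \<le> \<xi>"
      define t where "t = exp \<xi>"
      have t2: "2 \<le> t" using \<xi> unfolding t_def by (metis exp_le_cancel_iff exp_ln zero_less_numeral)
      have t0: "0 < t" using t2 by linarith
      have et: "exp (- \<xi>) = inverse t" by (simp add: t_def exp_minus)
      have es: "exp (- 2 * real j * \<xi>) = inverse t ^ (2 * j)"
        by (simp add: t_def exp_minus[symmetric] exp_of_nat_mult[symmetric] mult_ac)
      have o: "outer_pow j e (t + y) * inverse t ^ (2 * j) = (- 1) ^ j * t ^ e * A y (inverse t)" if "\<bar>y\<bar> < 1" for y
      proof -
        have "1 \<le> t + y" using t2 that by (auto simp: abs_less_iff)
        then have "1 \<le> (t + y)\<^sup>2" by (simp add: one_le_power)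
        then have m: "max 0 ((t + y)\<^sup>2 - 1) = t\<^sup>2 * ((1 + y * inverse t)\<^sup>2 - (inverse t)\<^sup>2)"
          using t0 by (simp add: field_simps power2_eq_square)
        have f: "t + y = t * (1 + y * inverse t)" using t0 by (simp add: field_simps)
        have "outer_pow j e (t + y) = (- 1) ^ j * (t ^ e * (1 + y * inverse t) ^ e) * (t ^ (2 * j) * ((1 + y * inverse t)\<^sup>2 - (inverse t)\<^sup>2) ^ j)"
          unfolding outer_pow_def m by (subst f) (simp only: power_mult_distrib power_mult)
        moreover have "t ^ (2 * j) * inverse t ^ (2 * j) = 1" using t0 by (simp add: power_mult_distrib[symmetric])
        moreover have "a * (b * X) * (c * Y) * d = a * b * (X * Y) * (c * d)" for a b c d X Y :: real
          by (simp only: mult_ac)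
        ultimately show ?thesis unfolding A_def by (simp only: mult_1_right)
      qed
      have "q \<xi> = outer_pow j e (t + x) * inverse t ^ (2 * j) + (- 1) ^ e * (outer_pow j e (t + - x) * inverse t ^ (2 * j))"
        unfolding q_def es d_def t_def[symmetric] by (simp add: algebra_simps)
      also have "\<dots> = (- 1) ^ j * (t ^ e * A x (inverse t) + (- 1) ^ e * (t ^ e * A (- x) (inverse t)))"
        using o[of x] o[of "- x"] x by (simp add: algebra_simps)
      also have "\<dots> = (- 1) ^ j * R (inverse t)"
        unfolding R_def using e01 t0 by (elim disjE) (simp_all add: divide_inverse algebra_simps)
      finally show "(- 1) ^ j * R (exp (- \<xi>)) = q \<xi>" unfolding et ..
    qed
    ultimately show ?thesis by (rule Lim_transform_eventually)
  qed
  have eq: "exp (- 2 * real j * \<xi>) * cap_diff m (real j) e x (exp \<xi>) =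
      (\<Sum>k = 1..m. - (dcoef m (int k) * real k powr (2 * real j)) * q (\<xi> + ln (real k)))" for \<xi>
  proof -
    have "real k powr (2 * real j) * q (\<xi> + ln (real k)) = exp (- 2 * real j * \<xi>) * d (real k * exp \<xi>)" if "k \<in> {1..m}" for k
    proof -
      have 1: "exp (\<xi> + ln (real k)) = real k * exp \<xi>" using that by (simp add: exp_add)
      have 2: "real k powr (2 * real j) * exp (- 2 * real j * (\<xi> + ln (real k))) = exp (- 2 * real j * \<xi>)"
        using that by (simp add: powr_def exp_add[symmetric] algebra_simps)
      show ?thesis unfolding q_def 1 mult.assoc[symmetric] 2 ..
    qed
    then show ?thesis
      unfolding cap_diff_integer[OF j e x] d_def[symmetric] mult_minus_right sum_distrib_left sum_negf[symmetric]
      by (intro sum.cong refl) (simp add: mult_ac)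
  qed
  have "((\<lambda>R. integral {- R..R} (\<lambda>\<xi>. \<Sum>k = 1..m. - (dcoef m (int k) * real k powr (2 * real j)) * q (\<xi> + ln (real k))))
     \<longlongrightarrow> ((- 1) ^ j * (2 * ((1 + 2 * real j) * x) ^ e)) * (\<Sum>k = 1..m. - (dcoef m (int k) * real k powr (2 * real j)) * ln (real k))) at_top"
  proof (rule frullani_combination[where B = "- ln (1 - \<bar>x\<bar>)", OF cq q0 ql])
    show "(\<Sum>k = 1..m. - (dcoef m (int k) * real k powr (2 * real j))) = 0"
      using coef_sum_integer[OF j] by (simp add: sum_negf coef_sum_def)
  qed auto
  moreover have "((- 1) ^ j * (2 * ((1 + 2 * real j) * x) ^ e)) * (\<Sum>k = 1..m. - (dcoef m (int k) * real k powr (2 * real j)) * ln (real k))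
     = ((1 + 2 * real j) * x) ^ e * (- 2 * (- 1) ^ j * coef_log_sum m (real j))"
    by (simp add: coef_log_sum_def sum_negf)
  ultimately show ?thesis by (simp only: eq)
qed

section \<open>Integrability of the one-dimensional integral\<close>

lemma nn_integral_exp_tail:
  assumes "0 < c"
  shows "(\<integral>\<^sup>+\<xi>. ennreal (exp (- c * \<xi>)) * indicator {a..} \<xi> \<partial>lborel) = ennreal (exp (- c * a) / c)"
proof -
  have "(\<integral>\<^sup>+\<xi>. ennreal (exp (- c * \<xi>)) * indicator {a..} \<xi> \<partial>lborel) = 0 - (- exp (- c * a) / c)"
  proof (rule nn_integral_FTC_atLeast)
    show "((\<lambda>\<xi>. - exp (- c * \<xi>) / c) \<longlongrightarrow> 0) at_top"
    proof -
      have "filterlim (\<lambda>\<xi>. - c * \<xi>) at_bot at_top"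
        using assms by (intro filterlim_tendsto_neg_mult_at_bot[OF tendsto_const] filterlim_ident) auto
      then have "((\<lambda>\<xi>. exp (- c * \<xi>)) \<longlongrightarrow> 0) at_top" by (rule filterlim_compose[OF exp_at_bot])
      from tendsto_divide[OF tendsto_minus[OF this] tendsto_const[of c]] show ?thesis using assms by simp
    qed
    show "((\<lambda>\<xi>. - exp (- c * \<xi>) / c) has_real_derivative exp (- c * x)) (at x)" for x
      using assms by (auto intro!: derivative_eq_intros)
  qed auto
  then show ?thesis by simp
qed

text \<open>
  A bound for the integrand in logarithmic coordinates: from the order of vanishing \<open>2 m\<close> for steps below
  \<open>r\<close>, and from the boundedness of the truncated powers above \<open>r\<close>.
\<close>

definition diff_majorant :: "nat \<Rightarrow> real \<Rightarrow> real \<Rightarrow> real \<Rightarrow> real" where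
  "diff_majorant m s r \<xi> = 4 ^ m * (2 * 2 powr s) *
     (if \<xi> \<le> ln r then exp ((2 * real m - 2 * s) * \<xi>) / (2 * r) ^ (2 * m) else exp (- 2 * s * \<xi>))"

lemma measurable_diff_majorant [measurable]: "diff_majorant m s r \<in> borel_measurable borel"
  unfolding diff_majorant_def[abs_def] by measurable

lemma nn_integral_diff_majorant:
  assumes s: "0 < s" "s < real m" and r: "0 < r"
  shows "(\<integral>\<^sup>+\<xi>. ennreal (diff_majorant m s r \<xi>) \<partial>lborel) < \<infinity>"
proof -
  define C where "C = (4::real) ^ m * (2 * 2 powr s)"
  define c where "c = 2 * real m - 2 * s"
  have C: "0 \<le> C" and c: "0 < c" using s by (auto simp: C_def c_def)
  have 1: "(\<integral>\<^sup>+\<xi>. ennreal (exp (c * \<xi>)) * indicator {..ln r} \<xi> \<partial>lborel) < \<infinity>"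
  proof -
    have "(\<integral>\<^sup>+\<xi>. ennreal (exp (c * \<xi>)) * indicator {..ln r} \<xi> \<partial>lborel)
        = (\<integral>\<^sup>+\<xi>. ennreal (exp (- c * \<xi>)) * indicator {- ln r..} \<xi> \<partial>lborel)"
      by (subst nn_integral_real_affine[of _ "- 1" 0]) (auto intro!: nn_integral_cong split: split_indicator)
    then show ?thesis using nn_integral_exp_tail[OF c] by simp
  qed
  have 2: "(\<integral>\<^sup>+\<xi>. ennreal (exp (- (2 * s) * \<xi>)) * indicator {ln r..} \<xi> \<partial>lborel) < \<infinity>"
    using nn_integral_exp_tail[of "2 * s"] s by simp
  have "(\<integral>\<^sup>+\<xi>. ennreal (diff_majorant m s r \<xi>) \<partial>lborel)
     \<le> (\<integral>\<^sup>+\<xi>. ennreal (C / (2 * r) ^ (2 * m)) * (ennreal (exp (c * \<xi>)) * indicator {..ln r} \<xi>)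
          + ennreal C * (ennreal (exp (- (2 * s) * \<xi>)) * indicator {ln r..} \<xi>) \<partial>lborel)"
    using C r by (intro nn_integral_mono)
      (auto simp: diff_majorant_def C_def[symmetric] c_def ennreal_mult[symmetric] split: split_indicator)
  also have "\<dots> = ennreal (C / (2 * r) ^ (2 * m)) * (\<integral>\<^sup>+\<xi>. ennreal (exp (c * \<xi>)) * indicator {..ln r} \<xi> \<partial>lborel)
      + ennreal C * (\<integral>\<^sup>+\<xi>. ennreal (exp (- (2 * s) * \<xi>)) * indicator {ln r..} \<xi> \<partial>lborel)"
    by (simp add: nn_integral_add nn_integral_cmult)
  also have "\<dots> < \<infinity>" using 1 2 by (simp add: ennreal_mult_eq_top_iff less_top[symmetric])
  finally show ?thesis .
qed

lemma cap_pow_abs_le: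
  assumes "0 < s" shows "\<bar>cap_pow s e y\<bar> \<le> 1"
proof (cases "y\<^sup>2 < 1")
  case True
  have "\<bar>y ^ e\<bar> \<le> 1" using True by (simp add: power_abs power_le_one abs_square_less_1 less_imp_le)
  moreover have "(1 - y\<^sup>2) powr s \<le> 1" using True assms by (simp add: powr_le1)
  ultimately show ?thesis using True
    by (simp add: cap_pow_def abs_mult mult_le_one)
qed (simp add: cap_pow_def)

lemma cap_diff_majorant:
  assumes x: "\<bar>x\<bar> \<le> \<rho>" "\<rho> < 1" and s: "0 < s" "s < real m"
  shows "\<bar>exp (- 2 * s * \<xi>) * cap_diff m s e x (exp \<xi>)\<bar> \<le> diff_majorant m s ((1 - \<rho>) / (4 * real m)) \<xi>"
proof -
  define r where "r = (1 - \<rho>) / (4 * real m)"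
  have m: "0 < real m" using s by linarith
  have r: "0 < r" using x m by (simp add: r_def)
  have rr: "(1 - \<rho>) / 2 = 2 * real m * r" using m by (simp add: r_def)
  show ?thesis
  proof (cases "\<xi> \<le> ln r")
    case True
    then have le: "exp \<xi> \<le> r" using r by (metis exp_le_cancel_iff exp_ln)
    have "\<bar>cap_diff m s e x (exp \<xi>)\<bar> \<le> 4 ^ m * (2 * 2 powr s) * (real m * \<bar>exp \<xi>\<bar> / ((1 - \<rho>) / 2)) ^ (2 * m)"
      by (rule cap_diff_small[OF x s(1)]) (use le m in \<open>simp add: rr\<close>)
    also have "real m * \<bar>exp \<xi>\<bar> / ((1 - \<rho>) / 2) = exp \<xi> / (2 * r)"
      using m r unfolding rr by (simp add: field_simps)
    finally have "exp (- 2 * s * \<xi>) * \<bar>cap_diff m s e x (exp \<xi>)\<bar> \<le> exp (- 2 * s * \<xi>) * (4 ^ m * (2 * 2 powr s) * (exp \<xi> / (2 * r)) ^ (2 * m))"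
      by (rule mult_left_mono) simp
    also have "\<dots> = 4 ^ m * (2 * 2 powr s) * ((exp (- 2 * s * \<xi>) * exp \<xi> ^ (2 * m)) / (2 * r) ^ (2 * m))"
      by (simp add: power_divide)
    also have "exp (- 2 * s * \<xi>) * exp \<xi> ^ (2 * m) = exp ((2 * real m - 2 * s) * \<xi>)"
      by (simp add: exp_of_nat_mult[symmetric] exp_add[symmetric] algebra_simps)
    finally show ?thesis using True by (simp add: diff_majorant_def r_def[symmetric] abs_mult)
  next
    case False
    have "\<bar>cap_diff m s e x (exp \<xi>)\<bar> \<le> (\<Sum>k = - int m..int m. \<bar>dcoef m k\<bar> * 1)"
      unfolding cap_diff_def
      by (rule order_trans[OF sum_abs sum_mono]) (simp only: abs_mult mult_left_mono[OF cap_pow_abs_le[OF s(1)] abs_ge_zero])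
    also have "\<dots> = 4 ^ m" by (simp add: sum_dcoef_abs)
    also have "\<dots> \<le> 4 ^ m * (2 * 2 powr s)"
    proof -
      have "1 \<le> 2 powr s" using s by (simp add: ge_one_powr_ge_zero)
      then show ?thesis by simp
    qed
    finally have "exp (- 2 * s * \<xi>) * \<bar>cap_diff m s e x (exp \<xi>)\<bar> \<le> exp (- 2 * s * \<xi>) * (4 ^ m * (2 * 2 powr s))"
      by (rule mult_left_mono) simp
    then show ?thesis using False unfolding diff_majorant_def r_def[symmetric] abs_mult by (simp add: mult.commute)
  qed
qed

lemma measurable_cap_pow [measurable]: "cap_pow s e \<in> borel_measurable borel"
  unfolding cap_pow_def[abs_def] by measurable

lemma measurable_cap_diff [measurable]: "cap_diff m s e x \<in> borel_measurable borel"
  unfolding cap_diff_def[abs_def] by measurable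

lemma integral_symmetric_limit:
  fixes f :: "real \<Rightarrow> real"
  assumes f: "integrable lborel f"
    and lim: "((\<lambda>R. integral {- R..R} f) \<longlongrightarrow> l) at_top"
  shows "(\<integral>\<xi>. f \<xi> \<partial>lborel) = l"
proof -
  have "((\<lambda>R. \<integral>\<xi>. indicator {- R..R} \<xi> *\<^sub>R f \<xi> \<partial>lborel) \<longlongrightarrow> (\<integral>\<xi>. f \<xi> \<partial>lborel)) at_top"
  proof (rule integral_dominated_convergence_at_top[where w = "\<lambda>\<xi>. norm (f \<xi>)"])
    show "AE \<xi> in lborel. ((\<lambda>R. indicator {- R..R} \<xi> *\<^sub>R f \<xi>) \<longlongrightarrow> f \<xi>) at_top"
    proof (rule AE_I2, rule tendsto_eventually)
      fix \<xi> :: real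
      show "\<forall>\<^sub>F R in at_top. indicator {- R..R} \<xi> *\<^sub>R f \<xi> = f \<xi>"
        using eventually_ge_at_top[of "\<bar>\<xi>\<bar>"] by eventually_elim (auto simp: indicator_def)
    qed
    show "\<forall>\<^sub>F R in at_top. AE \<xi> in lborel. norm (indicator {- R..R} \<xi> *\<^sub>R f \<xi>) \<le> norm (f \<xi>)"
      by (rule always_eventually, rule allI, rule AE_I2) (simp split: split_indicator)
    have [measurable]: "f \<in> borel_measurable lborel" using f by simp
    show "(\<lambda>\<xi>. indicator {- R..R} \<xi> *\<^sub>R f \<xi>) \<in> borel_measurable lborel" for R by measurable
    show "f \<in> borel_measurable lborel" by measurable
    show "integrable lborel (\<lambda>\<xi>. norm (f \<xi>))" using f by simp
  qed
  moreover have "(\<integral>\<xi>. indicator {- R..R} \<xi> *\<^sub>R f \<xi> \<partial>lborel) = integral {- R..R} f" for R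
  proof -
    have "set_integrable lborel {- R..R} f"
      unfolding set_integrable_def by (rule integrable_mult_indicator[OF _ f]) simp
    from set_borel_integral_eq_integral(2)[OF this] show ?thesis by (simp add: set_lebesgue_integral_def)
  qed
  ultimately have "((\<lambda>R. integral {- R..R} f) \<longlongrightarrow> (\<integral>\<xi>. f \<xi> \<partial>lborel)) at_top"
    by (simp only:)
  then show ?thesis by (rule tendsto_unique[OF trivial_limit_at_top_linorder _ lim])
qed

text \<open>
  In the variable \<open>\<xi> = ln t\<close> the measure \<open>t\<^sup>-\<^sup>1\<^sup>-\<^sup>2\<^sup>s dt\<close> becomes \<open>exp (- 2 s \<xi>) d\<xi>\<close>. Absolute integrability
  allows the integral to be computed as the limit over symmetric intervals found before.
\<close>

theorem cap_diff_log_integral: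
  assumes x: "\<bar>x\<bar> < 1" and s: "0 < s" "s < real m" and e: "e \<le> 1"
  shows "integrable lborel (\<lambda>\<xi>. exp (- 2 * s * \<xi>) * cap_diff m s e x (exp \<xi>))" (is "integrable lborel ?f")
    and "(\<integral>\<xi>. exp (- 2 * s * \<xi>) * cap_diff m s e x (exp \<xi>) \<partial>lborel) = ((1 + 2 * s) * x) ^ e * line_const m s"
proof -
  have m: "0 < real m" using s by linarith
  define r where "r = (1 - \<bar>x\<bar>) / (4 * real m)"
  have r: "0 < r" using x m by (simp add: r_def)
  have maj: "\<bar>?f \<xi>\<bar> \<le> diff_majorant m s r \<xi>" for \<xi>
    unfolding r_def by (rule cap_diff_majorant[OF _ x s]) simp
  show int: "integrable lborel ?f"
  proof (rule integrableI_bounded)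
    have "(\<integral>\<^sup>+\<xi>. ennreal (norm (?f \<xi>)) \<partial>lborel) \<le> (\<integral>\<^sup>+\<xi>. ennreal (diff_majorant m s r \<xi>) \<partial>lborel)"
      using maj by (intro nn_integral_mono ennreal_leI) simp
    then show "(\<integral>\<^sup>+\<xi>. ennreal (norm (?f \<xi>)) \<partial>lborel) < \<infinity>"
      using nn_integral_diff_majorant[OF s r] by (rule le_less_trans)
  qed measurable
  show "(\<integral>\<xi>. ?f \<xi> \<partial>lborel) = ((1 + 2 * s) * x) ^ e * line_const m s"
  proof (rule integral_symmetric_limit[OF int])
    show "((\<lambda>R. integral {- R..R} ?f) \<longlongrightarrow> ((1 + 2 * s) * x) ^ e * line_const m s) at_top"
    proof (cases "s \<in> \<nat>")
      case True
      then obtain j where j: "s = real j" by (auto elim: Nats_cases)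
      have "cos (pi * s) = (- 1) ^ j" unfolding j by (simp add: mult.commute)
      then show ?thesis
        using cap_diff_log_limit_integer[of j m e x] s e x True unfolding line_const_def j by simp
    next
      case False
      have sin: "sin (pi * s) \<noteq> 0"
      proof
        assume "sin (pi * s) = 0"
        then obtain i :: int where "pi * s = of_int i * pi" by (auto simp: sin_zero_iff_int2)
        then have i: "s = of_int i" by simp
        then have "s = real (nat i)" using s by simp
        then show False using False by (metis of_nat_in_Nats)
      qed
      have "((\<lambda>R. integral {- R..R} (\<lambda>\<xi>. exp (- 2 * s * \<xi>) * (sin (pi * s) * cap_diff m s e x (exp \<xi>))) / sin (pi * s))
          \<longlongrightarrow> (- pi * ((1 + 2 * s) * x) ^ e * coef_sum m s) / sin (pi * s)) at_top"
        by (intro tendsto_divide cap_diff_log_limit x s e tendsto_const sin)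
      moreover have "integral {- R..R} (\<lambda>\<xi>. exp (- 2 * s * \<xi>) * (sin (pi * s) * cap_diff m s e x (exp \<xi>))) / sin (pi * s) = integral {- R..R} ?f" for R
      proof -
        have "(\<lambda>\<xi>. exp (- 2 * s * \<xi>) * (sin (pi * s) * cap_diff m s e x (exp \<xi>))) = (\<lambda>\<xi>. sin (pi * s) * ?f \<xi>)"
          by (simp add: fun_eq_iff mult_ac)
        then show ?thesis using sin by simp
      qed
      ultimately show ?thesis using False by (simp add: line_const_def mult_ac)
    qed
  qed
qed

section \<open>Ellipsoidal polar coordinates\<close>

lemma diag_mult_nth: "(diag a *v x) $ i = a $ i * x $ i"
proof -
  have "(if i = j then a $ i else 0) * x $ j = (if i = j then a $ i * x $ j else 0)" for j by simp
  then show ?thesis by (simp add: matrix_vector_mult_def diag_def)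
qed

lemma diag_inner: "(diag a *v x) \<bullet> y = (\<Sum>i\<in>UNIV. a $ i * x $ i * y $ i)"
  by (simp add: inner_vec_def diag_mult_nth)

lemma norm_ell_scaleR: "norm_ell a (c *\<^sub>R x) = \<bar>c\<bar> * norm_ell a x"
proof -
  have "(diag a *v (c *\<^sub>R x)) \<bullet> (c *\<^sub>R x) = c\<^sup>2 * ((diag a *v x) \<bullet> x)"
    by (simp add: diag_inner sum_distrib_left power2_eq_square mult_ac)
  then show ?thesis by (simp add: norm_ell_def real_sqrt_mult)
qed

lemma continuous_norm_ell: "continuous_on UNIV (norm_ell a)"
  unfolding norm_ell_def diag_inner by (intro continuous_intros)

lemma measurable_norm_ell [measurable]: "norm_ell a \<in> borel_measurable borel"
  by (rule borel_measurable_continuous_onI[OF continuous_norm_ell])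

context
  fixes a :: "real^'n"
  assumes a_pos: "\<And>i. a $ i > 0"
begin

lemma norm_ell_sq: "(norm_ell a x)\<^sup>2 = (\<Sum>i\<in>UNIV. a $ i * (x $ i)\<^sup>2)"
proof -
  have "0 \<le> (diag a *v x) \<bullet> x"
    unfolding diag_inner using a_pos by (intro sum_nonneg) (simp add: mult.assoc less_imp_le)
  then show ?thesis by (simp add: norm_ell_def diag_inner power2_eq_square mult.assoc)
qed

lemma norm_ell_nonneg: "0 \<le> norm_ell a x"
proof -
  have "0 \<le> (diag a *v x) \<bullet> x"
    unfolding diag_inner using a_pos by (intro sum_nonneg) (simp add: mult.assoc less_imp_le)
  then show ?thesis by (simp add: norm_ell_def)
qed

lemma norm_ell_lower: "sqrt (Min (range (($) a))) * norm x \<le> norm_ell a x"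
proof (rule power2_le_imp_le)
  define c where "c = Min (range (($) a))"
  have c: "0 < c" "\<And>i. c \<le> a $ i" unfolding c_def using a_pos by auto
  have "(sqrt c * norm x)\<^sup>2 = (\<Sum>i\<in>UNIV. c * (x $ i)\<^sup>2)"
    using c by (simp add: power_mult_distrib norm_vec_def L2_set_def sum_nonneg sum_distrib_left)
  also have "\<dots> \<le> (norm_ell a x)\<^sup>2" unfolding norm_ell_sq by (intro sum_mono mult_right_mono c) simp
  finally show "(sqrt (Min (range (($) a))) * norm x)\<^sup>2 \<le> (norm_ell a x)\<^sup>2" by (simp add: c_def)
qed (rule norm_ell_nonneg)

lemma norm_ell_upper: "norm_ell a x \<le> sqrt (Max (range (($) a))) * norm x"
proof (rule power2_le_imp_le)
  define c where "c = Max (range (($) a))"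
  have c: "\<And>i. a $ i \<le> c" unfolding c_def by auto
  then have c0: "0 < c" using a_pos less_le_trans by blast
  have "(norm_ell a x)\<^sup>2 \<le> (\<Sum>i\<in>UNIV. c * (x $ i)\<^sup>2)"
    unfolding norm_ell_sq by (intro sum_mono mult_right_mono c) simp
  also have "\<dots> = (sqrt c * norm x)\<^sup>2"
    using c0 by (simp add: power_mult_distrib norm_vec_def L2_set_def sum_nonneg sum_distrib_left)
  finally show "(norm_ell a x)\<^sup>2 \<le> (sqrt (Max (range (($) a))) * norm x)\<^sup>2" by (simp add: c_def)
  show "0 \<le> sqrt (Max (range (($) a))) * norm x" using c0 by (simp add: c_def)
qed

lemma Min_range_pos: "0 < Min (range (($) a))"
  using a_pos by auto

lemma norm_ell_pos: "x \<noteq> 0 \<Longrightarrow> 0 < norm_ell a x"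
  using norm_ell_lower[of x] Min_range_pos
  by (smt (verit, best) mult_pos_pos real_sqrt_gt_zero zero_less_norm_iff)

lemma frontier_ellipsoid: "frontier (ellipsoid a) = {x. norm_ell a x = 1}"
proof -
  have op: "open (ellipsoid a)"
    unfolding ellipsoid_def using continuous_norm_ell by (intro open_Collect_less) auto
  have "closure (ellipsoid a) = {x. norm_ell a x \<le> 1}"
  proof
    have "closed {x. norm_ell a x \<le> 1}"
      using continuous_norm_ell by (intro closed_Collect_le) auto
    then show "closure (ellipsoid a) \<subseteq> {x. norm_ell a x \<le> 1}"
      by (rule closure_minimal[rotated]) (auto simp: ellipsoid_def)
    show "{x. norm_ell a x \<le> 1} \<subseteq> closure (ellipsoid a)"
    proof
      fix x assume "x \<in> {x. norm_ell a x \<le> 1}"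
      then have x: "norm_ell a x \<le> 1" by simp
      have "(\<lambda>n. (1 - inverse (real (Suc n))) *\<^sub>R x) \<longlonglongrightarrow> (1 - 0) *\<^sub>R x"
        by (intro tendsto_intros LIMSEQ_inverse_real_of_nat)
      moreover have "(1 - inverse (real (Suc n))) *\<^sub>R x \<in> ellipsoid a" for n
      proof -
        have "norm_ell a ((1 - inverse (real (Suc n))) *\<^sub>R x) = (1 - inverse (real (Suc n))) * norm_ell a x"
          by (simp add: norm_ell_scaleR inverse_le_1_iff abs_of_nonneg)
        also have "\<dots> \<le> (1 - inverse (real (Suc n))) * 1"
          using x by (intro mult_left_mono) (auto simp: inverse_le_1_iff)
        also have "\<dots> < 1" by simp
        finally show ?thesis by (simp add: ellipsoid_def)
      qed
      ultimately show "x \<in> closure (ellipsoid a)"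
        unfolding closure_sequential scaleR_one diff_zero by (intro exI conjI allI)
    qed
  qed
  then show ?thesis using op by (auto simp: frontier_def interior_open ellipsoid_def)
qed

text \<open>
  The mass of a set \<open>B\<close> of directions is \<open>n\<close> times the volume of the part of the ellipsoid that lies on
  the rays through \<open>B\<close>.
\<close>

definition cone_measure :: "(real^'n) measure" where
  "cone_measure = distr (density lborel (\<lambda>x. ennreal (real CARD('n)) * indicator {x. 0 < norm_ell a x \<and> norm_ell a x \<le> 1} x))
     borel (\<lambda>x. x /\<^sub>R norm_ell a x)"

lemma sets_cone_measure [simp, measurable_cong]: "sets cone_measure = sets borel"
  by (simp add: cone_measure_def)

lemma space_cone_measure [simp]: "space cone_measure = UNIV"
  by (simp add: cone_measure_def)

lemma nn_integral_cone_measure: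
  assumes [measurable]: "f \<in> borel_measurable borel"
  shows "(\<integral>\<^sup>+\<theta>. f \<theta> \<partial>cone_measure) =
    (\<integral>\<^sup>+x. ennreal (real CARD('n)) * indicator {x. 0 < norm_ell a x \<and> norm_ell a x \<le> 1} x * f (x /\<^sub>R norm_ell a x) \<partial>lborel)"
  unfolding cone_measure_def
  by (subst nn_integral_distr, measurable, subst nn_integral_density) (auto intro!: nn_integral_cong)

lemma AE_cone_measure: "AE \<theta> in cone_measure. norm_ell a \<theta> = 1"
  unfolding cone_measure_def
  by (subst AE_distr_iff, measurable, subst AE_density)
    (auto intro!: AE_I2 simp: norm_ell_scaleR split: split_indicator)

lemma finite_cone_measure: "finite_measure cone_measure"
proof
  have sub: "{x. 0 < norm_ell a x \<and> norm_ell a x \<le> 1} \<subseteq> cball 0 (1 / sqrt (Min (range (($) a))))"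
  proof
    fix x assume "x \<in> {x. 0 < norm_ell a x \<and> norm_ell a x \<le> 1}"
    then have "sqrt (Min (range (($) a))) * norm x \<le> 1" using norm_ell_lower[of x] by simp
    then show "x \<in> cball 0 (1 / sqrt (Min (range (($) a))))"
      using Min_range_pos by (simp add: field_simps)
  qed
  have "emeasure cone_measure (space cone_measure) = (\<integral>\<^sup>+\<theta>. 1 \<partial>cone_measure)" by simp
  also have "\<dots> = (\<integral>\<^sup>+x. ennreal (real CARD('n)) * indicator {x. 0 < norm_ell a x \<and> norm_ell a x \<le> 1} x \<partial>lborel)"
    by (subst nn_integral_cone_measure) auto
  also have "\<dots> \<le> (\<integral>\<^sup>+x. ennreal (real CARD('n)) * indicator (cball 0 (1 / sqrt (Min (range (($) a))))) x \<partial>(lborel :: (real^'n) measure))"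
    using sub by (intro nn_integral_mono) (auto split: split_indicator)
  also have "\<dots> = ennreal (real CARD('n)) * emeasure lborel (cball (0 :: real^'n) (1 / sqrt (Min (range (($) a)))))"
    by (subst nn_integral_cmult_indicator) auto
  also have "\<dots> < \<infinity>"
    using emeasure_bounded_finite[OF bounded_cball[of "0 :: real^'n" "1 / sqrt (Min (range (($) a)))"]] by (simp add: ennreal_mult_less_top)
  finally show "emeasure cone_measure (space cone_measure) \<noteq> \<infinity>" by simp
qed

end

lemma nn_integral_lborel_scaleR:
  fixes F :: "'a::euclidean_space \<Rightarrow> ennreal"
  assumes [measurable]: "F \<in> borel_measurable borel" and c: "0 < c"
  shows "(\<integral>\<^sup>+x. F x \<partial>lborel) = ennreal (c ^ DIM('a)) * (\<integral>\<^sup>+x. F (c *\<^sub>R x) \<partial>lborel)"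
proof -
  have "(\<integral>\<^sup>+x. F x \<partial>lborel) = (\<integral>\<^sup>+x. F x \<partial>density (distr lborel borel (\<lambda>x. 0 + c *\<^sub>R x)) (\<lambda>_. ennreal (\<bar>c\<bar> ^ DIM('a))))"
    using lborel_affine[of c "0::'a"] c by simp
  also have "\<dots> = ennreal (c ^ DIM('a)) * (\<integral>\<^sup>+x. F (c *\<^sub>R x) \<partial>lborel)"
    using c by (subst nn_integral_density, simp, simp, subst nn_integral_distr) (auto simp: nn_integral_cmult)
  finally show ?thesis .
qed

lemma nn_integral_exp_tail_normalized:
  assumes "0 < c"
  shows "(\<integral>\<^sup>+\<xi>. ennreal (c * exp (- c * \<xi>)) * indicator {b..} \<xi> \<partial>lborel) = ennreal (exp (- c * b))"
proof -
  have "(\<integral>\<^sup>+\<xi>. ennreal (c * exp (- c * \<xi>)) * indicator {b..} \<xi> \<partial>lborel)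
    = (\<integral>\<^sup>+\<xi>. ennreal c * (ennreal (exp (- c * \<xi>)) * indicator {b..} \<xi>) \<partial>lborel)"
    using assms by (intro nn_integral_cong) (simp add: ennreal_mult mult.assoc)
  also have "\<dots> = ennreal c * ennreal (exp (- c * b) / c)"
    unfolding nn_integral_exp_tail[OF assms, symmetric] by (rule nn_integral_cmult) measurable
  also have "\<dots> = ennreal (exp (- c * b))"
    using assms by (simp add: ennreal_mult[symmetric])
  finally show ?thesis .
qed

text \<open>
  Only homogeneity is used. Insert the definition of the cone measure, shift \<open>\<xi>\<close> by \<open>ln |x|\<^sub>a\<close> in the inner
  integral, exchange the integrals, and rescale \<open>x\<close> by \<open>exp (- \<eta>)\<close>; after a second exchange the
  inner integral is that of \<open>n exp (- n \<eta>)\<close> over \<open>\<eta> \<ge> ln |z|\<^sub>a\<close>, which compensates the factor \<open>|z|\<^sub>a\<^sup>n\<close>.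
\<close>

lemma polar_coordinates:
  fixes a :: "real^'n" and F :: "real^'n \<Rightarrow> ennreal"
  assumes a_pos: "\<And>i. a $ i > 0" and [measurable]: "F \<in> borel_measurable borel"
  shows "(\<integral>\<^sup>+x. F x \<partial>lborel) =
    (\<integral>\<^sup>+\<theta>. (\<integral>\<^sup>+\<xi>. ennreal (exp (real CARD('n) * \<xi>)) * F (exp \<xi> *\<^sub>R \<theta>) \<partial>lborel) \<partial>cone_measure a)"
proof -
  define n where "n = real CARD('n)"
  have n: "0 < n" by (simp add: n_def)
  define N where "N = norm_ell a"
  have [measurable]: "N \<in> borel_measurable borel" by (simp add: N_def)
  have Nscale: "N (c *\<^sub>R x) = \<bar>c\<bar> * N x" for c x by (simp add: N_def norm_ell_scaleR)
  have en: "exp (n * \<xi>) = exp \<xi> ^ CARD('n)" for \<xi> by (simp add: n_def exp_of_nat_mult)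
  define D where "D = {x. 0 < N x \<and> N x \<le> 1}"
  have [measurable]: "D \<in> sets borel" unfolding D_def by measurable
  have "(\<integral>\<^sup>+\<theta>. (\<integral>\<^sup>+\<xi>. ennreal (exp (n * \<xi>)) * F (exp \<xi> *\<^sub>R \<theta>) \<partial>lborel) \<partial>cone_measure a)
     = (\<integral>\<^sup>+x. ennreal n * indicator D x * (\<integral>\<^sup>+\<xi>. ennreal (exp (n * \<xi>)) * F (exp \<xi> *\<^sub>R (x /\<^sub>R N x)) \<partial>lborel) \<partial>lborel)"
    by (subst nn_integral_cone_measure[OF a_pos]) (simp_all add: n_def N_def D_def)
  also have "\<dots> = (\<integral>\<^sup>+x. (\<integral>\<^sup>+\<eta>. ennreal (n * N x ^ CARD('n) * exp (n * \<eta>)) * indicator D x * F (exp \<eta> *\<^sub>R x) \<partial>lborel) \<partial>lborel)"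
  proof (rule nn_integral_cong)
    fix x
    show "ennreal n * indicator D x * (\<integral>\<^sup>+\<xi>. ennreal (exp (n * \<xi>)) * F (exp \<xi> *\<^sub>R (x /\<^sub>R N x)) \<partial>lborel)
      = (\<integral>\<^sup>+\<eta>. ennreal (n * N x ^ CARD('n) * exp (n * \<eta>)) * indicator D x * F (exp \<eta> *\<^sub>R x) \<partial>lborel)"
    proof (cases "x \<in> D")
      case True
      then have Nx: "0 < N x" by (simp add: D_def)
      have "(\<integral>\<^sup>+\<xi>. ennreal (exp (n * \<xi>)) * F (exp \<xi> *\<^sub>R (x /\<^sub>R N x)) \<partial>lborel)
         = (\<integral>\<^sup>+\<eta>. ennreal (exp (n * (ln (N x) + \<eta>))) * F (exp (ln (N x) + \<eta>) *\<^sub>R (x /\<^sub>R N x)) \<partial>lborel)"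
        by (subst nn_integral_real_affine[of _ 1 "ln (N x)"]) auto
      also have "\<dots> = (\<integral>\<^sup>+\<eta>. ennreal (N x ^ CARD('n)) * (ennreal (exp (n * \<eta>)) * F (exp \<eta> *\<^sub>R x)) \<partial>lborel)"
      proof (rule nn_integral_cong)
        fix \<eta>
        have "exp (n * (ln (N x) + \<eta>)) = N x ^ CARD('n) * exp (n * \<eta>)"
          unfolding en using Nx by (simp add: exp_add power_mult_distrib)
        moreover have "exp (ln (N x) + \<eta>) *\<^sub>R (x /\<^sub>R N x) = exp \<eta> *\<^sub>R x"
          using Nx by (simp add: exp_add)
        moreover have "ennreal (N x ^ CARD('n) * exp (n * \<eta>)) = ennreal (N x ^ CARD('n)) * ennreal (exp (n * \<eta>))"
          using Nx by (simp add: ennreal_mult)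
        ultimately show "ennreal (exp (n * (ln (N x) + \<eta>))) * F (exp (ln (N x) + \<eta>) *\<^sub>R (x /\<^sub>R N x))
            = ennreal (N x ^ CARD('n)) * (ennreal (exp (n * \<eta>)) * F (exp \<eta> *\<^sub>R x))"
          by (simp only: mult.assoc)
      qed
      also have "\<dots> = ennreal (N x ^ CARD('n)) * (\<integral>\<^sup>+\<eta>. ennreal (exp (n * \<eta>)) * F (exp \<eta> *\<^sub>R x) \<partial>lborel)"
        by (rule nn_integral_cmult) measurable
      finally have "ennreal n * indicator D x * (\<integral>\<^sup>+\<xi>. ennreal (exp (n * \<xi>)) * F (exp \<xi> *\<^sub>R (x /\<^sub>R N x)) \<partial>lborel)
        = ennreal n * ennreal (N x ^ CARD('n)) * (\<integral>\<^sup>+\<eta>. ennreal (exp (n * \<eta>)) * F (exp \<eta> *\<^sub>R x) \<partial>lborel)"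
        using True by (simp add: mult.assoc)
      also have "\<dots> = (\<integral>\<^sup>+\<eta>. ennreal n * ennreal (N x ^ CARD('n)) * (ennreal (exp (n * \<eta>)) * F (exp \<eta> *\<^sub>R x)) \<partial>lborel)"
        by (rule nn_integral_cmult[symmetric]) measurable
      finally show ?thesis
        using True n Nx by (simp add: ennreal_mult mult.assoc)
    qed simp
  qed
  also have "\<dots> = (\<integral>\<^sup>+\<eta>. (\<integral>\<^sup>+x. ennreal (n * N x ^ CARD('n) * exp (n * \<eta>)) * indicator D x * F (exp \<eta> *\<^sub>R x) \<partial>lborel) \<partial>lborel)"
    by (rule lborel_pair.Fubini') measurable
  also have "\<dots> = (\<integral>\<^sup>+\<eta>. (\<integral>\<^sup>+z. F z * ennreal (N z ^ CARD('n)) * indicator {z. 0 < N z} z * (ennreal (n * exp (- n * \<eta>)) * indicator {ln (N z)..} \<eta>) \<partial>lborel) \<partial>lborel)"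
  proof (rule nn_integral_cong)
    fix \<eta> :: real
    have "(\<integral>\<^sup>+x. ennreal (n * N x ^ CARD('n) * exp (n * \<eta>)) * indicator D x * F (exp \<eta> *\<^sub>R x) \<partial>lborel)
      = ennreal (exp (- \<eta>) ^ CARD('n)) * (\<integral>\<^sup>+z. ennreal (n * N (exp (- \<eta>) *\<^sub>R z) ^ CARD('n) * exp (n * \<eta>)) * indicator D (exp (- \<eta>) *\<^sub>R z) * F (exp \<eta> *\<^sub>R exp (- \<eta>) *\<^sub>R z) \<partial>lborel)"
      by (subst nn_integral_lborel_scaleR[where c = "exp (- \<eta>)"]) auto
    also have "\<dots> = (\<integral>\<^sup>+z. ennreal (exp (- \<eta>) ^ CARD('n)) * (ennreal (n * N (exp (- \<eta>) *\<^sub>R z) ^ CARD('n) * exp (n * \<eta>)) * indicator D (exp (- \<eta>) *\<^sub>R z) * F (exp \<eta> *\<^sub>R exp (- \<eta>) *\<^sub>R z)) \<partial>lborel)"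
      by (rule nn_integral_cmult[symmetric]) measurable
    also have "\<dots> = (\<integral>\<^sup>+z. F z * ennreal (N z ^ CARD('n)) * indicator {z. 0 < N z} z * (ennreal (n * exp (- n * \<eta>)) * indicator {ln (N z)..} \<eta>) \<partial>lborel)"
    proof (rule nn_integral_cong)
      fix z
      have "0 \<le> N z" using norm_ell_nonneg[OF a_pos] by (simp add: N_def)
      show "ennreal (exp (- \<eta>) ^ CARD('n)) * (ennreal (n * N (exp (- \<eta>) *\<^sub>R z) ^ CARD('n) * exp (n * \<eta>)) * indicator D (exp (- \<eta>) *\<^sub>R z) * F (exp \<eta> *\<^sub>R exp (- \<eta>) *\<^sub>R z))
        = F z * ennreal (N z ^ CARD('n)) * indicator {z. 0 < N z} z * (ennreal (n * exp (- n * \<eta>)) * indicator {ln (N z)..} \<eta>)"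
      proof (cases "0 < N z")
        case True
        have "exp (- \<eta>) * N z \<le> 1 \<longleftrightarrow> N z \<le> exp \<eta>" by (simp add: exp_minus field_simps)
        also have "\<dots> \<longleftrightarrow> ln (N z) \<le> \<eta>" using True by (metis exp_le_cancel_iff exp_ln)
        finally have i: "indicator D (exp (- \<eta>) *\<^sub>R z) = (indicator {ln (N z)..} \<eta> :: ennreal)"
          using True by (simp add: D_def Nscale indicator_def)
        have "exp (- \<eta>) ^ CARD('n) * (n * (exp (- \<eta>) * N z) ^ CARD('n) * exp (n * \<eta>)) = N z ^ CARD('n) * (n * exp (- n * \<eta>))"
        proof -
          have "exp (- \<eta>) ^ CARD('n) = exp (- n * \<eta>)" using en[of "- \<eta>"] by simp
          moreover have "exp (- n * \<eta>) * exp (n * \<eta>) = 1" by (simp add: exp_add[symmetric])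
          ultimately show ?thesis by (simp add: power_mult_distrib mult_ac)
        qed
        then have "ennreal (exp (- \<eta>) ^ CARD('n)) * ennreal (n * N (exp (- \<eta>) *\<^sub>R z) ^ CARD('n) * exp (n * \<eta>)) = ennreal (N z ^ CARD('n)) * ennreal (n * exp (- n * \<eta>))"
          using True n by (simp add: Nscale ennreal_mult[symmetric])
        moreover have "exp \<eta> *\<^sub>R exp (- \<eta>) *\<^sub>R z = z" by (simp add: exp_add[symmetric])
        ultimately show ?thesis using True unfolding i by (simp add: mult_ac)
      next
        case False
        then have "N z = 0" using \<open>0 \<le> N z\<close> by simp
        then show ?thesis by (simp add: D_def Nscale)
      qed
    qed
    finally show "(\<integral>\<^sup>+x. ennreal (n * N x ^ CARD('n) * exp (n * \<eta>)) * indicator D x * F (exp \<eta> *\<^sub>R x) \<partial>lborel)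
      = (\<integral>\<^sup>+z. F z * ennreal (N z ^ CARD('n)) * indicator {z. 0 < N z} z * (ennreal (n * exp (- n * \<eta>)) * indicator {ln (N z)..} \<eta>) \<partial>lborel)" .
  qed
  also have "\<dots> = (\<integral>\<^sup>+z. (\<integral>\<^sup>+\<eta>. F z * ennreal (N z ^ CARD('n)) * indicator {z. 0 < N z} z * (ennreal (n * exp (- n * \<eta>)) * indicator {ln (N z)..} \<eta>) \<partial>lborel) \<partial>lborel)"
  proof -
    have [measurable]: "(\<lambda>p::real \<times> (real^'n). indicator {ln (N (snd p))..} (fst p) :: ennreal) \<in> borel_measurable (lborel \<Otimes>\<^sub>M lborel)"
    proof -
      have "(\<lambda>p::real \<times> (real^'n). indicator {ln (N (snd p))..} (fst p) :: ennreal) = indicator {p. ln (N (snd p)) \<le> fst p}"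
        by (auto simp: fun_eq_iff indicator_def)
      then show ?thesis by simp
    qed
    show ?thesis by (rule lborel_pair.Fubini'[symmetric]) (measurable, simp add: case_prod_beta')
  qed
  also have "\<dots> = (\<integral>\<^sup>+z. F z \<partial>lborel)"
  proof (rule nn_integral_cong_AE)
    have "AE z in lborel. z \<noteq> (0 :: real^'n)"
      using AE_lborel_singleton by blast
    then show "AE z in lborel. (\<integral>\<^sup>+\<eta>. F z * ennreal (N z ^ CARD('n)) * indicator {z. 0 < N z} z * (ennreal (n * exp (- n * \<eta>)) * indicator {ln (N z)..} \<eta>) \<partial>lborel) = F z"
    proof eventually_elim
      fix z :: "real^'n" assume "z \<noteq> 0"
      then have Nz: "0 < N z" using norm_ell_pos[OF a_pos] by (simp add: N_def)
      have "(\<integral>\<^sup>+\<eta>. F z * ennreal (N z ^ CARD('n)) * indicator {z. 0 < N z} z * (ennreal (n * exp (- n * \<eta>)) * indicator {ln (N z)..} \<eta>) \<partial>lborel)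
        = F z * ennreal (N z ^ CARD('n)) * ennreal (exp (- n * ln (N z)))"
        using Nz nn_integral_exp_tail_normalized[OF n, of "ln (N z)"] by (subst nn_integral_cmult) simp_all
      moreover have "N z ^ CARD('n) * exp (- n * ln (N z)) = 1"
        using en[of "ln (N z)"] Nz by (simp add: exp_minus)
      ultimately show "(\<integral>\<^sup>+\<eta>. F z * ennreal (N z ^ CARD('n)) * indicator {z. 0 < N z} z * (ennreal (n * exp (- n * \<eta>)) * indicator {ln (N z)..} \<eta>) \<partial>lborel) = F z"
        using Nz by (simp add: mult.assoc ennreal_mult[symmetric])
    qed
  qed
  finally show ?thesis by (simp add: n_def)
qed

section \<open>The cone measure in graph coordinates\<close>

text \<open>
  A point is split into its coordinate \<open>i\<close> and a function of the other indices, so that the latter can range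
  over a product measure indexed by \<open>- {i}\<close>.
\<close>

definition vec_insert :: "'n \<Rightarrow> ('n \<Rightarrow> real) \<Rightarrow> real \<Rightarrow> real^'n" where
  "vec_insert i y t = (\<chi> j. if j = i then t else y j)"

interpretation lborel_product: product_sigma_finite "\<lambda>_. lborel :: real measure"
  by standard

lemma measurable_vec_lambda_PiM:
  assumes "\<And>j::'n::finite. (\<lambda>w. f w j) \<in> borel_measurable M"
  shows "(\<lambda>w. (\<chi> j. f w j) :: real^'n) \<in> borel_measurable M"
proof (rule borel_measurable_euclidean_space[THEN iffD2], rule ballI)
  fix b :: "real^'n" assume "b \<in> Basis"
  then obtain j where "b = axis j 1" by (auto simp: Basis_vec_def)
  then show "(\<lambda>w. (\<chi> j. f w j) \<bullet> b) \<in> borel_measurable M"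
    using assms[of j] by (simp add: inner_axis)
qed

lemma measurable_vec_insert [measurable]:
  fixes i :: "'n::finite"
  assumes f: "f \<in> M \<rightarrow>\<^sub>M PiM (- {i}) (\<lambda>_. lborel)" and [measurable]: "g \<in> borel_measurable M"
  shows "(\<lambda>w. vec_insert i (f w) (g w)) \<in> borel_measurable M"
  unfolding vec_insert_def
proof (rule measurable_vec_lambda_PiM)
  fix j
  show "(\<lambda>w. if j = i then g w else f w j) \<in> borel_measurable M"
  proof (cases "j = i")
    case False
    then have "(\<lambda>w. f w j) \<in> M \<rightarrow>\<^sub>M lborel"
      by (intro measurable_compose[OF f measurable_component_singleton]) simp
    then show ?thesis using False by simp
  qed simp
qed

lemma lborel_vec_eq:
  "(lborel :: (real^'n) measure) = distr (\<Pi>\<^sub>M j\<in>UNIV. lborel) borel (\<lambda>y. \<chi> j. y j)"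
proof (rule lborel_eqI)
  have meas: "(\<lambda>y. (\<chi> j. y j) :: real^'n) \<in> borel_measurable (\<Pi>\<^sub>M j\<in>UNIV. lborel)"
    by (rule measurable_vec_lambda_PiM) (use measurable_component_singleton[of _ UNIV "\<lambda>_. lborel"] in simp)
  fix l u :: "real^'n" assume le: "\<And>b. b \<in> Basis \<Longrightarrow> l \<bullet> b \<le> u \<bullet> b"
  have le': "l $ j \<le> u $ j" for j using le[of "axis j 1"] by (simp add: inner_axis axis_in_Basis_iff)
  have "emeasure (distr (\<Pi>\<^sub>M j\<in>UNIV. lborel) borel (\<lambda>y. \<chi> j. y j)) (box l u)
     = emeasure (\<Pi>\<^sub>M j\<in>UNIV. lborel) (\<Pi>\<^sub>E j\<in>UNIV. {l $ j<..<u $ j})"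
    using meas by (subst emeasure_distr) (auto simp: space_PiM mem_box_cart PiE_iff intro!: arg_cong2[of _ _ _ _ emeasure])
  also have "\<dots> = (\<Prod>j\<in>UNIV. emeasure lborel {l $ j<..<u $ j})"
    by (rule lborel_product.emeasure_PiM) auto
  also have "\<dots> = ennreal (\<Prod>j\<in>UNIV. u $ j - l $ j)"
    using le' by (simp add: prod_ennreal)
  also have "(\<Prod>j\<in>UNIV. u $ j - l $ j) = (\<Prod>b\<in>Basis. (u - l) \<bullet> b)"
  proof -
    have B: "(Basis :: (real^'n) set) = range (\<lambda>j. axis j 1)" by (auto simp: Basis_vec_def)
    have "inj (\<lambda>j. axis j 1 :: real^'n)" by (auto simp: inj_on_def axis_eq_axis)
    then show ?thesis unfolding B by (simp add: prod.reindex inner_axis)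
  qed
  finally show "emeasure (distr (\<Pi>\<^sub>M j\<in>UNIV. lborel) borel (\<lambda>y. \<chi> j. y j)) (box l u) = ennreal (\<Prod>b\<in>Basis. (u - l) \<bullet> b)" .
qed simp

lemma nn_integral_lborel_vec_insert:
  fixes F :: "real^'n \<Rightarrow> ennreal"
  assumes [measurable]: "F \<in> borel_measurable borel"
  shows "(\<integral>\<^sup>+x. F x \<partial>lborel) = (\<integral>\<^sup>+y. (\<integral>\<^sup>+t. F (vec_insert i y t) \<partial>lborel) \<partial>(\<Pi>\<^sub>M j\<in>- {i}. lborel))"
proof -
  have meas [measurable]: "(\<lambda>y. (\<chi> j. y j) :: real^'n) \<in> borel_measurable (\<Pi>\<^sub>M j\<in>UNIV. lborel)"
    by (rule measurable_vec_lambda_PiM) (use measurable_component_singleton[of _ UNIV "\<lambda>_. lborel"] in simp)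
  have U: "insert i (- {i}) = UNIV" by auto
  have "(\<integral>\<^sup>+x. F x \<partial>lborel) = (\<integral>\<^sup>+y. F (\<chi> j. y j) \<partial>(\<Pi>\<^sub>M j\<in>UNIV. lborel))"
    by (subst lborel_vec_eq) (simp add: nn_integral_distr)
  also have "\<dots> = (\<integral>\<^sup>+y. F (\<chi> j. y j) \<partial>(\<Pi>\<^sub>M j\<in>insert i (- {i}). lborel))"
    by (simp only: U)
  also have "\<dots> = (\<integral>\<^sup>+y. (\<integral>\<^sup>+t. F (\<chi> j. (y(i := t)) j) \<partial>lborel) \<partial>(\<Pi>\<^sub>M j\<in>- {i}. lborel))"
    by (rule lborel_product.product_nn_integral_insert) (use meas in \<open>auto simp: U\<close>)
  finally show ?thesis by (simp add: vec_insert_def fun_upd_def)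
qed

lemma nn_integral_PiM_scale:
  assumes "finite I" "F \<in> borel_measurable (PiM I (\<lambda>_. lborel))" "0 < t"
  shows "(\<integral>\<^sup>+y. F y \<partial>PiM I (\<lambda>_. lborel)) = ennreal (t ^ card I) * (\<integral>\<^sup>+y. F (\<lambda>j\<in>I. t * y j) \<partial>PiM I (\<lambda>_. lborel))"
  using assms(1,2)
proof (induction I arbitrary: F rule: finite_induct)
  case empty
  have "(\<lambda>j\<in>{}. t * y j) = (\<lambda>_. undefined)" for y :: "'a \<Rightarrow> real" by auto
  then show ?case by (simp add: lborel_product.nn_integral_empty del: nn_integral_const)
next
  case (insert i I)
  note [measurable] = insert.prems
  have upd: "(\<lambda>(x, v). x(i := v)) \<in> PiM I (\<lambda>_. lborel) \<Otimes>\<^sub>M lborel \<rightarrow>\<^sub>M PiM (insert i I) (\<lambda>_. lborel :: real measure)"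
    by (rule measurable_add_dim)
  have F2 [measurable]: "(\<lambda>p. F ((fst p)(i := snd p))) \<in> borel_measurable (PiM I (\<lambda>_. lborel) \<Otimes>\<^sub>M lborel)"
    using measurable_compose[OF upd insert.prems] by (simp add: case_prod_beta')
  have F1: "(\<lambda>v. F (x(i := v))) \<in> borel_measurable lborel" if "x \<in> space (PiM I (\<lambda>_. lborel))" for x
    using measurable_compose[OF measurable_Pair1'[OF that] F2] by simp
  have sc: "(\<lambda>y. \<lambda>j\<in>I. t * y j) \<in> PiM I (\<lambda>_. lborel) \<rightarrow>\<^sub>M PiM I (\<lambda>_. lborel :: real measure)"
    by (rule measurable_restrict) (use measurable_component_singleton[of _ I "\<lambda>_. lborel :: real measure"] in simp)
  have scI: "(\<lambda>y. \<lambda>j\<in>insert i I. t * y j) \<in> PiM (insert i I) (\<lambda>_. lborel) \<rightarrow>\<^sub>M PiM (insert i I) (\<lambda>_. lborel :: real measure)"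
    by (rule measurable_restrict) (use measurable_component_singleton[of _ "insert i I" "\<lambda>_. lborel :: real measure"] in simp)
  have "(\<integral>\<^sup>+y. F y \<partial>PiM (insert i I) (\<lambda>_. lborel)) = (\<integral>\<^sup>+x. (\<integral>\<^sup>+v. F (x(i := v)) \<partial>lborel) \<partial>PiM I (\<lambda>_. lborel))"
    by (rule lborel_product.product_nn_integral_insert[OF insert.hyps insert.prems])
  also have "\<dots> = ennreal (t ^ card I) * (\<integral>\<^sup>+x. (\<integral>\<^sup>+v. F ((\<lambda>j\<in>I. t * x j)(i := v)) \<partial>lborel) \<partial>PiM I (\<lambda>_. lborel))"
    by (rule insert.IH, rule lborel.borel_measurable_nn_integral, unfold case_prod_beta', rule F2)
  also have "(\<integral>\<^sup>+x. (\<integral>\<^sup>+v. F ((\<lambda>j\<in>I. t * x j)(i := v)) \<partial>lborel) \<partial>PiM I (\<lambda>_. lborel))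
     = (\<integral>\<^sup>+x. ennreal t * (\<integral>\<^sup>+v. F ((\<lambda>j\<in>I. t * x j)(i := t * v)) \<partial>lborel) \<partial>PiM I (\<lambda>_. lborel))"
  proof (rule nn_integral_cong)
    fix x :: "'a \<Rightarrow> real" assume x: "x \<in> space (PiM I (\<lambda>_. lborel))"
    then have "(\<lambda>j\<in>I. t * x j) \<in> space (PiM I (\<lambda>_. lborel))" using measurable_space[OF sc] by simp
    from F1[OF this] have m: "(\<lambda>v. F ((\<lambda>j\<in>I. t * x j)(i := v))) \<in> borel_measurable borel" by simp
    show "(\<integral>\<^sup>+v. F ((\<lambda>j\<in>I. t * x j)(i := v)) \<partial>lborel) = ennreal t * (\<integral>\<^sup>+v. F ((\<lambda>j\<in>I. t * x j)(i := t * v)) \<partial>lborel)"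
      using nn_integral_real_affine[OF m, of t 0] \<open>0 < t\<close> by simp
  qed
  also have "\<dots> = ennreal t * (\<integral>\<^sup>+x. (\<integral>\<^sup>+v. F ((\<lambda>j\<in>I. t * x j)(i := t * v)) \<partial>lborel) \<partial>PiM I (\<lambda>_. lborel))"
  proof (rule nn_integral_cmult)
    have "(\<lambda>p. F ((\<lambda>j\<in>I. t * (fst p) j)(i := t * snd p))) \<in> borel_measurable (PiM I (\<lambda>_. lborel) \<Otimes>\<^sub>M lborel)"
    proof -
      have "(\<lambda>p. (\<lambda>j\<in>I. t * (fst p) j, t * snd p)) \<in> PiM I (\<lambda>_. lborel) \<Otimes>\<^sub>M lborel \<rightarrow>\<^sub>M PiM I (\<lambda>_. lborel) \<Otimes>\<^sub>M (lborel :: real measure)"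
        using sc by measurable
      from measurable_compose[OF this F2] show ?thesis by simp
    qed
    then show "(\<lambda>x. \<integral>\<^sup>+v. F ((\<lambda>j\<in>I. t * x j)(i := t * v)) \<partial>lborel) \<in> borel_measurable (PiM I (\<lambda>_. lborel))"
      by (intro lborel.borel_measurable_nn_integral) (simp add: case_prod_beta')
  qed
  also have "(\<integral>\<^sup>+x. (\<integral>\<^sup>+v. F ((\<lambda>j\<in>I. t * x j)(i := t * v)) \<partial>lborel) \<partial>PiM I (\<lambda>_. lborel))
     = (\<integral>\<^sup>+x. (\<integral>\<^sup>+v. F (\<lambda>j\<in>insert i I. t * (x(i := v)) j) \<partial>lborel) \<partial>PiM I (\<lambda>_. lborel))"
  proof -
    have "(\<lambda>j\<in>I. t * x j)(i := t * v) = (\<lambda>j\<in>insert i I. t * (x(i := v)) j)" for x :: "'a \<Rightarrow> real" and v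
      using insert.hyps by (auto simp: fun_eq_iff)
    then show ?thesis by simp
  qed
  also have "\<dots> = (\<integral>\<^sup>+y. F (\<lambda>j\<in>insert i I. t * y j) \<partial>PiM (insert i I) (\<lambda>_. lborel))"
    by (rule lborel_product.product_nn_integral_insert[OF insert.hyps measurable_compose[OF scI insert.prems], symmetric])
  finally have "integral\<^sup>N (PiM (insert i I) (\<lambda>_. lborel)) F
    = ennreal (t ^ card I) * (ennreal t * (\<integral>\<^sup>+y. F (\<lambda>j\<in>insert i I. t * y j) \<partial>PiM (insert i I) (\<lambda>_. lborel)))" .
  moreover have "ennreal (t ^ card (insert i I)) = ennreal (t ^ card I) * ennreal t"
    using insert.hyps \<open>0 < t\<close> by (simp add: ennreal_mult mult.commute)
  ultimately show ?case by (simp only: mult.assoc)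
qed

text \<open>
  The substitution \<open>t = \<surd>(q + c v\<^sup>2)\<close>. Since the integrand is unbounded near \<open>t = \<surd>q\<close>, it is
  performed on the compact intervals \<open>[1/(n+1), n+1]\<close> in \<open>v\<close>, followed by monotone convergence.
\<close>

lemma nn_integral_sqrt_substitution:
  fixes F :: "real \<Rightarrow> ennreal"
  assumes [measurable]: "F \<in> borel_measurable borel" and q: "0 \<le> q" and c: "0 < c"
  shows "(\<integral>\<^sup>+v. F v * indicator {0<..} v \<partial>lborel) =
    (\<integral>\<^sup>+t. F (sqrt ((t\<^sup>2 - q) / c)) * ennreal (t / (c * sqrt ((t\<^sup>2 - q) / c))) * indicator {sqrt q<..} t \<partial>lborel)"
proof -
  define g where "g v = sqrt (q + c * v\<^sup>2)" for v
  define f where "f t = F (sqrt ((t\<^sup>2 - q) / c)) * ennreal (t / (c * sqrt ((t\<^sup>2 - q) / c)))" for t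
  have [measurable]: "f \<in> borel_measurable borel" unfolding f_def by measurable
  \<comment> \<open>For \<open>n = 0\<close> the interval degenerates, hence the index shift below.\<close>
  define A where "A n = {inverse (real (Suc n))..real (Suc n)}" for n
  define B where "B n = {g (inverse (real (Suc n)))..g (real (Suc n))}" for n
  have gpos: "0 < g v" if "0 < v" for v using q c that by (simp add: g_def add_nonneg_pos)
  have gmono: "g v \<le> g w" if "0 \<le> v" "v \<le> w" for v w
    using that c by (simp add: g_def power_mono)
  have fg: "f (g v) * ennreal (c * v / g v) = F v" if v: "0 < v" for v
  proof -
    have "(g v)\<^sup>2 = q + c * v\<^sup>2" using q c by (simp add: g_def)
    then have s: "sqrt (((g v)\<^sup>2 - q) / c) = v" using v c by simp
    have "g v / (c * v) * (c * v / g v) = 1" using gpos[OF v] v c by simp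
    then have "ennreal (g v / (c * v)) * ennreal (c * v / g v) = 1"
      using gpos[OF v] v c by (simp add: ennreal_mult[symmetric] del: times_divide_eq_left times_divide_eq_right)
    then show ?thesis unfolding f_def s by (simp only: mult.assoc mult_1_right)
  qed
  have step: "(\<integral>\<^sup>+t. f t * indicator (B n) t \<partial>lborel) = (\<integral>\<^sup>+v. F v * indicator (A n) v \<partial>lborel)" if "0 < n" for n
  proof -
    have lt: "inverse (real (Suc n)) < real (Suc n)"
    proof -
      have "inverse (real (Suc n)) < 1" using that by (simp add: inverse_less_1_iff)
      also have "1 < real (Suc n)" using that by simp
      finally show ?thesis .
    qed
    have pos: "0 < v" if "v \<in> {inverse (real (Suc n))..real (Suc n)}" for v
      using that less_le_trans[of 0 "inverse (real (Suc n))" v] by simp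
    have "(\<integral>\<^sup>+t. f t * indicator (B n) t \<partial>lborel) = (\<integral>\<^sup>+v. f (g v) * ennreal (c * v / g v) * indicator (A n) v \<partial>lborel)"
      unfolding A_def B_def
    proof (rule nn_integral_substitution_aux)
      show "(g has_real_derivative c * v / g v) (at v)" if "v \<in> {inverse (real (Suc n))..real (Suc n)}" for v
      proof -
        have "0 < q + c * v\<^sup>2" using pos[OF that] q c by (simp add: add_nonneg_pos)
        then show ?thesis unfolding g_def by (auto intro!: derivative_eq_intros simp: field_simps)
      qed
      show "continuous_on {inverse (real (Suc n))..real (Suc n)} (\<lambda>v. c * v / g v)"
      proof (intro continuous_on_divide)
        show "\<forall>v\<in>{inverse (real (Suc n))..real (Suc n)}. g v \<noteq> 0" using gpos pos by force
      qed (auto simp: g_def intro!: continuous_intros)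
      show "0 \<le> c * v / g v" if "v \<in> {inverse (real (Suc n))..real (Suc n)}" for v
        using pos[OF that] gpos[OF pos[OF that]] c by simp
    qed (use lt in auto)
    also have "\<dots> = (\<integral>\<^sup>+v. F v * indicator (A n) v \<partial>lborel)"
    proof (rule nn_integral_cong)
      fix v show "f (g v) * ennreal (c * v / g v) * indicator (A n) v = F v * indicator (A n) v"
        using fg[of v] pos[of v] by (cases "v \<in> A n") (simp_all add: A_def)
    qed
    finally show ?thesis .
  qed
  have incA: "incseq A" unfolding A_def by (intro monoI) (auto intro: order_trans le_imp_inverse_le)
  have incB: "incseq B" unfolding B_def
  proof (intro monoI subsetI)
    fix m n :: nat and t assume "m \<le> n" and t: "t \<in> {g (inverse (real (Suc m)))..g (real (Suc m))}"
    then have "g (inverse (real (Suc n))) \<le> g (inverse (real (Suc m)))" "g (real (Suc m)) \<le> g (real (Suc n))"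
      by (auto intro!: gmono le_imp_inverse_le)
    then show "t \<in> {g (inverse (real (Suc n)))..g (real (Suc n))}" using t by auto
  qed
  have ex: "\<exists>n. v \<in> A n" if v0: "0 < v" for v
  proof -
    obtain n1 where "v \<le> real n1" using real_arch_simple by blast
    moreover obtain n2 where "inverse (real (Suc n2)) < v" using reals_Archimedean[OF v0] by blast
    moreover have "inverse (real (Suc (max n1 n2))) \<le> inverse (real (Suc n2))"
      by (intro le_imp_inverse_le) auto
    ultimately have "inverse (real (Suc (max n1 n2))) \<le> v" by linarith
    moreover have "v \<le> real (Suc (max n1 n2))" using \<open>v \<le> real n1\<close> by simp
    ultimately show ?thesis unfolding A_def by (intro exI[of _ "max n1 n2"]) simp
  qed
  have UA: "(\<Union>n. A n) = {0<..}"
  proof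
    have "0 < v" if "v \<in> A n" for n v
      using that less_le_trans[of 0 "inverse (real (Suc n))" v] by (simp add: A_def)
    then show "(\<Union>n. A n) \<subseteq> {0<..}" by auto
  qed (use ex in auto)
  have UB: "(\<Union>n. B n) = {sqrt q<..}"
  proof
    have "sqrt q < t" if "t \<in> B n" for n t
    proof -
      have "sqrt q < g (inverse (real (Suc n)))" using c unfolding g_def by (simp del: of_nat_Suc)
      then show ?thesis using that by (simp add: B_def)
    qed
    then show "(\<Union>n. B n) \<subseteq> {sqrt q<..}" by auto
    show "{sqrt q<..} \<subseteq> (\<Union>n. B n)"
    proof
      fix t assume t: "t \<in> {sqrt q<..}"
      then have "sqrt q < t" by simp
      then have t0: "0 < t" using real_sqrt_ge_zero[OF q] by linarith
      have "q < t\<^sup>2" using t q t0 by (metis greaterThan_iff real_less_lsqrt real_sqrt_less_iff real_sqrt_unique less_imp_le real_sqrt_abs abs_of_pos)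
      then have v: "0 < sqrt ((t\<^sup>2 - q) / c)" using c by simp
      have gt: "g (sqrt ((t\<^sup>2 - q) / c)) = t" using \<open>q < t\<^sup>2\<close> c t0 by (simp add: g_def)
      obtain n where "sqrt ((t\<^sup>2 - q) / c) \<in> A n" using ex[OF v] by blast
      then have "g (inverse (real (Suc n))) \<le> t" "t \<le> g (real (Suc n))"
        using gmono[of "inverse (real (Suc n))" "sqrt ((t\<^sup>2 - q) / c)"] gmono[of "sqrt ((t\<^sup>2 - q) / c)" "real (Suc n)"] v
        unfolding gt A_def by auto
      then show "t \<in> (\<Union>n. B n)" by (auto simp: B_def)
    qed
  qed
  have cont: "(\<integral>\<^sup>+t. h t * indicator (\<Union>n. C (Suc n)) t \<partial>lborel) = (SUP n. \<integral>\<^sup>+t. h t * indicator (C (Suc n)) t \<partial>lborel)"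
    if [measurable]: "h \<in> borel_measurable borel" "\<And>n. C n \<in> sets borel" and "incseq C" for h :: "real \<Rightarrow> ennreal" and C
  proof -
    have "(SUP n. emeasure (density lborel h) (C (Suc n))) = emeasure (density lborel h) (\<Union>n. C (Suc n))"
      by (rule SUP_emeasure_incseq) (use \<open>incseq C\<close> in \<open>auto simp: incseq_def\<close>)
    then show ?thesis by (simp add: emeasure_density)
  qed
  have shift: "(\<Union>n. C (Suc n)) = (\<Union>n. C n)" if "incseq C" for C :: "nat \<Rightarrow> real set"
    using that by (force simp: incseq_Suc_iff)
  have "(\<integral>\<^sup>+v. F v * indicator {0<..} v \<partial>lborel) = (SUP n. \<integral>\<^sup>+v. F v * indicator (A (Suc n)) v \<partial>lborel)"
    unfolding UA[symmetric] shift[OF incA, symmetric] by (rule cont[OF _ _ incA]) (auto simp: A_def)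
  also have "\<dots> = (SUP n. \<integral>\<^sup>+t. f t * indicator (B (Suc n)) t \<partial>lborel)"
    by (simp add: step)
  also have "\<dots> = (\<integral>\<^sup>+t. f t * indicator {sqrt q<..} t \<partial>lborel)"
    unfolding UB[symmetric] shift[OF incB, symmetric] by (rule cont[OF _ _ incB, symmetric]) (auto simp: B_def)
  finally show ?thesis by (simp add: f_def)
qed

definition base_sum :: "real^'n \<Rightarrow> 'n \<Rightarrow> ('n \<Rightarrow> real) \<Rightarrow> real" where
  "base_sum a i y = (\<Sum>j\<in>- {i}. a $ j * (y j)\<^sup>2)"

text \<open>
  The height over \<open>y\<close> of the boundary of the ellipsoid, as a graph in direction \<open>i\<close>. It is meaningful for
  \<open>base_sum a i y < 1\<close>.
\<close>

definition cap_height :: "real^'n \<Rightarrow> 'n \<Rightarrow> ('n \<Rightarrow> real) \<Rightarrow> real" where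
  "cap_height a i y = sqrt ((1 - base_sum a i y) / a $ i)"

lemma measurable_base_sum [measurable]:
  fixes i :: "'n::finite"
  shows "base_sum a i \<in> borel_measurable (PiM (- {i}) (\<lambda>_. lborel))"
  unfolding base_sum_def[abs_def]
proof (rule borel_measurable_sum)
  fix j assume "j \<in> - {i}"
  then have "(\<lambda>y. y j) \<in> PiM (- {i}) (\<lambda>_. lborel) \<rightarrow>\<^sub>M (lborel :: real measure)"
    by (rule measurable_component_singleton)
  then have [measurable]: "(\<lambda>y. y j) \<in> borel_measurable (PiM (- {i}) (\<lambda>_. lborel :: real measure))" by simp
  show "(\<lambda>y. a $ j * (y j)\<^sup>2) \<in> borel_measurable (PiM (- {i}) (\<lambda>_. lborel))" by measurable
qed

lemma measurable_cap_height [measurable]: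
  fixes i :: "'n::finite"
  shows "cap_height a i \<in> borel_measurable (PiM (- {i}) (\<lambda>_. lborel))"
  unfolding cap_height_def[abs_def] by measurable

lemma measurable_vec_insert_id [measurable]:
  fixes i :: "'n::finite"
  assumes "g \<in> borel_measurable (PiM (- {i}) (\<lambda>_. lborel))"
  shows "(\<lambda>y. vec_insert i y (g y)) \<in> borel_measurable (PiM (- {i}) (\<lambda>_. lborel))"
  using measurable_vec_insert[of "\<lambda>y. y" _ i g] assms by simp

lemma vec_insert_nth: "vec_insert i y t $ j = (if j = i then t else y j)"
  by (simp add: vec_insert_def)

lemma vec_insert_scaleR: "vec_insert i (\<lambda>j\<in>- {i}. c * y j) (c * t) = c *\<^sub>R vec_insert i y t"
  by (simp add: vec_eq_iff vec_insert_nth)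

lemma base_sum_scale: "base_sum a i (\<lambda>j\<in>- {i}. c * y j) = c\<^sup>2 * base_sum a i y"
  by (simp add: base_sum_def sum_distrib_left power_mult_distrib mult_ac)

context
  fixes a :: "real^'n" and i :: 'n
  assumes a_pos: "\<And>i. a $ i > 0"
begin

lemma norm_ell_vec_insert: "(norm_ell a (vec_insert i y t))\<^sup>2 = a $ i * t\<^sup>2 + base_sum a i y"
proof -
  have U: "UNIV = insert i (- {i})" by auto
  show ?thesis unfolding norm_ell_sq[OF a_pos] base_sum_def
    by (subst U, subst sum.insert) (auto simp: vec_insert_nth intro!: sum.cong)
qed

lemma base_sum_nonneg: "0 \<le> base_sum a i y"
  unfolding base_sum_def using a_pos by (intro sum_nonneg) (simp add: less_imp_le)

lemma norm_ell_cap: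
  assumes "base_sum a i y < 1" "\<sigma>\<^sup>2 = 1"
  shows "norm_ell a (vec_insert i y (\<sigma> * cap_height a i y)) = 1"
proof -
  have "(norm_ell a (vec_insert i y (\<sigma> * cap_height a i y)))\<^sup>2 = 1"
    using assms a_pos[of i] by (simp add: norm_ell_vec_insert power_mult_distrib cap_height_def)
  then show ?thesis using norm_ell_nonneg[OF a_pos]
    by (metis abs_of_nonneg power2_eq_1_iff real_sqrt_abs real_sqrt_one)
qed

lemma cap_height_pos: "base_sum a i y < 1 \<Longrightarrow> 0 < cap_height a i y"
  using a_pos[of i] by (simp add: cap_height_def)

text \<open>
  Polar coordinates on a half-space in terms of the graph of the boundary. For fixed coordinates \<open>y\<close>
  the coordinate \<open>x\<^sub>i\<close> is replaced by \<open>t = |x|\<^sub>a\<close>, which is \<open>nn_integral_sqrt_substitution\<close>; then, for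
  fixed \<open>t\<close>, the variables \<open>y\<close> are scaled by \<open>t\<close>. The sign \<open>\<sigma>\<close> selects the upper or the lower half.
\<close>

lemma nn_integral_half_space:
  fixes F :: "real^'n \<Rightarrow> ennreal"
  assumes [measurable]: "F \<in> borel_measurable borel" and \<sigma>: "\<sigma>\<^sup>2 = 1"
  shows "(\<integral>\<^sup>+x. F x * indicator {x. 0 < \<sigma> * x $ i} x \<partial>lborel) =
    (\<integral>\<^sup>+t. (\<integral>\<^sup>+y. indicator {0<..} t * ennreal (t ^ (CARD('n) - 1)) * (indicator {y. base_sum a i y < 1} y *
        F (t *\<^sub>R vec_insert i y (\<sigma> * cap_height a i y)) * ennreal (1 / (a $ i * cap_height a i y)))
      \<partial>(\<Pi>\<^sub>M j\<in>- {i}. lborel)) \<partial>lborel)"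
proof -
  define M where "M = (\<Pi>\<^sub>M j\<in>- {i}. (lborel :: real measure))"
  interpret finite_product_sigma_finite "\<lambda>_. lborel :: real measure" "- {i}"
    by standard auto
  interpret pair_sigma_finite M "lborel :: real measure"
    unfolding M_def by standard
  have \<sigma>01: "\<sigma> = 1 \<or> \<sigma> = - 1" using \<sigma> by (simp add: power2_eq_1_iff)
  have [measurable]: "vec_nth x \<in> borel_measurable (count_space UNIV)" for x :: "real^'n" by simp
  have ind [measurable]: "{x::real^'n. 0 < \<sigma> * x $ i} \<in> sets borel"
    by (simp add: borel_measurable_less)
  have ci: "0 < a $ i" by (rule a_pos)
  have bM [measurable]: "base_sum a i \<in> borel_measurable M" "cap_height a i \<in> borel_measurable M" unfolding M_def by measurable
  have idM: "(\<lambda>w. fst w) \<in> M \<Otimes>\<^sub>M lborel \<rightarrow>\<^sub>M PiM (- {i}) (\<lambda>_. lborel)" unfolding M_def by measurable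
  have vi [measurable]: "(\<lambda>w. vec_insert i (fst w) (g w)) \<in> borel_measurable (M \<Otimes>\<^sub>M lborel)"
    if "g \<in> borel_measurable (M \<Otimes>\<^sub>M lborel)" for g
    by (rule measurable_vec_insert[OF idM that])
  define H where "H y t = F (vec_insert i y (\<sigma> * sqrt ((t\<^sup>2 - base_sum a i y) / a $ i))) *
      ennreal (t / (a $ i * sqrt ((t\<^sup>2 - base_sum a i y) / a $ i))) * indicator {sqrt (base_sum a i y)<..} t" for y t
  have "(\<integral>\<^sup>+x. F x * indicator {x. 0 < \<sigma> * x $ i} x \<partial>lborel)
     = (\<integral>\<^sup>+y. (\<integral>\<^sup>+v. F (vec_insert i y v) * indicator {x. 0 < \<sigma> * x $ i} (vec_insert i y v) \<partial>lborel) \<partial>M)"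
    unfolding M_def by (rule nn_integral_lborel_vec_insert) measurable
  also have "\<dots> = (\<integral>\<^sup>+y. (\<integral>\<^sup>+t. H y t \<partial>lborel) \<partial>M)"
  proof (rule nn_integral_cong)
    fix y assume y: "y \<in> space M"
    have c: "(\<lambda>v. y) \<in> lborel \<rightarrow>\<^sub>M PiM (- {i}) (\<lambda>_. lborel :: real measure)" using y unfolding M_def by simp
    have [measurable]: "(\<lambda>v. vec_insert i y (h v)) \<in> borel_measurable borel" if "h \<in> borel_measurable borel" for h :: "real \<Rightarrow> real"
      using measurable_vec_insert[OF c, of h] that by simp
    have m: "(\<lambda>v. F (vec_insert i y (\<sigma> * v))) \<in> borel_measurable borel" by measurable
    have "(\<integral>\<^sup>+v. F (vec_insert i y v) * indicator {x. 0 < \<sigma> * x $ i} (vec_insert i y v) \<partial>lborel)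
       = (\<integral>\<^sup>+v. F (vec_insert i y (\<sigma> * v)) * indicator {0<..} v \<partial>lborel)"
      using \<sigma>01 by (subst nn_integral_real_affine[of _ \<sigma> 0])
        (auto simp: vec_insert_nth indicator_def intro!: nn_integral_cong)
    also have "\<dots> = (\<integral>\<^sup>+t. H y t \<partial>lborel)"
      unfolding H_def by (rule nn_integral_sqrt_substitution[OF m base_sum_nonneg ci])
    finally show "(\<integral>\<^sup>+v. F (vec_insert i y v) * indicator {x. 0 < \<sigma> * x $ i} (vec_insert i y v) \<partial>lborel) = (\<integral>\<^sup>+t. H y t \<partial>lborel)" .
  qed
  also have "\<dots> = (\<integral>\<^sup>+t. (\<integral>\<^sup>+y. H y t \<partial>M) \<partial>lborel)"
  proof (rule Fubini'[symmetric])
    have "(\<lambda>p. indicator {sqrt (base_sum a i (fst p))<..} (snd p) :: ennreal) = indicator {p. sqrt (base_sum a i (fst p)) < snd p}"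
      by (auto simp: fun_eq_iff indicator_def)
    moreover have "Measurable.pred (M \<Otimes>\<^sub>M lborel) (\<lambda>p. sqrt (base_sum a i (fst p)) < snd p)" by measurable
    ultimately have [measurable]: "(\<lambda>p. indicator {sqrt (base_sum a i (fst p))<..} (snd p) :: ennreal) \<in> borel_measurable (M \<Otimes>\<^sub>M lborel)"
      by (simp add: borel_measurable_indicator_iff pred_def Int_def conj_commute)
    show "(\<lambda>(y, t). H y t) \<in> borel_measurable (M \<Otimes>\<^sub>M lborel)"
      unfolding H_def case_prod_beta' by measurable
  qed
  also have "\<dots> = (\<integral>\<^sup>+t. (\<integral>\<^sup>+y. indicator {0<..} t * ennreal (t ^ (CARD('n) - 1)) * (indicator {y. base_sum a i y < 1} y *
        F (t *\<^sub>R vec_insert i y (\<sigma> * cap_height a i y)) * ennreal (1 / (a $ i * cap_height a i y))) \<partial>M) \<partial>lborel)"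
  proof (rule nn_integral_cong)
    fix t :: real
    show "(\<integral>\<^sup>+y. H y t \<partial>M) = (\<integral>\<^sup>+y. indicator {0<..} t * ennreal (t ^ (CARD('n) - 1)) * (indicator {y. base_sum a i y < 1} y *
        F (t *\<^sub>R vec_insert i y (\<sigma> * cap_height a i y)) * ennreal (1 / (a $ i * cap_height a i y))) \<partial>M)"
    proof (cases "0 < t")
      case False
      have "\<not> sqrt (base_sum a i y) < t" for y
        using False real_sqrt_ge_zero[OF base_sum_nonneg, of y] by linarith
      then show ?thesis using False by (simp add: H_def)
    next
      case True
      have tm: "Measurable.pred M (\<lambda>y. sqrt (base_sum a i y) < t)" by measurable
      have "(\<lambda>y. indicator {sqrt (base_sum a i y)<..} t :: ennreal) = indicator {y. sqrt (base_sum a i y) < t}"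
        by (auto simp: fun_eq_iff indicator_def)
      with tm have [measurable]: "(\<lambda>y. indicator {sqrt (base_sum a i y)<..} t :: ennreal) \<in> borel_measurable M"
        by (simp add: borel_measurable_indicator_iff pred_def Int_def conj_commute)
      have vim [measurable]: "(\<lambda>y. vec_insert i y (g y)) \<in> borel_measurable M" if "g \<in> borel_measurable M" for g
        using measurable_vec_insert_id that unfolding M_def by blast
      have Hm: "(\<lambda>y. H y t) \<in> borel_measurable M" unfolding H_def by measurable
      have "card (- {i}) = CARD('n) - 1" by (simp add: Compl_eq_Diff_UNIV card_Diff_singleton)
      then have "(\<integral>\<^sup>+y. H y t \<partial>M) = ennreal (t ^ (CARD('n) - 1)) * (\<integral>\<^sup>+y. H (\<lambda>j\<in>- {i}. t * y j) t \<partial>M)"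
        using nn_integral_PiM_scale[OF _ Hm[unfolded M_def] True] unfolding M_def by simp
      also have "\<dots> = ennreal (t ^ (CARD('n) - 1)) * (\<integral>\<^sup>+y. indicator {y. base_sum a i y < 1} y *
        F (t *\<^sub>R vec_insert i y (\<sigma> * cap_height a i y)) * ennreal (1 / (a $ i * cap_height a i y)) \<partial>M)"
      proof (rule arg_cong2[of _ _ _ _ "(*)", OF refl], rule nn_integral_cong)
        fix y
        define b where "b = base_sum a i y"
        have b: "base_sum a i (\<lambda>j\<in>- {i}. t * y j) = t\<^sup>2 * b" by (simp add: base_sum_scale b_def)
        have "sqrt (t\<^sup>2 * b) = t * sqrt b" using True by (simp add: real_sqrt_mult)
        then have iff: "sqrt (t\<^sup>2 * b) < t \<longleftrightarrow> b < 1" using True by (simp add: mult_less_cancel_left2)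
        have "t\<^sup>2 - t\<^sup>2 * b = t\<^sup>2 * (1 - b)" by (simp add: algebra_simps)
        then have s: "sqrt ((t\<^sup>2 - t\<^sup>2 * b) / a $ i) = t * cap_height a i y"
          using True by (simp add: real_sqrt_mult real_sqrt_divide cap_height_def b_def)
        have v: "vec_insert i (\<lambda>j\<in>- {i}. t * y j) (\<sigma> * (t * cap_height a i y)) = t *\<^sub>R vec_insert i y (\<sigma> * cap_height a i y)"
          unfolding vec_insert_scaleR[symmetric] by (simp only: mult.left_commute)
        have r: "t / (a $ i * (t * cap_height a i y)) = 1 / (a $ i * cap_height a i y)" using True by simp
        show "H (\<lambda>j\<in>- {i}. t * y j) t = indicator {y. base_sum a i y < 1} y *
            F (t *\<^sub>R vec_insert i y (\<sigma> * cap_height a i y)) * ennreal (1 / (a $ i * cap_height a i y))"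
          unfolding H_def b s v r using iff by (simp add: indicator_def b_def)
      qed
      also have "\<dots> = (\<integral>\<^sup>+y. ennreal (t ^ (CARD('n) - 1)) * (indicator {y. base_sum a i y < 1} y *
        F (t *\<^sub>R vec_insert i y (\<sigma> * cap_height a i y)) * ennreal (1 / (a $ i * cap_height a i y))) \<partial>M)"
      proof (rule nn_integral_cmult[symmetric])
        have "Measurable.pred M (\<lambda>y. base_sum a i y < 1)" by measurable
        then have [measurable]: "(indicator {y. base_sum a i y < 1} :: _ \<Rightarrow> ennreal) \<in> borel_measurable M"
          by (simp add: borel_measurable_indicator_iff pred_def Int_def conj_commute)
        show "(\<lambda>y. indicator {y. base_sum a i y < 1} y * F (t *\<^sub>R vec_insert i y (\<sigma> * cap_height a i y)) * ennreal (1 / (a $ i * cap_height a i y))) \<in> borel_measurable M"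
          by measurable
      qed
      finally show ?thesis using True by simp
    qed
  qed
  finally show ?thesis by (simp only: M_def)
qed

text \<open>
  The previous formula for a function of the direction alone on the unit ellipsoid: the radial integral
  is that of \<open>n t\<^sup>n\<^sup>-\<^sup>1\<close> over \<open>(0, 1]\<close>.
\<close>

lemma nn_integral_cone_measure_cap:
  fixes f :: "real^'n \<Rightarrow> ennreal"
  assumes [measurable]: "f \<in> borel_measurable borel" and \<sigma>: "\<sigma>\<^sup>2 = 1"
  shows "(\<integral>\<^sup>+\<theta>. f \<theta> * indicator {\<theta>. 0 < \<sigma> * \<theta> $ i} \<theta> \<partial>cone_measure a) =
    (\<integral>\<^sup>+y. indicator {y. base_sum a i y < 1} y * f (vec_insert i y (\<sigma> * cap_height a i y)) * ennreal (1 / (a $ i * cap_height a i y))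
      \<partial>(\<Pi>\<^sub>M j\<in>- {i}. lborel))"
proof -
  define M where "M = (\<Pi>\<^sub>M j\<in>- {i}. (lborel :: real measure))"
  define n where "n = real CARD('n)"
  define N where "N = norm_ell a"
  have [measurable]: "N \<in> borel_measurable borel" by (simp add: N_def)
  have [measurable]: "{x::real^'n. 0 < \<sigma> * x $ i} \<in> sets borel" by (simp add: borel_measurable_less)
  define D where "D = {x. 0 < N x \<and> N x \<le> 1}"
  have [measurable]: "D \<in> sets borel" unfolding D_def by measurable
  define K where "K y = indicator {y. base_sum a i y < 1} y * f (vec_insert i y (\<sigma> * cap_height a i y)) * ennreal (1 / (a $ i * cap_height a i y))" for y
  have vim [measurable]: "(\<lambda>y. vec_insert i y (g y)) \<in> borel_measurable M" if "g \<in> borel_measurable M" for g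
    using measurable_vec_insert_id that unfolding M_def by blast
  have bM [measurable]: "base_sum a i \<in> borel_measurable M" "cap_height a i \<in> borel_measurable M" unfolding M_def by measurable
  have Km [measurable]: "K \<in> borel_measurable M"
  proof -
    have "Measurable.pred M (\<lambda>y. base_sum a i y < 1)" by measurable
    then have [measurable]: "(indicator {y. base_sum a i y < 1} :: _ \<Rightarrow> ennreal) \<in> borel_measurable M"
      by (simp add: borel_measurable_indicator_iff pred_def Int_def conj_commute)
    show ?thesis unfolding K_def[abs_def] by measurable
  qed
  have "(\<integral>\<^sup>+\<theta>. f \<theta> * indicator {\<theta>. 0 < \<sigma> * \<theta> $ i} \<theta> \<partial>cone_measure a)
    = (\<integral>\<^sup>+x. ennreal n * indicator D x * (f (x /\<^sub>R N x) * indicator {\<theta>. 0 < \<sigma> * \<theta> $ i} (x /\<^sub>R N x)) \<partial>lborel)"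
    by (subst nn_integral_cone_measure[OF a_pos]) (simp_all add: n_def N_def D_def)
  also have "\<dots> = (\<integral>\<^sup>+x. (ennreal n * indicator D x * f (x /\<^sub>R N x)) * indicator {x. 0 < \<sigma> * x $ i} x \<partial>lborel)"
  proof (rule nn_integral_cong)
    fix x show "ennreal n * indicator D x * (f (x /\<^sub>R N x) * indicator {\<theta>. 0 < \<sigma> * \<theta> $ i} (x /\<^sub>R N x))
      = (ennreal n * indicator D x * f (x /\<^sub>R N x)) * indicator {x. 0 < \<sigma> * x $ i} x"
    proof (cases "x \<in> D")
      case True
      then have "0 < N x" by (simp add: D_def)
      then have "0 < inverse (N x) * z \<longleftrightarrow> 0 < z" for z by (simp add: zero_less_mult_iff)
      moreover have "\<sigma> * (x /\<^sub>R N x) $ i = inverse (N x) * (\<sigma> * x $ i)" by simp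
      ultimately have "0 < \<sigma> * (x /\<^sub>R N x) $ i \<longleftrightarrow> 0 < \<sigma> * x $ i" by (simp only:)
      then show ?thesis by (simp add: indicator_def mult.assoc)
    qed simp
  qed
  also have "\<dots> = (\<integral>\<^sup>+t. (\<integral>\<^sup>+y. indicator {0<..} t * ennreal (t ^ (CARD('n) - 1)) * (indicator {y. base_sum a i y < 1} y *
        (ennreal n * indicator D (t *\<^sub>R vec_insert i y (\<sigma> * cap_height a i y)) *
          f ((t *\<^sub>R vec_insert i y (\<sigma> * cap_height a i y)) /\<^sub>R N (t *\<^sub>R vec_insert i y (\<sigma> * cap_height a i y)))) *
        ennreal (1 / (a $ i * cap_height a i y))) \<partial>M) \<partial>lborel)"
    unfolding M_def by (rule nn_integral_half_space[OF _ \<sigma>]) measurable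
  also have "\<dots> = (\<integral>\<^sup>+t. (\<integral>\<^sup>+y. (ennreal (n * t ^ (CARD('n) - 1)) * indicator {0<..1} t) * K y \<partial>M) \<partial>lborel)"
  proof (intro nn_integral_cong)
    fix t :: real and y
    let ?\<theta> = "vec_insert i y (\<sigma> * cap_height a i y)"
    show "indicator {0<..} t * ennreal (t ^ (CARD('n) - 1)) * (indicator {y. base_sum a i y < 1} y *
        (ennreal n * indicator D (t *\<^sub>R ?\<theta>) * f ((t *\<^sub>R ?\<theta>) /\<^sub>R N (t *\<^sub>R ?\<theta>))) * ennreal (1 / (a $ i * cap_height a i y)))
      = (ennreal (n * t ^ (CARD('n) - 1)) * indicator {0<..1} t) * K y"
    proof (cases "0 < t \<and> base_sum a i y < 1")
      case True
      then have N: "N (t *\<^sub>R ?\<theta>) = t" using norm_ell_cap[OF _ \<sigma>, of y] by (simp add: N_def norm_ell_scaleR)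
      have "(t *\<^sub>R ?\<theta>) /\<^sub>R t = ?\<theta>" using True by simp
      moreover have "(indicator D (t *\<^sub>R ?\<theta>) :: ennreal) = indicator {0<..1} t" using True by (simp add: D_def N indicator_def)
      moreover have "ennreal (n * t ^ (CARD('n) - 1)) = ennreal n * ennreal (t ^ (CARD('n) - 1))"
        using True by (simp add: ennreal_mult n_def)
      ultimately show ?thesis unfolding N K_def using True by (simp add: mult_ac)
    next
      case False
      then show ?thesis by (auto simp: K_def indicator_def)
    qed
  qed
  also have "\<dots> = (\<integral>\<^sup>+t. (ennreal (n * t ^ (CARD('n) - 1)) * indicator {0<..1} t) * (\<integral>\<^sup>+y. K y \<partial>M) \<partial>lborel)"
    by (intro nn_integral_cong nn_integral_cmult Km)
  also have "\<dots> = (\<integral>\<^sup>+t. ennreal (n * t ^ (CARD('n) - 1)) * indicator {0<..1} t \<partial>lborel) * (\<integral>\<^sup>+y. K y \<partial>M)"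
    by (rule nn_integral_multc) measurable
  also have "(\<integral>\<^sup>+t. ennreal (n * t ^ (CARD('n) - 1)) * indicator {0<..1} t \<partial>lborel) = 1"
  proof -
    have "(\<integral>\<^sup>+t. ennreal (n * t ^ (CARD('n) - 1)) * indicator {0<..1} t \<partial>lborel) = (\<integral>\<^sup>+t. ennreal (n * t ^ (CARD('n) - 1)) * indicator {0..1} t \<partial>lborel)"
    proof (rule nn_integral_cong_AE)
      have "AE t in lborel. t \<noteq> (0::real)" using AE_lborel_singleton by blast
      then show "AE t in lborel. ennreal (n * t ^ (CARD('n) - 1)) * indicator {0<..1} t = ennreal (n * t ^ (CARD('n) - 1)) * indicator {0..1} t"
        by eventually_elim (auto simp: indicator_def)
    qed
    also have "\<dots> = ennreal (1 ^ CARD('n) - 0 ^ CARD('n))"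
    proof (rule nn_integral_FTC_Icc)
      show "((\<lambda>t. t ^ CARD('n)) has_real_derivative n * x ^ (CARD('n) - 1)) (at x)" for x :: real
        using DERIV_pow[of "CARD('n)" x UNIV] by (simp add: n_def)
    qed (auto simp: n_def)
    finally show ?thesis by (simp add: zero_power)
  qed
  finally show ?thesis by (simp add: K_def M_def)
qed

end

section \<open>The surface measure of an ellipsoid\<close>

lemma measurable_vec_nth [measurable]: "(\<lambda>x::real^'n. x $ i) \<in> borel_measurable borel"
  by (intro borel_measurable_continuous_onI continuous_intros)

lemma set_coord_vec_insert: "set_coord (vec_insert i y t) i t' = vec_insert i y t'"
  by (simp add: set_coord_def vec_eq_iff vec_insert_nth)

lemma vec_insert_of_vec: "y $ i = t \<Longrightarrow> vec_insert i (($) y) t = y"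
  by (auto simp: vec_eq_iff vec_insert_nth)

lemma hyperplane_lborel_eq: "hyperplane_lborel i = distr (\<Pi>\<^sub>M j\<in>- {i}. lborel) borel (\<lambda>y. vec_insert i y 0)"
  by (simp add: hyperplane_lborel_def vec_insert_def)

context
  fixes a :: "real^'n"
  assumes a_pos: "\<And>i. a $ i > 0"
begin

lemma norm_diag_vec_insert:
  "(norm (diag a *v vec_insert i y t))\<^sup>2 = (a $ i * t)\<^sup>2 + (\<Sum>j\<in>- {i}. (a $ j * y j)\<^sup>2)"
proof -
  have U: "UNIV = insert i (- {i})" by auto
  have "(norm (diag a *v vec_insert i y t))\<^sup>2 = (\<Sum>j\<in>UNIV. (a $ j * vec_insert i y t $ j)\<^sup>2)"
    by (simp add: norm_vec_def L2_set_def sum_nonneg diag_mult_nth)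
  also have "\<dots> = (a $ i * t)\<^sup>2 + (\<Sum>j\<in>- {i}. (a $ j * y j)\<^sup>2)"
    by (subst U, subst sum.insert) (auto simp: vec_insert_nth intro!: sum.cong)
  finally show ?thesis .
qed

text \<open>
  On a patch the height \<open>g\<close> satisfies \<open>a\<^sub>i g\<^sup>2 + \<Sum> a\<^sub>j y\<^sub>j\<^sup>2 = 1\<close>. Differentiating along the hyperplane
  gives \<open>a\<^sub>i g \<partial>\<^sub>l g = - a\<^sub>l y\<^sub>l\<close>, so that \<open>(- \<nabla>g, 1)\<close> is the multiple \<open>1 / (a\<^sub>i g)\<close> of \<open>A \<theta>\<close>. If \<open>g\<close>
  vanished, so would all \<open>y\<^sub>l\<close>, against the equation.
\<close>

lemma patch_gradient:
  assumes P: "C1_graph_patch {x. norm_ell a x = 1} i U V g G" and y: "vec_insert i y 0 \<in> V"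
  defines "c \<equiv> g (vec_insert i y 0)"
  shows "a $ i * c\<^sup>2 + base_sum a i y = 1" "c \<noteq> 0"
    "sqrt (1 + (\<Sum>j\<in>- {i}. (G (vec_insert i y 0) $ j)\<^sup>2)) = norm (diag a *v vec_insert i y c) / (a $ i * \<bar>c\<bar>)"
proof -
  define p where "p = vec_insert i y 0"
  have V: "open V" and gd: "\<And>z. z \<in> V \<Longrightarrow> (g has_derivative (\<lambda>h. G z \<bullet> h)) (at z)"
    and SU: "{x. norm_ell a x = 1} \<inter> U = {set_coord z i (g z) | z. z \<in> V \<and> z $ i = 0}"
    using P by (auto simp: C1_graph_patch_def)
  have eq: "a $ i * (g z)\<^sup>2 + base_sum a i (($) z) = 1" if "z \<in> V" "z $ i = 0" for z
  proof -
    have "norm_ell a (set_coord z i (g z)) = 1" using SU that by blast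
    moreover have "set_coord z i (g z) = vec_insert i (($) z) (g z)"
      by (simp add: set_coord_def vec_insert_def)
    ultimately show ?thesis using norm_ell_vec_insert[OF a_pos, of i "($) z" "g z"] by simp
  qed
  have p: "p \<in> V" "p $ i = 0" using y by (auto simp: p_def vec_insert_nth)
  have base_p: "base_sum a i (($) p) = base_sum a i y"
    unfolding base_sum_def p_def by (intro sum.cong refl) (auto simp: vec_insert_nth)
  have c: "g p = c" by (simp add: c_def p_def)
  show 1: "a $ i * c\<^sup>2 + base_sum a i y = 1" using eq[OF p] by (simp add: base_p c)
  have grad: "a $ i * c * G p $ l = - (a $ l * y l)" if l: "l \<noteq> i" for l
  proof -
    define z where "z \<tau> = p + \<tau> *\<^sub>R axis l 1" for \<tau> :: real
    have z0: "z 0 = p" by (simp add: z_def)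
    have zn: "z \<tau> $ j = (if j = i then 0 else y j + \<tau> * (if j = l then 1 else 0))" for \<tau> j
      using l by (simp add: z_def p_def vec_insert_nth axis_def)
    have "(z has_derivative (\<lambda>\<tau>. \<tau> *\<^sub>R axis l 1)) (at 0)"
      unfolding z_def[abs_def] by (auto intro!: derivative_eq_intros)
    moreover have "(g has_derivative (\<lambda>h. G p \<bullet> h)) (at (z 0))" using gd[OF p(1)] by (simp add: z0)
    ultimately have "((\<lambda>\<tau>. g (z \<tau>)) has_derivative (\<lambda>\<tau>. G p \<bullet> (\<tau> *\<^sub>R axis l 1))) (at 0)"
      by (rule has_derivative_compose)
    then have dg: "((\<lambda>\<tau>. g (z \<tau>)) has_real_derivative G p $ l) (at 0)"
    proof -
      have "(\<lambda>\<tau>. G p \<bullet> (\<tau> *\<^sub>R axis l 1)) = (*) (G p $ l)"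
        by (simp add: fun_eq_iff inner_axis mult.commute)
      then show "((\<lambda>\<tau>. g (z \<tau>)) has_derivative (\<lambda>\<tau>. G p \<bullet> (\<tau> *\<^sub>R axis l 1))) (at 0) \<Longrightarrow> ?thesis"
        by (simp only: has_field_derivative_def)
    qed
    have "base_sum a i (($) (z \<tau>)) = (\<Sum>j\<in>- {i}. a $ j * (y j + \<tau> * (if j = l then 1 else 0))\<^sup>2)" for \<tau>
      unfolding base_sum_def by (intro sum.cong refl) (auto simp: zn)
    moreover have "((\<lambda>\<tau>. \<Sum>j\<in>- {i}. a $ j * (y j + \<tau> * (if j = l then 1 else 0))\<^sup>2) has_real_derivative
        (\<Sum>j\<in>- {i}. a $ j * (2 * y j * (if j = l then 1 else 0)))) (at 0)"
      by (auto intro!: derivative_eq_intros sum.cong)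
    moreover have "(\<Sum>j\<in>- {i}. a $ j * (2 * y j * (if j = l then 1 else 0))) = (\<Sum>j\<in>- {i}. if j = l then 2 * a $ l * y l else 0)"
      by (intro sum.cong refl) auto
    ultimately have db: "((\<lambda>\<tau>. base_sum a i (($) (z \<tau>))) has_real_derivative 2 * a $ l * y l) (at 0)"
      using l by simp
    have d1: "((\<lambda>\<tau>. a $ i * (g (z \<tau>))\<^sup>2 + base_sum a i (($) (z \<tau>))) has_real_derivative
        (a $ i * (2 * c * G p $ l) + 2 * a $ l * y l)) (at 0)"
      by (rule derivative_eq_intros dg db refl)+ (simp add: z0 c)
    have "\<forall>\<^sub>F \<tau> in nhds 0. z \<tau> \<in> V"
    proof -
      have "isCont z 0" unfolding z_def[abs_def] by (intro continuous_intros)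
      then show ?thesis using V p(1) by (auto simp: isCont_def z0 tendsto_def eventually_at_filter elim!: allE[of _ V] eventually_mono)
    qed
    then have "\<forall>\<^sub>F \<tau> in nhds 0. a $ i * (g (z \<tau>))\<^sup>2 + base_sum a i (($) (z \<tau>)) = 1"
      by eventually_elim (simp add: eq zn)
    then have "((\<lambda>\<tau>. a $ i * (g (z \<tau>))\<^sup>2 + base_sum a i (($) (z \<tau>))) has_real_derivative 0) (at 0)"
      by (subst DERIV_cong_ev[OF refl _ refl]) auto
    from DERIV_unique[OF d1 this] show ?thesis by simp
  qed
  show c0: "c \<noteq> 0"
  proof
    assume "c = 0"
    then have "y l = 0" if "l \<noteq> i" for l using grad[OF that] a_pos[of l] by simp
    then have "base_sum a i y = 0" by (simp add: base_sum_def)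
    then show False using 1 \<open>c = 0\<close> by simp
  qed
  have ac: "0 < a $ i * \<bar>c\<bar>" "a $ i \<noteq> 0" using a_pos[of i] c0 by simp_all
  have "(\<Sum>j\<in>- {i}. (G p $ j)\<^sup>2) = (\<Sum>j\<in>- {i}. (a $ j * y j)\<^sup>2 / (a $ i * c)\<^sup>2)"
  proof (rule sum.cong[OF refl])
    fix l assume "l \<in> - {i}"
    then have "G p $ l = - (a $ l * y l) / (a $ i * c)" using grad[of l] c0 a_pos[of i] by (simp add: field_simps)
    then show "(G p $ l)\<^sup>2 = (a $ l * y l)\<^sup>2 / (a $ i * c)\<^sup>2" by (simp add: power_divide)
  qed
  then have "1 + (\<Sum>j\<in>- {i}. (G p $ j)\<^sup>2) = ((a $ i * c)\<^sup>2 + (\<Sum>j\<in>- {i}. (a $ j * y j)\<^sup>2)) / (a $ i * c)\<^sup>2"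
    using ac c0 by (simp add: sum_divide_distrib add_divide_distrib)
  also have "\<dots> = (norm (diag a *v vec_insert i y c) / (a $ i * \<bar>c\<bar>))\<^sup>2"
    by (simp add: norm_diag_vec_insert power_divide power_mult_distrib)
  finally have "sqrt (1 + (\<Sum>j\<in>- {i}. (G p $ j)\<^sup>2)) = \<bar>norm (diag a *v vec_insert i y c) / (a $ i * \<bar>c\<bar>)\<bar>"
    by simp
  then show "sqrt (1 + (\<Sum>j\<in>- {i}. (G (vec_insert i y 0) $ j)\<^sup>2)) = norm (diag a *v vec_insert i y c) / (a $ i * \<bar>c\<bar>)"
    using ac by (simp add: p_def abs_of_nonneg)
qed

definition ell_surface :: "(real^'n) measure" where
  "ell_surface = density (cone_measure a) (\<lambda>\<theta>. ennreal (norm (diag a *v \<theta>)))"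

lemma measurable_norm_diag [measurable]: "(\<lambda>\<theta>. norm (diag a *v \<theta>)) \<in> borel_measurable borel"
  by (intro borel_measurable_continuous_onI continuous_intros matrix_vector_mult_linear_continuous_on)

lemma patch_measurable:
  assumes P: "C1_graph_patch S i U V g G" and [measurable]: "B \<in> sets borel"
  shows "(\<lambda>y. indicator B (set_coord y i (g y)) * ennreal (sqrt (1 + (\<Sum>j\<in>- {i}. (G y $ j)\<^sup>2))) * indicator V y)
    \<in> borel_measurable (borel :: (real^'n) measure)"
proof -
  have V: "open V" and gd: "\<And>z. z \<in> V \<Longrightarrow> (g has_derivative (\<lambda>h. G z \<bullet> h)) (at z)" and G: "continuous_on V G"
    using P by (auto simp: C1_graph_patch_def)
  have [measurable]: "V \<in> sets borel" using V by simp
  have "continuous_on V g"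
    using has_derivative_continuous[OF gd] by (intro continuous_at_imp_continuous_on) auto
  then have g [measurable]: "(\<lambda>y. if y \<in> V then g y else 0) \<in> borel_measurable borel"
    by (intro borel_measurable_continuous_on_if continuous_intros) auto
  have G [measurable]: "(\<lambda>y. if y \<in> V then G y else 0) \<in> borel_measurable borel"
    by (intro borel_measurable_continuous_on_if continuous_intros G) auto
  have [measurable]: "(\<lambda>y. set_coord y i (if y \<in> V then g y else 0)) \<in> borel_measurable borel"
    unfolding set_coord_def by (rule measurable_vec_lambda_PiM) measurable
  have "(\<lambda>y. indicator B (set_coord y i (g y)) * ennreal (sqrt (1 + (\<Sum>j\<in>- {i}. (G y $ j)\<^sup>2))) * indicator V y)
    = (\<lambda>y. indicator B (set_coord y i (if y \<in> V then g y else 0)) *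
        ennreal (sqrt (1 + (\<Sum>j\<in>- {i}. ((if y \<in> V then G y else 0) $ j)\<^sup>2))) * indicator V y :: ennreal)"
    by (auto simp: fun_eq_iff indicator_def)
  also have "\<dots> \<in> borel_measurable borel" by measurable
  finally show ?thesis .
qed

text \<open>
  An arbitrary patch is, over each base point, on one of the two standard hemispheres, because its height
  does not vanish. There the density of the cone measure is \<open>1 / (a\<^sub>i |g|)\<close>, and the surface element is
  \<open>|A \<theta>| / (a\<^sub>i |g|)\<close> by \<open>patch_gradient\<close>.
\<close>

lemma ell_surface_patch:
  assumes P: "C1_graph_patch {x. norm_ell a x = 1} i U V g G"
    and B [measurable]: "B \<in> sets borel" and BU: "B \<subseteq> {x. norm_ell a x = 1} \<inter> U"
  shows "emeasure ell_surface B = (\<integral>\<^sup>+y\<in>V. indicator B (set_coord y i (g y)) *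
             ennreal (sqrt (1 + (\<Sum>j\<in>- {i}. (G y $ j)\<^sup>2))) \<partial>hyperplane_lborel i)"
proof -
  define M where "M = (\<Pi>\<^sub>M j\<in>- {i}. (lborel :: real measure))"
  have [measurable_cong]: "sets (cone_measure a) = sets borel" by (rule sets_cone_measure[OF a_pos])
  have SU: "{x. norm_ell a x = 1} \<inter> U = {set_coord z i (g z) | z. z \<in> V \<and> z $ i = 0}"
    using P by (auto simp: C1_graph_patch_def)
  \<comment> \<open>A point of \<open>B\<close> determines its base point and its height, so at most one of the two signs of the
    height over a given base point belongs to \<open>B\<close>.\<close>
  have inB: "vec_insert i y 0 \<in> V \<and> g (vec_insert i y 0) = t" if t: "vec_insert i y t \<in> B" for y t
  proof -
    obtain z where z: "vec_insert i y t = set_coord z i (g z)" "z \<in> V" "z $ i = 0" using t BU SU by blast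
    have "z = vec_insert i y 0"
      unfolding vec_eq_iff
    proof
      fix j show "z $ j = vec_insert i y 0 $ j"
        using arg_cong[OF z(1), of "\<lambda>v. v $ j"] z(3) by (cases "j = i") (auto simp: vec_insert_nth set_coord_def)
    qed
    moreover have "g z = t" using arg_cong[OF z(1), of "\<lambda>v. v $ i"] by (simp add: vec_insert_nth set_coord_def)
    ultimately show ?thesis using z by simp
  qed
  define f where "f \<theta> = ennreal (norm (diag a *v \<theta>)) * indicator B \<theta>" for \<theta>
  have [measurable]: "f \<in> borel_measurable borel" unfolding f_def[abs_def] by measurable
  define R where "R y = indicator B (set_coord y i (g y)) * ennreal (sqrt (1 + (\<Sum>j\<in>- {i}. (G y $ j)\<^sup>2))) * indicator V y" for y
  have R [measurable]: "R \<in> borel_measurable borel" unfolding R_def[abs_def] by (rule patch_measurable[OF P B])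
  define W where "W \<sigma> y = indicator {y. base_sum a i y < 1} y * f (vec_insert i y (\<sigma> * cap_height a i y)) * ennreal (1 / (a $ i * cap_height a i y))" for \<sigma> y
  have W [measurable]: "W \<sigma> \<in> borel_measurable M" for \<sigma>
  proof -
    have vim [measurable]: "(\<lambda>y. vec_insert i y (h y)) \<in> borel_measurable M" if "h \<in> borel_measurable M" for h
      using measurable_vec_insert_id that unfolding M_def by blast
    have bM [measurable]: "base_sum a i \<in> borel_measurable M" "cap_height a i \<in> borel_measurable M" unfolding M_def by measurable
    have "Measurable.pred M (\<lambda>y. base_sum a i y < 1)" by measurable
    then have [measurable]: "(indicator {y. base_sum a i y < 1} :: _ \<Rightarrow> ennreal) \<in> borel_measurable M"
      by (simp add: borel_measurable_indicator_iff pred_def Int_def conj_commute)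
    show ?thesis unfolding W_def[abs_def] by measurable
  qed
  have [measurable]: "{\<theta>::real^'n. 0 < \<sigma> * \<theta> $ i} \<in> sets borel" for \<sigma> by measurable
  have "emeasure ell_surface B = (\<integral>\<^sup>+\<theta>. f \<theta> \<partial>cone_measure a)"
  proof -
    have "(\<lambda>\<theta>. ennreal (norm (diag a *v \<theta>))) \<in> borel_measurable (cone_measure a)" by measurable
    then show ?thesis
      unfolding ell_surface_def f_def by (rule emeasure_density) (simp add: sets_cone_measure[OF a_pos])
  qed
  also have "\<dots> = (\<integral>\<^sup>+\<theta>. f \<theta> * indicator {\<theta>. 0 < 1 * \<theta> $ i} \<theta> + f \<theta> * indicator {\<theta>. 0 < - 1 * \<theta> $ i} \<theta> \<partial>cone_measure a)"
  proof (rule nn_integral_cong)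
    fix \<theta> :: "real^'n"
    have "\<theta> $ i \<noteq> 0" if "\<theta> \<in> B"
    proof -
      have "vec_insert i (($) \<theta>) (\<theta> $ i) \<in> B" using that by (simp add: vec_insert_of_vec)
      from inB[OF this] show ?thesis using patch_gradient(2)[OF P] by metis
    qed
    then show "f \<theta> = f \<theta> * indicator {\<theta>. 0 < 1 * \<theta> $ i} \<theta> + f \<theta> * indicator {\<theta>. 0 < - 1 * \<theta> $ i} \<theta>"
      by (cases "\<theta> \<in> B") (auto simp: f_def indicator_def)
  qed
  also have "\<dots> = (\<integral>\<^sup>+\<theta>. f \<theta> * indicator {\<theta>. 0 < 1 * \<theta> $ i} \<theta> \<partial>cone_measure a) + (\<integral>\<^sup>+\<theta>. f \<theta> * indicator {\<theta>. 0 < - 1 * \<theta> $ i} \<theta> \<partial>cone_measure a)"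
    by (rule nn_integral_add) measurable
  also have "\<dots> = (\<integral>\<^sup>+y. W 1 y \<partial>M) + (\<integral>\<^sup>+y. W (- 1) y \<partial>M)"
    unfolding W_def M_def by (subst (1 2) nn_integral_cone_measure_cap[OF a_pos]) auto
  also have "\<dots> = (\<integral>\<^sup>+y. W 1 y + W (- 1) y \<partial>M)"
    by (rule nn_integral_add[symmetric]) measurable
  also have "\<dots> = (\<integral>\<^sup>+y. R (vec_insert i y 0) \<partial>M)"
  proof (rule nn_integral_cong)
    fix y
    show "W 1 y + W (- 1) y = R (vec_insert i y 0)"
    proof (cases "vec_insert i y 0 \<in> V")
      case False
      then have "f (vec_insert i y t) = 0" for t using inB[of y t] by (auto simp: f_def indicator_def)
      then show ?thesis using False by (simp add: W_def R_def)
    next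
      case True
      define c where "c = g (vec_insert i y 0)"
      note pg = patch_gradient[OF P True, folded c_def]
      have "0 < a $ i * c\<^sup>2" using pg(2) a_pos[of i] by simp
      then have b: "base_sum a i y < 1" using pg(1) by linarith
      have "1 - base_sum a i y = a $ i * c\<^sup>2" using pg(1) by linarith
      then have h: "cap_height a i y = \<bar>c\<bar>" using a_pos[of i] by (simp add: cap_height_def)
      have "vec_insert i y (- c) \<notin> B" using inB[of y "- c"] pg(2) by (auto simp: c_def)
      then have 0: "f (vec_insert i y (- c)) = 0" by (simp add: f_def)
      have "W 1 y + W (- 1) y = (f (vec_insert i y \<bar>c\<bar>) + f (vec_insert i y (- \<bar>c\<bar>))) * ennreal (1 / (a $ i * \<bar>c\<bar>))"
        using b by (simp add: W_def h distrib_right)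
      also have "f (vec_insert i y \<bar>c\<bar>) + f (vec_insert i y (- \<bar>c\<bar>)) = f (vec_insert i y c)"
        using 0 by (cases "0 \<le> c") (auto simp: abs_of_neg)
      also have "f (vec_insert i y c) * ennreal (1 / (a $ i * \<bar>c\<bar>)) =
          indicator B (vec_insert i y c) * (ennreal (norm (diag a *v vec_insert i y c)) * ennreal (1 / (a $ i * \<bar>c\<bar>)))"
        by (simp add: f_def mult_ac)
      also have "ennreal (norm (diag a *v vec_insert i y c)) * ennreal (1 / (a $ i * \<bar>c\<bar>)) = ennreal (norm (diag a *v vec_insert i y c) / (a $ i * \<bar>c\<bar>))"
        using a_pos[of i] by (subst ennreal_mult[symmetric]) (auto simp: less_imp_le)
      also have "norm (diag a *v vec_insert i y c) / (a $ i * \<bar>c\<bar>) = sqrt (1 + (\<Sum>j\<in>- {i}. (G (vec_insert i y 0) $ j)\<^sup>2))"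
        by (rule pg(3)[symmetric])
      finally show ?thesis using True by (simp add: R_def set_coord_vec_insert c_def)
    qed
  qed
  also have "\<dots> = (\<integral>\<^sup>+y. R y \<partial>hyperplane_lborel i)"
    unfolding hyperplane_lborel_eq M_def by (rule nn_integral_distr[symmetric]) measurable
  finally show ?thesis by (simp add: R_def)
qed

lemma is_surface_measure_ell_surface: "is_surface_measure {x. norm_ell a x = 1} ell_surface"
  unfolding is_surface_measure_def
proof (intro conjI allI impI ballI)
  have "AE \<theta> in ell_surface. norm_ell a \<theta> = 1"
    unfolding ell_surface_def using AE_cone_measure[OF a_pos]
    by (subst AE_density) (auto simp: measurable_cong_sets[OF sets_cone_measure[OF a_pos] refl] elim: eventually_mono)
  then have "{\<theta> \<in> space ell_surface. \<not> norm_ell a \<theta> = 1} \<in> null_sets ell_surface"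
    by (subst (asm) AE_iff_null) (auto simp: ell_surface_def space_cone_measure[OF a_pos] sets_cone_measure[OF a_pos])
  moreover have "{\<theta> \<in> space ell_surface. \<not> norm_ell a \<theta> = 1} = - {x. norm_ell a x = 1}"
    by (auto simp: ell_surface_def space_cone_measure[OF a_pos])
  ultimately show "- {x. norm_ell a x = 1} \<in> null_sets ell_surface" by simp
qed (auto simp: ell_surface_def sets_cone_measure[OF a_pos] intro!: ell_surface_patch[unfolded ell_surface_def])

lemma hemisphere_patch:
  fixes i :: 'n
  assumes \<sigma>: "\<sigma>\<^sup>2 = 1"
  shows "\<exists>V g G. C1_graph_patch {x. norm_ell a x = 1} i {x. 0 < \<sigma> * x $ i} V g G"
proof -
  have ai: "0 < a $ i" by (rule a_pos)
  define V where "V = {y::real^'n. base_sum a i (($) y) < 1}"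
  define g where "g y = \<sigma> * cap_height a i (($) y)" for y :: "real^'n"
  define G where "G y = (\<chi> l. if l = i then 0 else - (a $ l * y $ l) / (a $ i * g y))" for y :: "real^'n"
  have cb: "continuous_on UNIV (\<lambda>y::real^'n. base_sum a i (($) y))"
    unfolding base_sum_def by (intro continuous_intros)
  have pos: "0 < cap_height a i (($) y)" if "y \<in> V" for y
    using that cap_height_pos[OF a_pos] by (simp add: V_def)
  have gg: "g y * g y = (1 - base_sum a i (($) y)) / a $ i" if "y \<in> V" for y
  proof -
    have "(g y)\<^sup>2 = (cap_height a i (($) y))\<^sup>2" using \<sigma> by (simp add: g_def power_mult_distrib)
    then show ?thesis using that ai by (simp add: V_def cap_height_def power2_eq_square)
  qed
  have g0: "g y \<noteq> 0" if "y \<in> V" for y using pos[OF that] \<sigma> by (auto simp: g_def)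
  have "C1_graph_patch {x. norm_ell a x = 1} i {x. 0 < \<sigma> * x $ i} V g G"
    unfolding C1_graph_patch_def
  proof (intro conjI ballI)
    show "open {x::real^'n. 0 < \<sigma> * x $ i}" by (intro open_Collect_less continuous_intros)
    show "open V" unfolding V_def by (intro open_Collect_less cb continuous_intros)
    show "(g has_derivative (\<lambda>h. G y \<bullet> h)) (at y)" if y: "y \<in> V" for y
    proof -
      define b where "b = base_sum a i (($) y)"
      have b: "0 < (1 - b) / a $ i" using y ai by (simp add: V_def b_def)
      have nth: "((\<lambda>y::real^'n. y $ j) has_derivative (\<lambda>h. h $ j)) (at y)" for j
        by (rule bounded_linear_imp_has_derivative[OF bounded_linear_vec_nth])
      have sq: "((\<lambda>y::real^'n. a $ j * (y $ j)\<^sup>2) has_derivative (\<lambda>h. a $ j * (2 * (y $ j * h $ j)))) (at y)" for j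
        by (auto intro!: derivative_eq_intros nth simp: power2_eq_square algebra_simps)
      have db: "((\<lambda>y::real^'n. base_sum a i (($) y)) has_derivative (\<lambda>h. \<Sum>j\<in>- {i}. a $ j * (2 * (y $ j * h $ j)))) (at y)"
        unfolding base_sum_def by (intro has_derivative_sum sq)
      have "((\<lambda>y::real^'n. (1 - base_sum a i (($) y)) / a $ i) has_derivative (\<lambda>h. (0 - (\<Sum>j\<in>- {i}. a $ j * (2 * (y $ j * h $ j)))) / a $ i)) (at y)"
        by (intro bounded_linear.has_derivative[OF bounded_linear_divide] has_derivative_diff has_derivative_const db)
      from has_derivative_real_sqrt[OF _ this] b
      have "((\<lambda>y::real^'n. cap_height a i (($) y)) has_derivative
         (\<lambda>h. (0 - (\<Sum>j\<in>- {i}. a $ j * (2 * (y $ j * h $ j)))) / a $ i * (inverse (cap_height a i (($) y)) / 2))) (at y)"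
        unfolding cap_height_def b_def[symmetric] by (simp add: b_def)
      from has_derivative_mult_right[OF this, of \<sigma>]
      have "(g has_derivative (\<lambda>h. \<sigma> * ((0 - (\<Sum>j\<in>- {i}. a $ j * (2 * (y $ j * h $ j)))) / a $ i * (inverse (cap_height a i (($) y)) / 2)))) (at y)"
        unfolding g_def[abs_def] .
      moreover have "\<sigma> * ((0 - (\<Sum>j\<in>- {i}. a $ j * (2 * (y $ j * h $ j)))) / a $ i * (inverse (cap_height a i (($) y)) / 2)) = G y \<bullet> h" for h
      proof -
        have U: "UNIV = insert i (- {i})" by auto
        have "G y \<bullet> h = (\<Sum>j\<in>- {i}. - (a $ j * y $ j) / (a $ i * g y) * h $ j)"
          unfolding inner_vec_def by (subst U, subst sum.insert) (auto simp: G_def intro!: sum.cong)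
        moreover have "1 / g y = \<sigma> * inverse (cap_height a i (($) y))"
          using \<sigma> pos[OF y] unfolding g_def power2_eq_1_iff by (auto simp: divide_inverse)
        then have "- (a $ j * y $ j) / (a $ i * g y) * h $ j = \<sigma> * (- (a $ j * (2 * (y $ j * h $ j))) / a $ i * (inverse (cap_height a i (($) y)) / 2))" for j
        proof -
          assume e: "1 / g y = \<sigma> * inverse (cap_height a i (($) y))"
          have "- (a $ j * y $ j) / (a $ i * g y) * h $ j = - (a $ j * y $ j * h $ j) / a $ i * (1 / g y)" by simp
          then show ?thesis unfolding e by (simp add: mult_ac)
        qed
        ultimately have "G y \<bullet> h = (\<Sum>j\<in>- {i}. \<sigma> * (- (a $ j * (2 * (y $ j * h $ j))) / a $ i * (inverse (cap_height a i (($) y)) / 2)))"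
          by simp
        then show ?thesis
          by (simp add: sum_distrib_left sum_distrib_right sum_divide_distrib sum_negf)
      qed
      ultimately show ?thesis by simp
    qed
    show "continuous_on V G"
      unfolding G_def
    proof (intro continuous_on_vec_lambda)
      fix l
      have "continuous_on V g"
        unfolding g_def cap_height_def using ai by (intro continuous_intros continuous_on_subset[OF cb]) auto
      then have "continuous_on V (\<lambda>y. - (a $ l * y $ l) / (a $ i * g y))"
        using g0 ai by (intro continuous_intros) auto
      then show "continuous_on V (\<lambda>y. if l = i then 0 else - (a $ l * y $ l) / (a $ i * g y))"
        by (cases "l = i") auto
    qed
    show "{x. norm_ell a x = 1} \<inter> {x. 0 < \<sigma> * x $ i} = {set_coord y i (g y) |y. y \<in> V \<and> y $ i = 0}"
    proof (intro equalityI subsetI)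
      fix x assume "x \<in> {x. norm_ell a x = 1} \<inter> {x. 0 < \<sigma> * x $ i}"
      then have x: "norm_ell a x = 1" "0 < \<sigma> * x $ i" by auto
      define y where "y = vec_insert i (($) x) 0"
      have bsy: "base_sum a i (($) y) = base_sum a i (($) x)"
        unfolding base_sum_def y_def by (intro sum.cong refl) (auto simp: vec_insert_nth)
      have 1: "a $ i * (x $ i)\<^sup>2 + base_sum a i (($) x) = 1"
        using norm_ell_vec_insert[OF a_pos, of i "($) x" "x $ i"] x(1) by (simp add: vec_insert_of_vec)
      have "x $ i \<noteq> 0" using x(2) by auto
      then have "0 < a $ i * (x $ i)\<^sup>2" using ai by simp
      then have yV: "y \<in> V" using 1 by (simp add: V_def bsy)
      have "(1 - base_sum a i (($) y)) / a $ i = (x $ i)\<^sup>2" using 1 ai by (simp add: bsy field_simps)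
      then have h: "cap_height a i (($) y) = \<bar>x $ i\<bar>" by (simp add: cap_height_def)
      have "g y = x $ i" using \<sigma> x(2) unfolding g_def h power2_eq_1_iff by auto
      then have "x = set_coord y i (g y)" by (simp add: y_def set_coord_vec_insert vec_insert_of_vec)
      then show "x \<in> {set_coord y i (g y) |y. y \<in> V \<and> y $ i = 0}" using yV by (auto simp: y_def vec_insert_nth)
    next
      fix x assume "x \<in> {set_coord y i (g y) |y. y \<in> V \<and> y $ i = 0}"
      then obtain y where y: "x = set_coord y i (g y)" "y \<in> V" by blast
      have xi: "x = vec_insert i (($) y) (\<sigma> * cap_height a i (($) y))"
        by (simp add: y set_coord_def vec_insert_def g_def)
      have "norm_ell a x = 1" unfolding xi by (rule norm_ell_cap[OF a_pos _ \<sigma>]) (use y in \<open>simp add: V_def\<close>)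
      moreover have "\<sigma> * x $ i = cap_height a i (($) y)"
        using \<sigma> by (simp add: xi vec_insert_nth power2_eq_square mult.assoc[symmetric])
      ultimately show "x \<in> {x. norm_ell a x = 1} \<inter> {x. 0 < \<sigma> * x $ i}" using pos[OF y(2)] by simp
    qed
  qed
  then show ?thesis by blast
qed

text \<open>
  The open hemispheres \<open>\<plusminus> x\<^sub>i > 0\<close> are patches, on which the definition leaves no freedom, and finitely
  many of them cover the boundary of the ellipsoid.
\<close>

lemma is_surface_measure_unique:
  assumes \<mu>: "is_surface_measure {x. norm_ell a x = 1} \<mu>" and \<nu>: "is_surface_measure {x. norm_ell a x = 1} \<nu>"
  shows "\<mu> = \<nu>"
proof (rule measure_eqI)
  have sets [simp]: "sets \<mu> = sets borel" "sets \<nu> = sets borel"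
    using assms by (auto simp: is_surface_measure_def)
  then show "sets \<mu> = sets \<nu>" by simp
  define S where "S = {x. norm_ell a x = 1}"
  define H where "H p = {x::real^'n. 0 < snd p * x $ fst p}" for p :: "'n \<times> real"
  have Hm [measurable]: "H p \<in> sets borel" for p unfolding H_def by measurable
  have Sm [measurable]: "S \<in> sets borel" unfolding S_def by measurable
  have hemi: "emeasure \<mu> B = emeasure \<nu> B"
    if pB: "p \<in> UNIV \<times> {1, - 1}" "B \<in> sets borel" "B \<subseteq> S \<inter> H p" for p B
  proof -
    have "(snd p)\<^sup>2 = 1" using pB by auto
    from hemisphere_patch[OF this, of "fst p"] obtain V g G where
      P: "C1_graph_patch {x. norm_ell a x = 1} (fst p) {x. 0 < snd p * x $ fst p} V g G" by blast
    have "emeasure M B = (\<integral>\<^sup>+y\<in>V. indicator B (set_coord y (fst p) (g y)) *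
        ennreal (sqrt (1 + (\<Sum>j\<in>- {fst p}. (G y $ j)\<^sup>2))) \<partial>hyperplane_lborel (fst p))"
      if M: "is_surface_measure {x. norm_ell a x = 1} M" for M
    proof -
      have "\<forall>B\<in>sets borel. B \<subseteq> {x. norm_ell a x = 1} \<inter> {x. 0 < snd p * x $ fst p} \<longrightarrow>
        emeasure M B = (\<integral>\<^sup>+y\<in>V. indicator B (set_coord y (fst p) (g y)) *
          ennreal (sqrt (1 + (\<Sum>j\<in>- {fst p}. (G y $ j)\<^sup>2))) \<partial>hyperplane_lborel (fst p))"
        using M[unfolded is_surface_measure_def, THEN conjunct2, THEN conjunct2, rule_format, OF P] by simp
      then show ?thesis using pB(2,3) unfolding S_def H_def by simp
    qed
    from this[OF \<mu>] this[OF \<nu>] show ?thesis by simp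
  qed
  have union: "emeasure \<mu> B = emeasure \<nu> B"
    if "finite I" "I \<subseteq> UNIV \<times> {1, - 1}" "B \<in> sets borel" "B \<subseteq> S \<inter> (\<Union>p\<in>I. H p)" for I B
    using that
  proof (induction I arbitrary: B rule: finite_induct)
    case empty
    then show ?case by simp
  next
    case (insert p I)
    have B: "B = (B \<inter> H p) \<union> (B - H p)" "(B \<inter> H p) \<inter> (B - H p) = {}" by auto
    have m: "B \<inter> H p \<in> sets borel" "B - H p \<in> sets borel" using insert.prems by auto
    have "emeasure \<mu> (B \<inter> H p) = emeasure \<nu> (B \<inter> H p)"
      by (rule hemi[of p]) (use insert.prems m in auto)
    moreover have "emeasure \<mu> (B - H p) = emeasure \<nu> (B - H p)"
      by (rule insert.IH) (use insert.prems m in auto)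
    ultimately show ?case
      using plus_emeasure[of "B \<inter> H p" \<mu> "B - H p"] plus_emeasure[of "B \<inter> H p" \<nu> "B - H p"] m B by simp
  qed
  fix B assume "B \<in> sets \<mu>"
  then have [measurable]: "B \<in> sets borel" by simp
  have null: "emeasure M B = emeasure M (B \<inter> S)" if "is_surface_measure {x. norm_ell a x = 1} M" for M
  proof -
    have s: "sets M = sets borel" and n: "- S \<in> null_sets M" using that by (auto simp: is_surface_measure_def S_def)
    have "emeasure M (B - (- S)) = emeasure M B"
      by (rule emeasure_Diff_null_set[OF n]) (simp add: s)
    then show ?thesis by (simp add: Diff_eq)
  qed
  have cover: "B \<inter> S \<subseteq> S \<inter> (\<Union>p\<in>UNIV \<times> {1, - 1}. H p)"
  proof
    fix x assume x: "x \<in> B \<inter> S"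
    then have "x \<noteq> 0" using norm_ell_scaleR[of a 0 x] by (auto simp: S_def)
    then obtain i where "x $ i \<noteq> 0" by (auto simp: vec_eq_iff)
    then have "x \<in> H (i, 1) \<or> x \<in> H (i, - 1)" by (auto simp: H_def)
    then show "x \<in> S \<inter> (\<Union>p\<in>UNIV \<times> {1, - 1}. H p)" using x by blast
  qed
  have "emeasure \<mu> (B \<inter> S) = emeasure \<nu> (B \<inter> S)"
    by (rule union[OF _ _ _ cover]) auto
  then show "emeasure \<mu> B = emeasure \<nu> B" using null[OF \<mu>] null[OF \<nu>] by simp
qed

lemma surface_measure_ellipsoid:
  "surface_measure (frontier (ellipsoid a)) = density (cone_measure a) (\<lambda>\<theta>. ennreal (norm (diag a *v \<theta>)))"
  unfolding surface_measure_def frontier_ellipsoid[OF a_pos] ell_surface_def[symmetric]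
  by (rule the_equality, rule is_surface_measure_ell_surface,
      erule is_surface_measure_unique[OF _ is_surface_measure_ell_surface])

text \<open>
  The factor \<open>|A \<theta>|\<close> of the surface measure cancels.
\<close>

lemma mu_ell_eq:
  "mu_ell a s = density (cone_measure a) (\<lambda>\<theta>. ennreal (1 / norm \<theta> powr (real CARD('n) + 2 * s)))"
proof -
  have [measurable_cong]: "sets (cone_measure a) = sets borel" by (rule sets_cone_measure[OF a_pos])
  have "mu_ell a s = density (cone_measure a) (\<lambda>\<theta>. ennreal (norm (diag a *v \<theta>)) *
      ennreal (1 / (norm \<theta> powr (real CARD('n) + 2 * s) * norm (diag a *v \<theta>))))"
    unfolding mu_ell_def surface_measure_ellipsoid by (rule density_density_eq) measurable
  also have "\<dots> = density (cone_measure a) (\<lambda>\<theta>. ennreal (1 / norm \<theta> powr (real CARD('n) + 2 * s)))"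
  proof (rule density_cong)
    show "AE \<theta> in cone_measure a. ennreal (norm (diag a *v \<theta>)) * ennreal (1 / (norm \<theta> powr (real CARD('n) + 2 * s) * norm (diag a *v \<theta>)))
        = ennreal (1 / norm \<theta> powr (real CARD('n) + 2 * s))"
      using AE_cone_measure[OF a_pos]
    proof eventually_elim
      fix \<theta> assume "norm_ell a \<theta> = 1"
      then have "diag a *v \<theta> \<noteq> 0" by (auto simp: norm_ell_def)
      then show "ennreal (norm (diag a *v \<theta>)) * ennreal (1 / (norm \<theta> powr (real CARD('n) + 2 * s) * norm (diag a *v \<theta>)))
        = ennreal (1 / norm \<theta> powr (real CARD('n) + 2 * s))"
        by (subst ennreal_mult[symmetric]) auto
    qed
  qed measurable
  finally show ?thesis .
qed

end

section \<open>Symmetry, polar integration and chords\<close>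

definition reflect :: "'n \<Rightarrow> real^'n \<Rightarrow> real^'n" where
  "reflect k x = (\<chi> j. if j = k then - x $ j else x $ j)"

lemma measurable_reflect [measurable]: "reflect k \<in> borel_measurable borel"
  unfolding reflect_def[abs_def] by (rule measurable_vec_lambda_PiM) measurable

lemma nn_integral_reflect:
  fixes F :: "real^'n \<Rightarrow> ennreal"
  assumes [measurable]: "F \<in> borel_measurable borel"
  shows "(\<integral>\<^sup>+x. F (reflect k x) \<partial>lborel) = (\<integral>\<^sup>+x. F x \<partial>lborel)"
proof -
  have r: "reflect k (vec_insert k y t) = vec_insert k y (- t)" for y t
    by (simp add: reflect_def vec_eq_iff vec_insert_nth)
  have "(\<integral>\<^sup>+x. F (reflect k x) \<partial>lborel) = (\<integral>\<^sup>+y. (\<integral>\<^sup>+t. F (vec_insert k y (- t)) \<partial>lborel) \<partial>(\<Pi>\<^sub>M j\<in>- {k}. lborel))"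
    by (subst nn_integral_lborel_vec_insert[of _ k]) (simp_all add: r)
  also have "\<dots> = (\<integral>\<^sup>+y. (\<integral>\<^sup>+t. F (vec_insert k y t) \<partial>lborel) \<partial>(\<Pi>\<^sub>M j\<in>- {k}. lborel))"
  proof (rule nn_integral_cong)
    fix y assume y: "y \<in> space (\<Pi>\<^sub>M j\<in>- {k}. (lborel :: real measure))"
    then have c: "(\<lambda>v. y) \<in> lborel \<rightarrow>\<^sub>M PiM (- {k}) (\<lambda>_. lborel :: real measure)" by simp
    have m: "(\<lambda>t. F (vec_insert k y t)) \<in> borel_measurable borel"
      using measurable_vec_insert[OF c, of "\<lambda>t. t"] by simp
    show "(\<integral>\<^sup>+t. F (vec_insert k y (- t)) \<partial>lborel) = (\<integral>\<^sup>+t. F (vec_insert k y t) \<partial>lborel)"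
      using nn_integral_real_affine[OF m, of "- 1" 0] by simp
  qed
  also have "\<dots> = (\<integral>\<^sup>+x. F x \<partial>lborel)"
    by (rule nn_integral_lborel_vec_insert[symmetric]) measurable
  finally show ?thesis .
qed

context
  fixes a :: "real^'n"
  assumes a_pos: "\<And>i. a $ i > 0"
begin

lemma norm_ell_reflect: "norm_ell a (reflect k x) = norm_ell a x"
proof -
  have "(norm_ell a (reflect k x))\<^sup>2 = (norm_ell a x)\<^sup>2"
    unfolding norm_ell_sq[OF a_pos] by (intro sum.cong) (auto simp: reflect_def)
  then show ?thesis using norm_ell_nonneg[OF a_pos] by (metis power2_eq_iff_nonneg)
qed

lemma distr_reflect_cone_measure: "distr (cone_measure a) borel (reflect k) = cone_measure a"
proof (rule measure_eqI)
  have [measurable_cong]: "sets (cone_measure a) = sets borel" by (rule sets_cone_measure[OF a_pos])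
  fix B assume "B \<in> sets (distr (cone_measure a) borel (reflect k))"
  then have [measurable]: "B \<in> sets borel" by simp
  have D: "norm_ell a (reflect k x) = norm_ell a x" for x by (rule norm_ell_reflect)
  have sc: "reflect k (c *\<^sub>R x) = c *\<^sub>R reflect k x" for c x by (simp add: reflect_def vec_eq_iff)
  define F where "F x = ennreal (real CARD('n)) * indicator {x. 0 < norm_ell a x \<and> norm_ell a x \<le> 1} x * indicator B (x /\<^sub>R norm_ell a x)" for x
  have [measurable]: "F \<in> borel_measurable borel" unfolding F_def[abs_def] by measurable
  have "emeasure (distr (cone_measure a) borel (reflect k)) B = (\<integral>\<^sup>+\<theta>. indicator B \<theta> \<partial>distr (cone_measure a) borel (reflect k))"
    by simp
  also have "\<dots> = (\<integral>\<^sup>+\<theta>. indicator B (reflect k \<theta>) \<partial>cone_measure a)"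
    by (rule nn_integral_distr) measurable
  also have "\<dots> = (\<integral>\<^sup>+x. F (reflect k x) \<partial>lborel)"
    by (subst nn_integral_cone_measure[OF a_pos]) (simp_all add: F_def D sc indicator_def)
  also have "\<dots> = (\<integral>\<^sup>+x. F x \<partial>lborel)" by (rule nn_integral_reflect) measurable
  also have "\<dots> = (\<integral>\<^sup>+\<theta>. indicator B \<theta> \<partial>cone_measure a)"
    by (subst nn_integral_cone_measure[OF a_pos]) (simp_all add: F_def[abs_def])
  also have "\<dots> = emeasure (cone_measure a) B" by (simp add: sets_cone_measure[OF a_pos])
  finally show "emeasure (distr (cone_measure a) borel (reflect k)) B = emeasure (cone_measure a) B" .
qed (simp add: sets_cone_measure[OF a_pos])

text \<open>
  The polar formula as an identity of measures, which transfers it to signed functions.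
\<close>

lemma lborel_polar:
  "(lborel :: (real^'n) measure) = distr (density (cone_measure a \<Otimes>\<^sub>M lborel) (\<lambda>p. ennreal (exp (real CARD('n) * snd p))))
     borel (\<lambda>p. exp (snd p) *\<^sub>R fst p)"
proof (rule measure_eqI)
  have sc [measurable_cong]: "sets (cone_measure a) = sets borel" by (rule sets_cone_measure[OF a_pos])
  interpret finite_measure "cone_measure a" by (rule finite_cone_measure[OF a_pos])
  interpret pair_sigma_finite "cone_measure a" "lborel :: real measure" ..
  fix B :: "(real^'n) set" assume "B \<in> sets lborel"
  then have [measurable]: "B \<in> sets borel" by simp
  have "emeasure lborel B = (\<integral>\<^sup>+x. indicator B x \<partial>(lborel :: (real^'n) measure))" by simp
  also have "\<dots> = (\<integral>\<^sup>+\<theta>. (\<integral>\<^sup>+\<xi>. ennreal (exp (real CARD('n) * \<xi>)) * indicator B (exp \<xi> *\<^sub>R \<theta>) \<partial>lborel) \<partial>cone_measure a)"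
    by (rule polar_coordinates[OF a_pos]) measurable
  also have "\<dots> = (\<integral>\<^sup>+p. ennreal (exp (real CARD('n) * snd p)) * indicator B (exp (snd p) *\<^sub>R fst p) \<partial>(cone_measure a \<Otimes>\<^sub>M lborel))"
    using lborel.nn_integral_fst[of "\<lambda>p. ennreal (exp (real CARD('n) * snd p)) * indicator B (exp (snd p) *\<^sub>R fst p)" "cone_measure a"]
    by simp
  also have "\<dots> = (\<integral>\<^sup>+x. indicator B x \<partial>distr (density (cone_measure a \<Otimes>\<^sub>M lborel) (\<lambda>p. ennreal (exp (real CARD('n) * snd p))))
     borel (\<lambda>p. exp (snd p) *\<^sub>R fst p))"
    by (subst nn_integral_distr, measurable, subst nn_integral_density) simp_all
  also have "\<dots> = emeasure (distr (density (cone_measure a \<Otimes>\<^sub>M lborel) (\<lambda>p. ennreal (exp (real CARD('n) * snd p))))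
     borel (\<lambda>p. exp (snd p) *\<^sub>R fst p)) B"
    by simp
  finally show "emeasure lborel B = emeasure (distr (density (cone_measure a \<Otimes>\<^sub>M lborel) (\<lambda>p. ennreal (exp (real CARD('n) * snd p))))
     borel (\<lambda>p. exp (snd p) *\<^sub>R fst p)) B" .
qed simp

lemma integral_polar:
  fixes F :: "real^'n \<Rightarrow> real"
  assumes [measurable]: "F \<in> borel_measurable borel"
    and fin: "(\<integral>\<^sup>+\<theta>. (\<integral>\<^sup>+\<xi>. ennreal \<bar>exp (real CARD('n) * \<xi>) * F (exp \<xi> *\<^sub>R \<theta>)\<bar> \<partial>lborel) \<partial>cone_measure a) < \<infinity>"
  shows "(\<integral>x. F x \<partial>lborel) = (\<integral>\<theta>. (\<integral>\<xi>. exp (real CARD('n) * \<xi>) * F (exp \<xi> *\<^sub>R \<theta>) \<partial>lborel) \<partial>cone_measure a)"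
proof -
  have [measurable_cong]: "sets (cone_measure a) = sets borel" by (rule sets_cone_measure[OF a_pos])
  interpret finite_measure "cone_measure a" by (rule finite_cone_measure[OF a_pos])
  interpret pair_sigma_finite "cone_measure a" "lborel :: real measure" ..
  let ?H = "\<lambda>p. exp (real CARD('n) * snd p) * F (exp (snd p) *\<^sub>R fst p)"
  have "integrable (cone_measure a \<Otimes>\<^sub>M lborel) ?H"
  proof (rule integrableI_bounded)
    show "?H \<in> borel_measurable (cone_measure a \<Otimes>\<^sub>M lborel)" by measurable
    have "(\<integral>\<^sup>+p. ennreal (norm (?H p)) \<partial>(cone_measure a \<Otimes>\<^sub>M lborel))
      = (\<integral>\<^sup>+\<theta>. (\<integral>\<^sup>+\<xi>. ennreal \<bar>exp (real CARD('n) * \<xi>) * F (exp \<xi> *\<^sub>R \<theta>)\<bar> \<partial>lborel) \<partial>cone_measure a)"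
      using lborel.nn_integral_fst[of "\<lambda>p. ennreal (norm (?H p))" "cone_measure a"] by simp
    then show "(\<integral>\<^sup>+p. ennreal (norm (?H p)) \<partial>(cone_measure a \<Otimes>\<^sub>M lborel)) < \<infinity>" using fin by simp
  qed
  from integral_fst'[OF this]
  have "(\<integral>\<theta>. (\<integral>\<xi>. exp (real CARD('n) * \<xi>) * F (exp \<xi> *\<^sub>R \<theta>) \<partial>lborel) \<partial>cone_measure a) = (\<integral>p. ?H p \<partial>(cone_measure a \<Otimes>\<^sub>M lborel))"
    by simp
  also have "\<dots> = (\<integral>x. F x \<partial>lborel)"
    by (subst lborel_polar, subst integral_distr, measurable, subst integral_density) simp_all
  finally show ?thesis by simp
qed

lemma cauchy_schwarz_ell: "\<bar>(diag a *v x) \<bullet> \<theta>\<bar> \<le> norm_ell a x * norm_ell a \<theta>"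
proof -
  define v where "v z = (\<chi> i. sqrt (a $ i) * z $ i)" for z :: "real^'n"
  have s: "sqrt (a $ i) * sqrt (a $ i) = a $ i" for i using a_pos[of i] by simp
  have vv: "v y \<bullet> v z = (diag a *v y) \<bullet> z" for y z
  proof -
    have "v y $ i * v z $ i = (sqrt (a $ i) * sqrt (a $ i)) * y $ i * z $ i" for i
      by (simp add: v_def del: real_sqrt_mult_self)
    then show ?thesis unfolding diag_inner by (simp add: inner_vec_def s del: real_sqrt_mult_self)
  qed
  have n: "norm (v z) = norm_ell a z" for z by (simp add: norm_eq_sqrt_inner vv norm_ell_def)
  show ?thesis using Cauchy_Schwarz_ineq2[of "v x" "v \<theta>"] by (simp add: vv n)
qed

lemma norm_ell_add_sq: "(norm_ell a (x + y))\<^sup>2 = (norm_ell a x)\<^sup>2 + 2 * ((diag a *v x) \<bullet> y) + (norm_ell a y)\<^sup>2"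
  unfolding norm_ell_sq[OF a_pos] diag_inner sum_distrib_left sum.distrib[symmetric]
  by (intro sum.cong) (auto simp: power2_eq_square algebra_simps)

text \<open>
  In direction \<open>\<theta>\<close> the chord of the ellipsoid through \<open>x\<close> consists of the points \<open>x + t \<theta>\<close> with
  \<open>|t + chord_centre x \<theta>| < chord_radius x \<theta>\<close>.
\<close>

definition chord_centre :: "real^'n \<Rightarrow> real^'n \<Rightarrow> real" where
  "chord_centre x \<theta> = (diag a *v x) \<bullet> \<theta>"

definition chord_radius :: "real^'n \<Rightarrow> real^'n \<Rightarrow> real" where
  "chord_radius x \<theta> = sqrt (1 - (norm_ell a x)\<^sup>2 + (chord_centre x \<theta>)\<^sup>2)"

context
  fixes x \<theta> :: "real^'n"
  assumes x: "norm_ell a x < 1" and \<theta>: "norm_ell a \<theta> = 1"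
begin

lemma chord_radius_sq: "(chord_radius x \<theta>)\<^sup>2 = 1 - (norm_ell a x)\<^sup>2 + (chord_centre x \<theta>)\<^sup>2"
  and chord_radius_pos: "0 < chord_radius x \<theta>"
proof -
  have "(norm_ell a x)\<^sup>2 < 1" using x norm_ell_nonneg[OF a_pos, of x] by (simp add: abs_square_less_1)
  moreover have "0 \<le> (chord_centre x \<theta>)\<^sup>2" by simp
  ultimately have "0 < 1 - (norm_ell a x)\<^sup>2 + (chord_centre x \<theta>)\<^sup>2" by linarith
  then show "(chord_radius x \<theta>)\<^sup>2 = 1 - (norm_ell a x)\<^sup>2 + (chord_centre x \<theta>)\<^sup>2" "0 < chord_radius x \<theta>"
    unfolding chord_radius_def by (rule real_sqrt_pow2[OF less_imp_le], rule real_sqrt_gt_zero)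
qed

lemma chord_centre_le: "\<bar>chord_centre x \<theta>\<bar> \<le> norm_ell a x"
  using cauchy_schwarz_ell[of x \<theta>] by (simp add: chord_centre_def \<theta>)

lemma chord_centre_sq_le: "(chord_centre x \<theta>)\<^sup>2 \<le> (norm_ell a x)\<^sup>2"
  using power_mono[OF chord_centre_le, of 2] by simp

lemma chord_radius_le_1: "chord_radius x \<theta> \<le> 1"
proof (rule power2_le_imp_le)
  show "(chord_radius x \<theta>)\<^sup>2 \<le> 1\<^sup>2"
    using chord_centre_sq_le unfolding chord_radius_sq one_power2 by linarith
qed simp

text \<open>
  The position of \<open>x\<close> on the chord, scaled to \<open>(-1, 1)\<close>, stays away from the end points uniformly in the
  direction.
\<close>

lemma chord_ratio_le: "\<bar>chord_centre x \<theta> / chord_radius x \<theta>\<bar> \<le> norm_ell a x"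
proof -
  have r: "(norm_ell a x)\<^sup>2 \<le> 1" using x norm_ell_nonneg[OF a_pos, of x] by (simp add: abs_square_le_1)
  define B where "B = (chord_centre x \<theta>)\<^sup>2"
  define r where "r = (norm_ell a x)\<^sup>2"
  have "B * (1 - r) \<le> r * (1 - r)"
    using chord_centre_sq_le \<open>(norm_ell a x)\<^sup>2 \<le> 1\<close> unfolding B_def r_def by (intro mult_right_mono) auto
  then have "B \<le> r * (1 - r + B)" by (simp add: algebra_simps)
  then have "(chord_centre x \<theta>)\<^sup>2 \<le> (norm_ell a x * chord_radius x \<theta>)\<^sup>2"
    by (simp add: power_mult_distrib chord_radius_sq B_def r_def)
  then have "\<bar>chord_centre x \<theta>\<bar>\<^sup>2 \<le> (norm_ell a x * chord_radius x \<theta>)\<^sup>2" by simp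
  moreover have "0 \<le> norm_ell a x * chord_radius x \<theta>"
    using chord_radius_pos norm_ell_nonneg[OF a_pos, of x] by simp
  ultimately have "\<bar>chord_centre x \<theta>\<bar> \<le> norm_ell a x * chord_radius x \<theta>" by (rule power2_le_imp_le)
  then show ?thesis using chord_radius_pos by (simp add: field_simps)
qed

lemma u_ell_on_line:
  "u_ell a s (x + t *\<^sub>R \<theta>) = chord_radius x \<theta> powr (2 * s) * cap_pow s 0 (chord_centre x \<theta> / chord_radius x \<theta> + t / chord_radius x \<theta>)"
proof -
  define b where "b = chord_centre x \<theta>"
  define R where "R = chord_radius x \<theta>"
  have R: "0 < R" "R\<^sup>2 = 1 - (norm_ell a x)\<^sup>2 + b\<^sup>2" using chord_radius_pos chord_radius_sq by (auto simp: R_def b_def)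
  have "(norm_ell a (x + t *\<^sub>R \<theta>))\<^sup>2 = (norm_ell a x)\<^sup>2 + 2 * (t * b) + t\<^sup>2"
    by (simp add: norm_ell_add_sq norm_ell_scaleR \<theta> b_def chord_centre_def)
  then have "1 - (norm_ell a (x + t *\<^sub>R \<theta>))\<^sup>2 = R\<^sup>2 - (b + t)\<^sup>2"
    unfolding R(2) by (simp add: power2_eq_square algebra_simps)
  also have "\<dots> = R\<^sup>2 * (1 - (b / R + t / R)\<^sup>2)"
    using R(1) by (simp add: add_divide_distrib[symmetric] power_divide right_diff_distrib)
  finally have "max 0 (1 - (norm_ell a (x + t *\<^sub>R \<theta>))\<^sup>2) = R\<^sup>2 * max 0 (1 - (b / R + t / R)\<^sup>2)"
    using R(1) by (simp add: max_mult_distrib_left)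
  moreover have "(R\<^sup>2) powr s = R powr (2 * s)"
    using R(1) by (simp add: powr_powr[symmetric] powr_numeral)
  ultimately show ?thesis
    unfolding u_ell_def cap_pow_def R_def[symmetric] b_def[symmetric]
    by (simp only: powr_mult zero_le_power2 max.cobounded1 power_0 mult_1)
qed

lemma finite_diff_on_line:
  fixes U :: "real^'n \<Rightarrow> real"
  assumes U: "\<And>z. U z = (1 - sqrt (a $ k) * z $ k) * u_ell a s z"
  shows "finite_diff m U x (t *\<^sub>R \<theta>) = chord_radius x \<theta> powr (2 * s) *
    ((1 - sqrt (a $ k) * (x $ k - chord_centre x \<theta> * \<theta> $ k)) *
       cap_diff m s 0 (chord_centre x \<theta> / chord_radius x \<theta>) (t / chord_radius x \<theta>) -
     sqrt (a $ k) * \<theta> $ k * chord_radius x \<theta> *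
       cap_diff m s 1 (chord_centre x \<theta> / chord_radius x \<theta>) (t / chord_radius x \<theta>))"
proof -
  define b where "b = chord_centre x \<theta>"
  define R where "R = chord_radius x \<theta>"
  have R: "0 < R" using chord_radius_pos by (simp add: R_def)
  define A where "A = 1 - sqrt (a $ k) * (x $ k - b * \<theta> $ k)"
  define B where "B = sqrt (a $ k) * \<theta> $ k * R"
  have summand: "U (x + of_int j *\<^sub>R (t *\<^sub>R \<theta>)) = R powr (2 * s) *
      (A * cap_pow s 0 (b / R + of_int j * (t / R)) - B * cap_pow s 1 (b / R + of_int j * (t / R)))" for j :: int
  proof -
    define \<tau> where "\<tau> = b / R + of_int j * (t / R)"
    have c1: "cap_pow s 1 \<tau> = \<tau> * cap_pow s 0 \<tau>" by (simp add: cap_pow_def)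
    have \<tau>: "R * \<tau> = b + of_int j * t" using R by (simp add: \<tau>_def field_simps)
    have "x + of_int j *\<^sub>R (t *\<^sub>R \<theta>) = x + (of_int j * t) *\<^sub>R \<theta>" by simp
    then have "U (x + of_int j *\<^sub>R (t *\<^sub>R \<theta>)) = (1 - sqrt (a $ k) * (x $ k + of_int j * t * \<theta> $ k)) * (R powr (2 * s) * cap_pow s 0 \<tau>)"
      by (simp add: U u_ell_on_line \<tau>_def R_def b_def)
    also have "1 - sqrt (a $ k) * (x $ k + of_int j * t * \<theta> $ k) = A - B * \<tau>"
    proof -
      have jt: "of_int j * t = R * \<tau> - b" using \<tau> by simp
      show ?thesis unfolding jt A_def B_def by (simp add: algebra_simps)
    qed
    finally show ?thesis unfolding \<tau>_def[symmetric] c1 by (simp add: algebra_simps)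
  qed
  have "finite_diff m U x (t *\<^sub>R \<theta>) = (\<Sum>j = - int m..int m. dcoef m j * (R powr (2 * s) *
      (A * cap_pow s 0 (b / R + of_int j * (t / R)) - B * cap_pow s 1 (b / R + of_int j * (t / R)))))"
    unfolding finite_diff_def summand dcoef_def ..
  also have "\<dots> = R powr (2 * s) * (A * cap_diff m s 0 (b / R) (t / R) - B * cap_diff m s 1 (b / R) (t / R))"
    unfolding cap_diff_def sum_distrib_left sum_subtractf[symmetric] by (intro sum.cong refl) (simp add: algebra_simps)
  finally show ?thesis by (simp add: A_def B_def R_def b_def)
qed

end

end

section \<open>Integration over all directions\<close>

lemma measurable_u_ell [measurable]: "u_ell a s \<in> borel_measurable borel"
  unfolding u_ell_def[abs_def] by measurable

lemma measurable_finite_diff [measurable]: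
  fixes u :: "real^'n \<Rightarrow> real"
  assumes [measurable]: "u \<in> borel_measurable borel"
  shows "finite_diff m u x \<in> borel_measurable borel"
  unfolding finite_diff_def[abs_def] by measurable

context
  fixes a :: "real^'n"
  assumes a_pos: "\<And>i. a $ i > 0"
begin

context
  fixes x \<theta> :: "real^'n" and U :: "real^'n \<Rightarrow> real" and s :: real and m :: nat and k :: 'n
  assumes x: "norm_ell a x < 1" and \<theta>: "norm_ell a \<theta> = 1" and s: "0 < s" "s < real m"
    and U: "\<And>z. U z = (1 - sqrt (a $ k) * z $ k) * u_ell a s z"
begin

text \<open>
  The integrand along the chord after rescaling the step by the radius of the chord; in logarithmic
  coordinates the rescaling is a translation.
\<close>

definition chord_profile :: "real \<Rightarrow> real" where
  "chord_profile \<eta> =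
    (1 - sqrt (a $ k) * (x $ k - chord_centre a x \<theta> * \<theta> $ k)) *
      (exp (- 2 * s * \<eta>) * cap_diff m s 0 (chord_centre a x \<theta> / chord_radius a x \<theta>) (exp \<eta>)) -
    sqrt (a $ k) * \<theta> $ k * chord_radius a x \<theta> *
      (exp (- 2 * s * \<eta>) * cap_diff m s 1 (chord_centre a x \<theta> / chord_radius a x \<theta>) (exp \<eta>))"

lemma finite_diff_chord_profile:
  "exp (- 2 * s * \<xi>) * finite_diff m U x (exp \<xi> *\<^sub>R \<theta>) = chord_profile (- ln (chord_radius a x \<theta>) + 1 * \<xi>)"
proof -
  define R where "R = chord_radius a x \<theta>"
  have R: "0 < R" using chord_radius_pos[OF a_pos x \<theta>] by (simp add: R_def)
  have e: "exp (- ln R + 1 * \<xi>) = exp \<xi> / R" using R by (simp add: exp_diff)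
  have E: "exp (- 2 * s * \<xi>) * R powr (2 * s) = exp (- 2 * s * (- ln R + 1 * \<xi>))"
    using R by (simp add: powr_def exp_add[symmetric] algebra_simps)
  have alg: "E * (P * (A * c - B * d)) = A * ((E * P) * c) - B * ((E * P) * d)" for E P A B c d :: real
    by (simp add: algebra_simps)
  show ?thesis
    unfolding finite_diff_on_line[OF a_pos x \<theta> U] chord_profile_def R_def[symmetric] e alg E ..
qed

lemma integral_along_ray:
  "(\<integral>\<xi>. exp (- 2 * s * \<xi>) * finite_diff m U x (exp \<xi> *\<^sub>R \<theta>) \<partial>lborel) =
    line_const m s * (1 - sqrt (a $ k) * x $ k - 2 * s * sqrt (a $ k) * (chord_centre a x \<theta> * \<theta> $ k))"
proof -
  define R where "R = chord_radius a x \<theta>"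
  define b where "b = chord_centre a x \<theta>"
  have R: "0 < R" using chord_radius_pos[OF a_pos x \<theta>] by (simp add: R_def)
  have lt: "\<bar>b / R\<bar> < 1" using chord_ratio_le[OF a_pos x \<theta>] x by (simp add: b_def R_def)
  note c0 = cap_diff_log_integral[OF lt s, of 0, simplified]
  note c1 = cap_diff_log_integral[OF lt s, of 1, simplified]
  have "(\<integral>\<xi>. exp (- 2 * s * \<xi>) * finite_diff m U x (exp \<xi> *\<^sub>R \<theta>) \<partial>lborel) = (\<integral>\<xi>. chord_profile (- ln R + 1 * \<xi>) \<partial>lborel)"
    unfolding finite_diff_chord_profile R_def ..
  also have "\<dots> = (\<integral>\<eta>. chord_profile \<eta> \<partial>lborel)"
    using lborel_integral_real_affine[of 1 chord_profile "- ln R"] by simp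
  also have "\<dots> = (1 - sqrt (a $ k) * (x $ k - b * \<theta> $ k)) * line_const m s
      - sqrt (a $ k) * \<theta> $ k * R * ((1 + 2 * s) * (b / R) * line_const m s)"
    unfolding chord_profile_def b_def[symmetric] R_def[symmetric]
    using c0 c1 by simp
  also have "\<dots> = line_const m s * (1 - sqrt (a $ k) * x $ k - 2 * s * sqrt (a $ k) * (b * \<theta> $ k))"
    using R by (simp add: algebra_simps)
  finally show ?thesis by (simp add: b_def)
qed

lemma nn_integral_along_ray_le:
  assumes r: "\<bar>\<theta> $ k\<bar> \<le> r"
  shows "(\<integral>\<^sup>+\<xi>. ennreal \<bar>exp (- 2 * s * \<xi>) * finite_diff m U x (exp \<xi> *\<^sub>R \<theta>)\<bar> \<partial>lborel) \<le>
    ennreal (1 + sqrt (a $ k) * (\<bar>x $ k\<bar> + 2 * r)) *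
      (\<integral>\<^sup>+\<eta>. ennreal (diff_majorant m s ((1 - norm_ell a x) / (4 * real m)) \<eta>) \<partial>lborel)"
proof -
  define R where "R = chord_radius a x \<theta>"
  define b where "b = chord_centre a x \<theta>"
  define D where "D = diff_majorant m s ((1 - norm_ell a x) / (4 * real m))"
  have R: "0 < R" "R \<le> 1" using chord_radius_pos[OF a_pos x \<theta>] chord_radius_le_1[OF a_pos x \<theta>] by (auto simp: R_def)
  have b: "\<bar>b\<bar> \<le> 1" using chord_centre_le[OF a_pos x \<theta>] x by (simp add: b_def)
  have r0: "0 \<le> r" using r by (meson abs_ge_zero order_trans)
  have ak: "0 \<le> sqrt (a $ k)" using a_pos[of k] by simp
  have m: "0 < real m" using s by linarith
  have [measurable]: "D \<in> borel_measurable borel" by (simp add: D_def)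
  have bth: "\<bar>b * \<theta> $ k\<bar> \<le> r" unfolding abs_mult using mult_mono[OF b r] by simp
  have A: "\<bar>1 - sqrt (a $ k) * (x $ k - b * \<theta> $ k)\<bar> \<le> 1 + sqrt (a $ k) * (\<bar>x $ k\<bar> + r)"
  proof -
    have "\<bar>1 - sqrt (a $ k) * (x $ k - b * \<theta> $ k)\<bar> \<le> 1 + \<bar>sqrt (a $ k) * (x $ k - b * \<theta> $ k)\<bar>"
      using abs_triangle_ineq4[of 1 "sqrt (a $ k) * (x $ k - b * \<theta> $ k)"] by simp
    also have "\<bar>sqrt (a $ k) * (x $ k - b * \<theta> $ k)\<bar> \<le> sqrt (a $ k) * (\<bar>x $ k\<bar> + r)"
      unfolding abs_mult using ak bth by (intro mult_mono) auto
    finally show ?thesis by simp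
  qed
  have B: "\<bar>sqrt (a $ k) * \<theta> $ k * R\<bar> \<le> sqrt (a $ k) * r"
  proof -
    have "\<bar>\<theta> $ k\<bar> * R \<le> r * 1" using r R r0 by (intro mult_mono) auto
    then have "sqrt (a $ k) * (\<bar>\<theta> $ k\<bar> * R) \<le> sqrt (a $ k) * (r * 1)" by (rule mult_left_mono[OF _ ak])
    then show ?thesis using ak R by (simp add: abs_mult mult.assoc)
  qed
  have prof: "\<bar>chord_profile \<eta>\<bar> \<le> (1 + sqrt (a $ k) * (\<bar>x $ k\<bar> + 2 * r)) * D \<eta>" for \<eta>
  proof -
    note maj = cap_diff_majorant[OF chord_ratio_le[OF a_pos x \<theta>] x s]
    have D0: "0 \<le> D \<eta>" using maj[of \<eta> 0] abs_ge_zero unfolding D_def by (rule order_trans[rotated])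
    have "\<bar>chord_profile \<eta>\<bar> \<le>
      \<bar>1 - sqrt (a $ k) * (x $ k - b * \<theta> $ k)\<bar> * \<bar>exp (- 2 * s * \<eta>) * cap_diff m s 0 (b / R) (exp \<eta>)\<bar> +
      \<bar>sqrt (a $ k) * \<theta> $ k * R\<bar> * \<bar>exp (- 2 * s * \<eta>) * cap_diff m s 1 (b / R) (exp \<eta>)\<bar>"
      unfolding chord_profile_def b_def[symmetric] R_def[symmetric] abs_mult[symmetric] by (rule abs_triangle_ineq4)
    also have "\<dots> \<le> (1 + sqrt (a $ k) * (\<bar>x $ k\<bar> + r)) * D \<eta> + (sqrt (a $ k) * r) * D \<eta>"
      unfolding D_def b_def R_def
      using A B maj D0 ak r0 by (intro add_mono mult_mono) (auto simp: b_def R_def D_def)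
    finally show ?thesis by (simp add: algebra_simps)
  qed
  have "(\<integral>\<^sup>+\<xi>. ennreal \<bar>exp (- 2 * s * \<xi>) * finite_diff m U x (exp \<xi> *\<^sub>R \<theta>)\<bar> \<partial>lborel)
     \<le> (\<integral>\<^sup>+\<xi>. ennreal ((1 + sqrt (a $ k) * (\<bar>x $ k\<bar> + 2 * r)) * D (- ln R + 1 * \<xi>)) \<partial>lborel)"
    unfolding finite_diff_chord_profile R_def[symmetric] using prof by (intro nn_integral_mono ennreal_leI)
  also have "\<dots> = (\<integral>\<^sup>+\<eta>. ennreal ((1 + sqrt (a $ k) * (\<bar>x $ k\<bar> + 2 * r)) * D \<eta>) \<partial>lborel)"
    by (subst (2) nn_integral_real_affine[of _ 1 "- ln R"]) auto
  also have "\<dots> = ennreal (1 + sqrt (a $ k) * (\<bar>x $ k\<bar> + 2 * r)) * (\<integral>\<^sup>+\<eta>. ennreal (D \<eta>) \<partial>lborel)"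
    using ak r0 by (subst nn_integral_cmult[symmetric]) (auto simp: ennreal_mult' intro!: nn_integral_cong)
  finally show ?thesis by (simp add: D_def)
qed

end

definition radial_weight :: "real \<Rightarrow> real^'n \<Rightarrow> real" where
  "radial_weight s \<theta> = 1 / norm \<theta> powr (real CARD('n) + 2 * s)"

lemma measurable_radial_weight [measurable]: "radial_weight s \<in> borel_measurable borel"
  unfolding radial_weight_def[abs_def] by measurable

lemma sphere_bounds:
  assumes \<theta>: "norm_ell a \<theta> = 1"
  shows "norm \<theta> \<le> 1 / sqrt (Min (range (($) a)))" "1 / sqrt (Max (range (($) a))) \<le> norm \<theta>"
proof -
  have "0 < Max (range (($) a))" using a_pos by (subst Max_gr_iff) auto
  then show "norm \<theta> \<le> 1 / sqrt (Min (range (($) a)))" "1 / sqrt (Max (range (($) a))) \<le> norm \<theta>"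
    using norm_ell_lower[OF a_pos, of \<theta>] norm_ell_upper[OF a_pos, of \<theta>] Min_range_pos[OF a_pos] \<theta>
    by (simp_all add: field_simps)
qed

lemma radial_weight_bound:
  assumes "0 < s"
  obtains W where "0 \<le> W" "\<And>\<theta>. norm_ell a \<theta> = 1 \<Longrightarrow> 0 \<le> radial_weight s \<theta> \<and> radial_weight s \<theta> \<le> W"
proof
  define r where "r = 1 / sqrt (Max (range (($) a)))"
  have "0 < Max (range (($) a))" using a_pos by (subst Max_gr_iff) auto
  then have r: "0 < r" by (simp add: r_def)
  show "0 \<le> 1 / r powr (real CARD('n) + 2 * s)" by simp
  show "0 \<le> radial_weight s \<theta> \<and> radial_weight s \<theta> \<le> 1 / r powr (real CARD('n) + 2 * s)" if "norm_ell a \<theta> = 1" for \<theta>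
  proof -
    have "r powr (real CARD('n) + 2 * s) \<le> norm \<theta> powr (real CARD('n) + 2 * s)"
      using r sphere_bounds(2)[OF that] assms by (intro powr_mono2) (auto simp: r_def)
    then show ?thesis using r unfolding radial_weight_def by (auto intro!: divide_left_mono mult_pos_pos)
  qed
qed

lemma integrable_cone_measure:
  fixes f :: "real^'n \<Rightarrow> real"
  assumes [measurable]: "f \<in> borel_measurable borel" and "\<And>\<theta>. norm_ell a \<theta> = 1 \<Longrightarrow> \<bar>f \<theta>\<bar> \<le> C"
  shows "integrable (cone_measure a) f"
proof -
  have [measurable_cong]: "sets (cone_measure a) = sets borel" by (rule sets_cone_measure[OF a_pos])
  interpret finite_measure "cone_measure a" by (rule finite_cone_measure[OF a_pos])
  show ?thesis
    by (rule integrable_const_bound[where B = C])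
      (use AE_cone_measure[OF a_pos] assms(2) in \<open>auto elim!: eventually_mono\<close>)
qed

lemma integrable_weighted_products:
  assumes "0 < s"
  shows "integrable (cone_measure a) (radial_weight s)"
    "integrable (cone_measure a) (\<lambda>\<theta>. radial_weight s \<theta> * (\<theta> $ j * \<theta> $ k))"
proof -
  obtain W where W: "0 \<le> W" "\<And>\<theta>. norm_ell a \<theta> = 1 \<Longrightarrow> 0 \<le> radial_weight s \<theta> \<and> radial_weight s \<theta> \<le> W"
    using radial_weight_bound[OF assms] by blast
  show "integrable (cone_measure a) (radial_weight s)"
    by (rule integrable_cone_measure[where C = W]) (use W in auto)
  define r where "r = 1 / sqrt (Min (range (($) a)))"
  show "integrable (cone_measure a) (\<lambda>\<theta>. radial_weight s \<theta> * (\<theta> $ j * \<theta> $ k))"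
  proof (rule integrable_cone_measure[where C = "W * (r * r)"])
    fix \<theta> assume \<theta>: "norm_ell a \<theta> = 1"
    have n: "\<bar>\<theta> $ i\<bar> \<le> r" for i
      using component_le_norm_cart[of \<theta> i] sphere_bounds(1)[OF \<theta>] by (simp add: r_def)
    have "0 \<le> r" using n[of j] abs_ge_zero order_trans by blast
    then have "\<bar>\<theta> $ j\<bar> * \<bar>\<theta> $ k\<bar> \<le> r * r" using n by (intro mult_mono) auto
    then show "\<bar>radial_weight s \<theta> * (\<theta> $ j * \<theta> $ k)\<bar> \<le> W * (r * r)"
      unfolding abs_mult by (rule mult_mono[rotated]) (use W \<theta> \<open>0 \<le> r\<close> in auto)
  qed measurable
qed

text \<open>
  The reflection in the \<open>k\<close>-th coordinate preserves the cone measure and the norm, and changes the sign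
  of the product.
\<close>

lemma integral_weighted_mixed_product:
  assumes "j \<noteq> k"
  shows "(\<integral>\<theta>. radial_weight s \<theta> * (\<theta> $ j * \<theta> $ k) \<partial>cone_measure a) = 0"
proof -
  have [measurable_cong]: "sets (cone_measure a) = sets borel" by (rule sets_cone_measure[OF a_pos])
  define f where "f \<theta> = radial_weight s \<theta> * (\<theta> $ j * \<theta> $ k)" for \<theta>
  have [measurable]: "f \<in> borel_measurable borel" unfolding f_def[abs_def] by measurable
  have n: "norm (reflect k \<theta>) = norm \<theta>" for \<theta> :: "real^'n"
    unfolding norm_vec_def L2_set_def by (intro arg_cong[of _ _ sqrt] sum.cong) (auto simp: reflect_def)
  have r: "f (reflect k \<theta>) = - f \<theta>" for \<theta>
    using assms by (simp add: f_def radial_weight_def n) (simp add: reflect_def)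
  have "(\<integral>\<theta>. f \<theta> \<partial>cone_measure a) = (\<integral>\<theta>. f \<theta> \<partial>distr (cone_measure a) borel (reflect k))"
    by (simp only: distr_reflect_cone_measure[OF a_pos])
  also have "\<dots> = (\<integral>\<theta>. f (reflect k \<theta>) \<partial>cone_measure a)"
    by (rule integral_distr) measurable
  also have "\<dots> = - (\<integral>\<theta>. f \<theta> \<partial>cone_measure a)" by (simp add: r)
  finally show ?thesis by (simp add: f_def)
qed

lemma integral_mu_ell:
  fixes f :: "real^'n \<Rightarrow> real"
  assumes [measurable]: "f \<in> borel_measurable borel"
  shows "(LINT \<theta>:frontier (ellipsoid a)|mu_ell a s. f \<theta>) = (\<integral>\<theta>. radial_weight s \<theta> * f \<theta> \<partial>cone_measure a)"
proof -
  have [measurable_cong]: "sets (cone_measure a) = sets borel" by (rule sets_cone_measure[OF a_pos])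
  define S where "S = {x. norm_ell a x = 1}"
  have [measurable]: "S \<in> sets borel" unfolding S_def by measurable
  have f: "(\<lambda>\<theta>. indicat_real S \<theta> *\<^sub>R f \<theta>) \<in> borel_measurable (cone_measure a)" by measurable
  have w: "radial_weight s \<in> borel_measurable (cone_measure a)" by measurable
  have "AE \<theta> in cone_measure a. 0 \<le> radial_weight s \<theta>" by (simp add: radial_weight_def)
  from integral_density[OF f w this]
  have "(LINT \<theta>:frontier (ellipsoid a)|mu_ell a s. f \<theta>)
    = (\<integral>\<theta>. radial_weight s \<theta> *\<^sub>R (indicat_real S \<theta> *\<^sub>R f \<theta>) \<partial>cone_measure a)"
    unfolding set_lebesgue_integral_def mu_ell_eq[OF a_pos] frontier_ellipsoid[OF a_pos] radial_weight_def S_def .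
  also have "\<dots> = (\<integral>\<theta>. radial_weight s \<theta> * f \<theta> \<partial>cone_measure a)"
  proof (rule integral_cong_AE)
    show "AE \<theta> in cone_measure a. radial_weight s \<theta> *\<^sub>R (indicat_real S \<theta> *\<^sub>R f \<theta>) = radial_weight s \<theta> * f \<theta>"
      using AE_cone_measure[OF a_pos] by eventually_elim (simp add: S_def)
  qed measurable
  finally show ?thesis .
qed

lemma finite_diff_integral:
  fixes U :: "real^'n \<Rightarrow> real"
  assumes x: "norm_ell a x < 1" and s: "0 < s" "s < real m"
    and U: "\<And>z. U z = (1 - sqrt (a $ k) * z $ k) * u_ell a s z"
  shows "(\<integral>y. finite_diff m U x y / norm y powr (real CARD('n) + 2 * s) \<partial>lborel) =
    line_const m s * (J0 a s - (J0 a s + 2 * s * J a s 1 k) * sqrt (a $ k) * x $ k)"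
proof -
  define p where "p = real CARD('n) + 2 * s"
  define F where "F y = finite_diff m U x y / norm y powr p" for y
  have sc [measurable_cong]: "sets (cone_measure a) = sets borel" by (rule sets_cone_measure[OF a_pos])
  have [measurable]: "U \<in> borel_measurable borel" unfolding U[abs_def] by measurable
  have Fm [measurable]: "F \<in> borel_measurable borel" unfolding F_def[abs_def] by measurable
  \<comment> \<open>The polar factor \<open>exp (n \<xi>)\<close> cancels against \<open>|y|\<^sup>n\<close> and leaves the one-dimensional weight.\<close>
  have ray: "exp (real CARD('n) * \<xi>) * F (exp \<xi> *\<^sub>R \<theta>) = radial_weight s \<theta> * (exp (- 2 * s * \<xi>) * finite_diff m U x (exp \<xi> *\<^sub>R \<theta>))" for \<xi> \<theta>
  proof -
    have n: "norm (exp \<xi> *\<^sub>R \<theta>) powr p = exp (p * \<xi>) * norm \<theta> powr p"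
      by (simp add: powr_mult exp_powr_real mult.commute)
    have e: "exp (real CARD('n) * \<xi>) / exp (p * \<xi>) = exp (- 2 * s * \<xi>)"
      by (simp add: exp_diff[symmetric] p_def algebra_simps)
    have alg: "c * (d / (E * P)) = 1 / P * ((c / E) * d)" for c d E P :: real by simp
    show ?thesis unfolding F_def radial_weight_def p_def[symmetric] n alg e ..
  qed
  obtain W where W: "0 \<le> W" "\<And>\<theta>. norm_ell a \<theta> = 1 \<Longrightarrow> 0 \<le> radial_weight s \<theta> \<and> radial_weight s \<theta> \<le> W"
    using radial_weight_bound[OF s(1)] by blast
  define r where "r = 1 / sqrt (Min (range (($) a)))"
  have m: "0 < real m" using s by linarith
  define D where "D = (\<integral>\<^sup>+\<eta>. ennreal (diff_majorant m s ((1 - norm_ell a x) / (4 * real m)) \<eta>) \<partial>lborel)"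
  have D: "D < \<infinity>" unfolding D_def by (rule nn_integral_diff_majorant[OF s]) (use x m in simp)
  define C where "C = ennreal W * (ennreal (1 + sqrt (a $ k) * (\<bar>x $ k\<bar> + 2 * r)) * D)"
  have fin: "(\<integral>\<^sup>+\<theta>. (\<integral>\<^sup>+\<xi>. ennreal \<bar>exp (real CARD('n) * \<xi>) * F (exp \<xi> *\<^sub>R \<theta>)\<bar> \<partial>lborel) \<partial>cone_measure a) < \<infinity>"
  proof -
    have "(\<integral>\<^sup>+\<theta>. (\<integral>\<^sup>+\<xi>. ennreal \<bar>exp (real CARD('n) * \<xi>) * F (exp \<xi> *\<^sub>R \<theta>)\<bar> \<partial>lborel) \<partial>cone_measure a)
      \<le> (\<integral>\<^sup>+\<theta>. C \<partial>cone_measure a)"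
    proof (rule nn_integral_mono_AE)
      show "AE \<theta> in cone_measure a. (\<integral>\<^sup>+\<xi>. ennreal \<bar>exp (real CARD('n) * \<xi>) * F (exp \<xi> *\<^sub>R \<theta>)\<bar> \<partial>lborel) \<le> C"
        using AE_cone_measure[OF a_pos]
      proof eventually_elim
        fix \<theta> assume \<theta>: "norm_ell a \<theta> = 1"
        have n: "\<bar>\<theta> $ k\<bar> \<le> r"
          using component_le_norm_cart[of \<theta> k] sphere_bounds(1)[OF \<theta>] by (simp add: r_def)
        have "(\<integral>\<^sup>+\<xi>. ennreal \<bar>exp (real CARD('n) * \<xi>) * F (exp \<xi> *\<^sub>R \<theta>)\<bar> \<partial>lborel)
          = (\<integral>\<^sup>+\<xi>. ennreal (radial_weight s \<theta>) * ennreal \<bar>exp (- 2 * s * \<xi>) * finite_diff m U x (exp \<xi> *\<^sub>R \<theta>)\<bar> \<partial>lborel)"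
          unfolding ray using W(2)[OF \<theta>] by (intro nn_integral_cong) (simp add: abs_mult[of "radial_weight s \<theta>"] ennreal_mult)
        also have "\<dots> = ennreal (radial_weight s \<theta>) * (\<integral>\<^sup>+\<xi>. ennreal \<bar>exp (- 2 * s * \<xi>) * finite_diff m U x (exp \<xi> *\<^sub>R \<theta>)\<bar> \<partial>lborel)"
          by (rule nn_integral_cmult) measurable
        also have "\<dots> \<le> C"
          unfolding C_def D_def using W(2)[OF \<theta>]
          by (intro mult_mono ennreal_leI nn_integral_along_ray_le[OF x \<theta> s U n]) auto
        finally show "(\<integral>\<^sup>+\<xi>. ennreal \<bar>exp (real CARD('n) * \<xi>) * F (exp \<xi> *\<^sub>R \<theta>)\<bar> \<partial>lborel) \<le> C" .
      qed
    qed
    also have "\<dots> = C * emeasure (cone_measure a) (space (cone_measure a))" by simp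
    also have "\<dots> < \<infinity>"
      using D finite_measure.emeasure_finite[OF finite_cone_measure[OF a_pos]]
      by (simp add: C_def ennreal_mult_less_top less_top[symmetric] ennreal_mult_eq_top_iff)
    finally show ?thesis .
  qed
  define I where "I j = (\<integral>\<theta>. radial_weight s \<theta> * (\<theta> $ j * \<theta> $ k) \<partial>cone_measure a)" for j
  have I0: "I j = 0" if "j \<noteq> k" for j unfolding I_def by (rule integral_weighted_mixed_product[OF that])
  have J0: "J0 a s = (\<integral>\<theta>. radial_weight s \<theta> \<partial>cone_measure a)"
    unfolding J0_def by (subst integral_mu_ell) simp_all
  have J1: "J a s 1 k = a $ k * I k"
    unfolding J_def I_def by (subst integral_mu_ell) (simp_all add: power2_eq_square)
  note int = integrable_weighted_products[OF s(1)]
  have "(\<integral>y. F y \<partial>lborel) = (\<integral>\<theta>. (\<integral>\<xi>. exp (real CARD('n) * \<xi>) * F (exp \<xi> *\<^sub>R \<theta>) \<partial>lborel) \<partial>cone_measure a)"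
    by (rule integral_polar[OF a_pos Fm fin])
  also have "\<dots> = (\<integral>\<theta>. line_const m s * ((1 - sqrt (a $ k) * x $ k) * radial_weight s \<theta>
      - 2 * s * sqrt (a $ k) * (\<Sum>j\<in>UNIV. a $ j * x $ j * (radial_weight s \<theta> * (\<theta> $ j * \<theta> $ k)))) \<partial>cone_measure a)"
  proof (rule integral_cong_AE)
    show "AE \<theta> in cone_measure a. (\<integral>\<xi>. exp (real CARD('n) * \<xi>) * F (exp \<xi> *\<^sub>R \<theta>) \<partial>lborel) =
      line_const m s * ((1 - sqrt (a $ k) * x $ k) * radial_weight s \<theta>
      - 2 * s * sqrt (a $ k) * (\<Sum>j\<in>UNIV. a $ j * x $ j * (radial_weight s \<theta> * (\<theta> $ j * \<theta> $ k))))"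
      using AE_cone_measure[OF a_pos]
    proof eventually_elim
      fix \<theta> assume \<theta>: "norm_ell a \<theta> = 1"
      have "(\<integral>\<xi>. exp (real CARD('n) * \<xi>) * F (exp \<xi> *\<^sub>R \<theta>) \<partial>lborel)
        = radial_weight s \<theta> * (line_const m s * (1 - sqrt (a $ k) * x $ k - 2 * s * sqrt (a $ k) * (chord_centre a x \<theta> * \<theta> $ k)))"
        unfolding ray using integral_along_ray[OF x \<theta> s U] by simp
      moreover have "(\<Sum>j\<in>UNIV. a $ j * x $ j * (radial_weight s \<theta> * (\<theta> $ j * \<theta> $ k))) = radial_weight s \<theta> * (chord_centre a x \<theta> * \<theta> $ k)"
        unfolding chord_centre_def[OF a_pos] diag_inner sum_distrib_left sum_distrib_right by (intro sum.cong refl) (simp add: mult_ac)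
      ultimately show "(\<integral>\<xi>. exp (real CARD('n) * \<xi>) * F (exp \<xi> *\<^sub>R \<theta>) \<partial>lborel) =
        line_const m s * ((1 - sqrt (a $ k) * x $ k) * radial_weight s \<theta>
        - 2 * s * sqrt (a $ k) * (\<Sum>j\<in>UNIV. a $ j * x $ j * (radial_weight s \<theta> * (\<theta> $ j * \<theta> $ k))))"
        by (simp add: algebra_simps)
    qed
  qed measurable
  also have "\<dots> = line_const m s * ((1 - sqrt (a $ k) * x $ k) * J0 a s - 2 * s * sqrt (a $ k) * (\<Sum>j\<in>UNIV. a $ j * x $ j * I j))"
  proof -
    have i: "integrable (cone_measure a) (\<lambda>\<theta>. a $ j * x $ j * (radial_weight s \<theta> * (\<theta> $ j * \<theta> $ k)))" for j
      by (rule integrable_mult_right[OF int(2)])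
    have "(\<integral>\<theta>. (\<Sum>j\<in>UNIV. a $ j * x $ j * (radial_weight s \<theta> * (\<theta> $ j * \<theta> $ k))) \<partial>cone_measure a) = (\<Sum>j\<in>UNIV. a $ j * x $ j * I j)"
      unfolding I_def by (subst Bochner_Integration.integral_sum[OF i]) simp
    then show ?thesis
      unfolding J0
      by (simp only: integral_mult_right_zero
          Bochner_Integration.integral_diff[OF integrable_mult_right[OF int(1)] integrable_mult_right[OF Bochner_Integration.integrable_sum[OF i]]])
  qed
  also have "(\<Sum>j\<in>UNIV. a $ j * x $ j * I j) = a $ k * x $ k * I k"
  proof -
    have "(\<Sum>j\<in>UNIV. a $ j * x $ j * I j) = (\<Sum>j\<in>UNIV. if j = k then a $ k * x $ k * I k else 0)"
      by (intro sum.cong refl) (auto simp: I0)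
    then show ?thesis by simp
  qed
  also have "line_const m s * ((1 - sqrt (a $ k) * x $ k) * J0 a s - 2 * s * sqrt (a $ k) * (a $ k * x $ k * I k))
     = line_const m s * (J0 a s - (J0 a s + 2 * s * J a s 1 k) * sqrt (a $ k) * x $ k)"
    unfolding J1 by (simp add: algebra_simps)
  finally show ?thesis by (simp add: F_def p_def)
qed

end

theorem lemma3p6:
  fixes a x :: "real^'n" and s :: real and k :: 'n and m :: nat
    and U :: "real^'n \<Rightarrow> real"
  assumes a_pos: "\<And>i. a $ i > 0"
    and s_pos: "s > 0"
    and m_gt: "real m > s"
    and U_def: "\<And>z. U z = (1 - sqrt (a $ k) * z $ k) * u_ell a s z"
    and x_in: "x \<in> ellipsoid a"
  shows "frac_laplacian m s U x / (k_const CARD('n) s * Gamma (1 + s)) =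
         J0 a s - (J0 a s + 2 * s * J a s 1 k) * sqrt (a $ k) * x $ k"
proof -
  have x: "norm_ell a x < 1" using x_in by (simp add: ellipsoid_def)
  have "0 < k_const CARD('n) s * Gamma (1 + s)"
    unfolding k_const_def using s_pos by (intro mult_pos_pos divide_pos_pos Gamma_real_pos) (auto intro: add_nonneg_pos)
  then have "k_const CARD('n) s * Gamma (1 + s) \<noteq> 0" by (metis less_irrefl)
  moreover have "frac_laplacian m s U x = (frac_const CARD('n) m s / 2 * line_const m s) *
      (J0 a s - (J0 a s + 2 * s * J a s 1 k) * sqrt (a $ k) * x $ k)"
    unfolding frac_laplacian_def finite_diff_integral[OF a_pos x s_pos m_gt U_def] by (simp only: mult.assoc)
  ultimately show ?thesis
    unfolding frac_const_line_const[OF s_pos m_gt] by (metis nonzero_mult_div_cancel_left)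
qed

end
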